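(* Let $1<p<N$, $p+m-3>0$, and let $g\in C([0,+\infty))\cap C^1((0,+\infty))$, $g(0)=0$, $g(s)>0$ for $s>0$, satisfy, for given $0<\alpha_1\le\alpha_2<p$, $$\alpha_1\frac{g(s)}{s}\le g'(s)\le\alpha_2\frac{g(s)}{s},\qquad s>0;$$ set $f(x)=e^{g(|x|)}$. Then there exist a positive function $\rho\in C([0,+\infty))$ and a transformation of the radial space variable $r=\hat r(s)$, where $\hat r:[0,+\infty)\to[0,+\infty)$ is an increasing bijection, such that radial solutions $U(r,t)$, $r=|x|$, [respectively, radial supersolutions and subsolutions] of $$f(x)\,\frac{\partial u}{\partial t}-\operatorname{div}\big(f(x)u^{m-1}|\nabla u|^{p-2}\nabla u\big)=0,\qquad x\in\mathbb R^N,\ t>0,$$ correspond, through $v(s,t)=U(\hat r(s),t)$, to radial solutions $v(s,t)$, $s=|x|$, [respectively, radial supersolutions and subsolutions] of $$\rho(|x|)\,\frac{\partial v}{\partial t}=\operatorname{div}\big(v^{m-1}|\nabla v|^{p-2}\nabla v\big),\qquad x\in\mathbb R^N,\ t>0.$$ Moreover $\rho(0)=1$, $$\rho(s)\sim\frac{g^{(-1)}(\log s)^p}{(\log s)^p}\,\frac1{s^p},$$ and $$\hat r(s)\sim g^{(-1)}(\log s).$$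
   Context: $g^{(-1)}$ is the inverse function of $g$. For positive functions $F_1,F_2$, the notation $F_1(s)\sim F_2(s)$ means that there exist constants $C_1,C_2,\bar s>0$ such that $C_1\le F_2(s)/F_1(s)\le C_2$ for all $s\ge\bar s$. $S_\infty=\mathbb R^N\times(0,+\infty)$. $L^1_f(\mathbb R^N)$ and $L^1_\rho(\mathbb R^N)$ denote the $L^1$ spaces with respect to the measures $f(x)\,dx$ and $\rho(|x|)\,dx$. A function $u\ge0$ is a (weak) solution to the first equation if $u\in C([0,+\infty);L^1_f(\mathbb R^N))\cap L^\infty(\mathbb R^N\times(\bar t,+\infty))$ for all $\bar t>0$, $\nabla u^{\frac{p+m-2}{p-1}}\in L^p_{\mathrm{loc}}(S_\infty)$, and for all $\eta\in C_0^\infty(S_\infty)$ $$\int_0^{+\infty}\!\!\int_{\mathbb R^N}\{-u\eta_t+u^{m-1}|\nabla u|^{p-2}\nabla u\cdot\nabla\eta\}f(x)\,dx\,dt=0.$$ Solutions $v\ge0$ to the second equation are understood in the analogous sense: $v\in C([0,+\infty);L^1_\rho(\mathbb R^N))\cap L^\infty(\mathbb R^N\times(\bar t,+\infty))$ for all $\bar t>0$, $\nabla v^{\frac{p+m-2}{p-1}}\in L^p_{\mathrm{loc}}(S_\infty)$, and for all $\eta\in C_0^\infty(S_\infty)$ $$\int_0^{+\infty}\!\!\int_{\mathbb R^N}\{-\rho(|x|)\,v\,\eta_t+v^{m-1}|\nabla v|^{p-2}\nabla v\cdot\nabla\eta\}\,dx\,dt=0.$$ Supersolutions [subsolutions] are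 defined similarly, requiring for all $\eta\ge0$ the inequality sign $\ge$ [$\le$] in place of equality in the integral identities. *)

theory Defs
  imports "HOL-Analysis.Analysis"
begin

text \<open>Functions \<open>u(x,t)\<close> are curried; functions of the space-time point \<open>z = (x,t)\<close>, such as test
  functions and weak gradients, are defined on pairs.\<close>

definition S_inf :: "((real ^ 'n) \<times> real) set" where
  "S_inf = UNIV \<times> {0<..}"

primrec Ck :: "nat \<Rightarrow> ('a::euclidean_space \<Rightarrow> real) \<Rightarrow> bool" where
  "Ck 0 h \<longleftrightarrow> continuous_on UNIV h"
| "Ck (Suc k) h \<longleftrightarrow>
    (\<forall>x. h differentiable (at x)) \<and> (\<forall>v. Ck k (\<lambda>x. frechet_derivative h (at x) v))"

text \<open>\<open>C\<^sub>0\<^sup>\<infinity>(S_inf)\<close>; its elements are extended by zero to all of space-time.\<close>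

definition test_fun :: "((real ^ 'n) \<times> real \<Rightarrow> real) \<Rightarrow> bool" where
  "test_fun \<eta> \<longleftrightarrow> (\<forall>k. Ck k \<eta>) \<and>
     compact (closure {z. \<eta> z \<noteq> 0}) \<and> closure {z. \<eta> z \<noteq> 0} \<subseteq> S_inf"

definition time_deriv :: "((real ^ 'n) \<times> real \<Rightarrow> real) \<Rightarrow> (real ^ 'n) \<times> real \<Rightarrow> real" where
  "time_deriv \<eta> z = frechet_derivative \<eta> (at z) (0, 1)"

definition space_grad :: "((real ^ 'n) \<times> real \<Rightarrow> real) \<Rightarrow> (real ^ 'n) \<times> real \<Rightarrow> real ^ 'n" where
  "space_grad \<eta> z = (\<chi> i. frechet_derivative \<eta> (at z) (axis i 1, 0))"

definition Lp_loc ::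
  "real \<Rightarrow> ((real ^ 'n) \<times> real \<Rightarrow> 'b::{real_normed_vector, second_countable_topology}) \<Rightarrow> bool" where
  "Lp_loc q w \<longleftrightarrow> w \<in> borel_measurable (lebesgue_on S_inf) \<and>
     (\<forall>K. compact K \<and> K \<subseteq> S_inf \<longrightarrow> integrable (lebesgue_on K) (\<lambda>z. norm (w z) powr q))"

definition weak_space_grad ::
  "((real ^ 'n) \<times> real \<Rightarrow> real) \<Rightarrow> ((real ^ 'n) \<times> real \<Rightarrow> real ^ 'n) \<Rightarrow> bool" where
  "weak_space_grad w G \<longleftrightarrow> Lp_loc 1 w \<and> Lp_loc 1 G \<and>
     (\<forall>\<phi>. test_fun \<phi> \<longrightarrow>
        (LINT z|lebesgue_on S_inf. w z *\<^sub>R space_grad \<phi> z) =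
        - (LINT z|lebesgue_on S_inf. \<phi> z *\<^sub>R G z))"

text \<open>Continuous curves \<open>t \<mapsto> u(\<cdot>,t)\<close> in \<open>L\<^sup>1\<close> of the measure with Lebesgue density \<open>a\<close>.\<close>

definition weighted :: "(real ^ 'n \<Rightarrow> real) \<Rightarrow> (real ^ 'n) measure" where
  "weighted a = density lebesgue (\<lambda>x. ennreal (a x))"

definition C_L1 :: "(real ^ 'n \<Rightarrow> real) \<Rightarrow> (real ^ 'n \<Rightarrow> real \<Rightarrow> real) \<Rightarrow> bool" where
  "C_L1 a u \<longleftrightarrow> (\<forall>t\<ge>0. integrable (weighted a) (\<lambda>x. u x t)) \<and>
     (\<forall>t0\<ge>0. ((\<lambda>t. LINT x|weighted a. \<bar>u x t - u x t0\<bar>) \<longlongrightarrow> 0) (at t0 within {0..}))"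

definition Linf_away :: "(real ^ 'n \<Rightarrow> real \<Rightarrow> real) \<Rightarrow> bool" where
  "Linf_away u \<longleftrightarrow> (\<lambda>(x, t). u x t) \<in> borel_measurable (lebesgue_on S_inf) \<and>
     (\<forall>tb>0. \<exists>C. AE z in lebesgue_on (UNIV \<times> {tb<..}). \<bar>(\<lambda>(x, t). u x t) z\<bar> \<le> C)"

text \<open>Only \<open>u\<^sup>\<sigma>\<close>, \<open>\<sigma> = (p + m - 2) / (p - 1)\<close>, is required to have a weak gradient \<open>G\<close>. As
  usual, \<open>\<nabla>u\<close> in the flux is read off from the chain rule \<open>G = \<sigma> u\<^bsup>\<sigma>-1\<^esup> \<nabla>u\<close> where
  \<open>u > 0\<close>, and is zero where \<open>u = 0\<close> (where \<open>G = 0\<close> almost everywhere). The latter, and the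
  vanishing of the flux there for every sign of the exponents, is provided by \<open>0 powr b = 0\<close>.\<close>

definition sig :: "real \<Rightarrow> real \<Rightarrow> real" where
  "sig p m = (p + m - 2) / (p - 1)"

definition Du :: "real \<Rightarrow> real \<Rightarrow> real \<Rightarrow> real ^ 'n \<Rightarrow> real ^ 'n" where
  "Du p m y G = (y powr (1 - sig p m) / sig p m) *\<^sub>R G"

definition flux :: "real \<Rightarrow> real \<Rightarrow> real \<Rightarrow> real ^ 'n \<Rightarrow> real ^ 'n" where
  "flux p m y G = (y powr (m - 1) * norm (Du p m y G) powr (p - 2)) *\<^sub>R Du p m y G"

text \<open>Weak theory of \<open>a u\<^sub>t = div (b u\<^bsup>m-1\<^esup> |\<nabla>u|\<^bsup>p-2\<^esup> \<nabla>u)\<close>. The two equations of interest are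
  \<open>a = b = f\<close> and \<open>a = \<rho>(|x|)\<close>, \<open>b = 1\<close>.\<close>

definition in_class :: "real \<Rightarrow> real \<Rightarrow> (real ^ 'n \<Rightarrow> real) \<Rightarrow>
    (real ^ 'n \<Rightarrow> real \<Rightarrow> real) \<Rightarrow> ((real ^ 'n) \<times> real \<Rightarrow> real ^ 'n) \<Rightarrow> bool" where
  "in_class p m a u G \<longleftrightarrow>
     (\<forall>t\<ge>0. AE x in lebesgue. 0 \<le> u x t) \<and> C_L1 a u \<and> Linf_away u \<and>
     weak_space_grad (\<lambda>(x, t). u x t powr sig p m) G \<and> Lp_loc p G"

definition weak_form :: "real \<Rightarrow> real \<Rightarrow> (real ^ 'n \<Rightarrow> real) \<Rightarrow> (real ^ 'n \<Rightarrow> real) \<Rightarrow>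
    (real ^ 'n \<Rightarrow> real \<Rightarrow> real) \<Rightarrow> ((real ^ 'n) \<times> real \<Rightarrow> real ^ 'n) \<Rightarrow>
    ((real ^ 'n) \<times> real \<Rightarrow> real) \<Rightarrow> real" where
  "weak_form p m a b u G \<eta> = (LINT (x, t)|lebesgue_on S_inf.
     - (a x * u x t * time_deriv \<eta> (x, t)) + b x * (flux p m (u x t) (G (x, t)) \<bullet> space_grad \<eta> (x, t)))"

definition weak_solution :: "real \<Rightarrow> real \<Rightarrow> (real ^ 'n \<Rightarrow> real) \<Rightarrow> (real ^ 'n \<Rightarrow> real) \<Rightarrow>
    (real ^ 'n \<Rightarrow> real \<Rightarrow> real) \<Rightarrow> bool" where
  "weak_solution p m a b u \<longleftrightarrow> (\<exists>G. in_class p m a u G \<and>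
     (\<forall>\<eta>. test_fun \<eta> \<longrightarrow> weak_form p m a b u G \<eta> = 0))"

definition weak_supersolution :: "real \<Rightarrow> real \<Rightarrow> (real ^ 'n \<Rightarrow> real) \<Rightarrow> (real ^ 'n \<Rightarrow> real) \<Rightarrow>
    (real ^ 'n \<Rightarrow> real \<Rightarrow> real) \<Rightarrow> bool" where
  "weak_supersolution p m a b u \<longleftrightarrow> (\<exists>G. in_class p m a u G \<and>
     (\<forall>\<eta>. test_fun \<eta> \<and> (\<forall>z. 0 \<le> \<eta> z) \<longrightarrow> weak_form p m a b u G \<eta> \<ge> 0))"

definition weak_subsolution :: "real \<Rightarrow> real \<Rightarrow> (real ^ 'n \<Rightarrow> real) \<Rightarrow> (real ^ 'n \<Rightarrow> real) \<Rightarrow>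
    (real ^ 'n \<Rightarrow> real \<Rightarrow> real) \<Rightarrow> bool" where
  "weak_subsolution p m a b u \<longleftrightarrow> (\<exists>G. in_class p m a u G \<and>
     (\<forall>\<eta>. test_fun \<eta> \<and> (\<forall>z. 0 \<le> \<eta> z) \<longrightarrow> weak_form p m a b u G \<eta> \<le> 0))"

text \<open>The relation \<open>F\<^sub>1(s) \<sim> F\<^sub>2(s)\<close>: two-sided comparability for large \<open>s\<close>, not asymptotic
  equivalence.\<close>

definition comparable :: "(real \<Rightarrow> real) \<Rightarrow> (real \<Rightarrow> real) \<Rightarrow> bool" where
  "comparable F1 F2 \<longleftrightarrow> (\<exists>C1 C2 sb. 0 < C1 \<and> 0 < C2 \<and> 0 < sb \<and>
     (\<forall>s\<ge>sb. C1 \<le> F2 s / F1 s \<and> F2 s / F1 s \<le> C2))"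

end

theory Submission
  imports Defs
begin

text \<open>
  Write \<open>S\<close> for the inverse of the sought map \<open>r = R(s)\<close>. For radial functions the two equations
  agree once \<open>(S')\<^bsup>p-1\<^esup> = (S/r)\<^bsup>N-1\<^esup> e\<^bsup>-g\<^esup>\<close> and \<open>\<rho> = (R')\<^bsup>p\<^esup>\<close>. The variables separate: with
  \<open>q = (N - p)/(p - 1)\<close> and \<open>I(r)\<close> the integral of \<open>q t\<^bsup>-q-1\<^esup> e\<^bsup>-g(t)/(p-1)\<^esup>\<close> over \<open>t > r\<close>, one takes
  \<open>S = I\<^bsup>-1/q\<^esup>\<close>. The asymptotics come from comparing \<open>I\<close> with \<open>Y(r) = r\<^bsup>-q\<^esup> e\<^bsup>-g(r)/(p-1)\<^esup>\<close>:
  since \<open>r g'\<close> and \<open>g\<close> are comparable, so are \<open>Y/I\<close> and \<open>1 + g\<close>.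

  The induced diffeomorphism of space is only \<open>C\<^sup>1\<close>, so the weak formulations are first extended from
  smooth to \<open>C\<^sup>1\<close> test functions by mollification, and its Jacobian is found by computing the volume
  of truncated cones. A weak gradient of a radial function is, by rotation invariance, almost
  everywhere parallel to \<open>x\<close>, and is therefore determined by its pairing with the Euler field \<open>x\<close>.
  This pairing transforms well under the change of variables, away from the axis \<open>x = 0\<close>; the axis
  itself is removed by a cutoff, which works because the function is locally bounded and \<open>N \<ge> 2\<close>.
\<close>

section \<open>Smooth bump functions and mollification\<close>

text \<open>Origin of the two relations: a test function composed with the map gains a factor S'
  along the radius, the gradient of v is that of U divided by S', and the flux is homogeneous of
  degree p - 1. So the space terms match if S'^p f = J with J = (S/r)^(N-1) S', the time terms match
  if f = J rho, and rho is S'^(-p) at corresponding points. As q + 1 = (N-1)/(p-1), the first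
  relation reads (S^(-q))' = -q r^(-q-1) e^(-g/(p-1)). For S to be onto, S^(-q) must tend to 0 at
  infinity, which fixes the constant of integration; the factor q in I gives S'(0) = 1, hence rho(0)
  = 1.

  The flux looks singular in u, but sigma is chosen so that all powers of u cancel where u is
  nonzero: what remains is a multiple of |G|^(p-2) G, with G the weak gradient of u^sigma. Thus only
  G has to be transported.

  Transport is proved in one direction, between two equations with general coefficients; the
  converse is the same theorem for the inverse map. This is why the class of radial maps in use is
  closed under inversion.\<close>

lemma Ck_SucD: "Ck (Suc k) h \<Longrightarrow> Ck k h"
proof (induction k arbitrary: h)
  case 0
  then show ?case
    by (simp add: differentiable_imp_continuous_within continuous_at_imp_continuous_on)
next
  case (Suc k)
  then show ?case
    by (metis Ck.simps(2))
qed

lemma Ck_SucI: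
  assumes "\<And>x. (h has_derivative h' x) (at x)" "\<And>v. Ck k (\<lambda>x. h' x v)"
  shows "Ck (Suc k) h"
proof -
  have "frechet_derivative h (at x) = h' x" for x
    using frechet_derivative_at[OF assms(1)] by simp
  with assms show ?thesis
    by (auto simp: differentiable_def)
qed

lemma Ck_Suc_has_derivative:
  assumes "Ck (Suc k) h"
  shows "(h has_derivative frechet_derivative h (at x)) (at x)"
  using assms frechet_derivative_works by auto

lemma Ck_const: "Ck k (\<lambda>_. c)"
  by (induction k arbitrary: c) (auto simp: frechet_derivative_const)

lemma Ck_add: "Ck k f \<Longrightarrow> Ck k g \<Longrightarrow> Ck k (\<lambda>x. f x + g x)"
proof (induction k arbitrary: f g)
  case 0
  then show ?case by (auto intro: continuous_intros)
next
  case (Suc k)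
  show ?case
    by (rule Ck_SucI[OF has_derivative_add[OF Ck_Suc_has_derivative Ck_Suc_has_derivative]])
       (use Suc in auto)
qed

lemma Ck_mult: "Ck k f \<Longrightarrow> Ck k g \<Longrightarrow> Ck k (\<lambda>x. f x * g x)"
proof (induction k arbitrary: f g)
  case 0
  then show ?case by (auto intro: continuous_intros)
next
  case (Suc k)
  show ?case
    by (rule Ck_SucI[OF has_derivative_mult[OF Ck_Suc_has_derivative Ck_Suc_has_derivative]])
       (use Suc Ck_SucD[OF Suc.prems(1)] Ck_SucD[OF Suc.prems(2)] in \<open>auto intro!: Ck_add Suc.IH\<close>)
qed

text \<open>The functions \<open>x\<^bsup>-n\<^esup> e\<^bsup>-1/x\<^esup>\<close> span a space closed under differentiation, which makes
  \<open>flat 0\<close> smooth.\<close>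

definition flat :: "nat \<Rightarrow> real \<Rightarrow> real" where
  "flat n x = (if x > 0 then (1 / x) ^ n * exp (- (1 / x)) else 0)"

text \<open>Only the term of degree n + 2 of the exponential series at 1/x is kept. The quadratic
  bound is what makes the difference quotient at 0 vanish.\<close>

lemma flat_bound: "\<bar>flat n x\<bar> \<le> fact (n + 2) * x\<^sup>2"
proof (cases "x > 0")
  case True
  define y where "y = 1 / x"
  have y: "y > 0" "x = 1 / y" using True by (auto simp: y_def)
  have "(\<Sum>k\<in>{n + 2}. y ^ k /\<^sub>R fact k) \<le> (\<Sum>k. y ^ k /\<^sub>R fact k)"
    using y(1) by (intro sum_le_suminf summable_exp_generic) auto
  then have "y ^ (n + 2) / fact (n + 2) \<le> exp y"
    by (simp add: exp_def field_simps del: fact_Suc)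
  then have "y ^ n * y\<^sup>2 \<le> fact (n + 2) * exp y"
    by (subst (asm) divide_le_eq) (simp add: power_add mult.commute power2_eq_square)
  then have "y ^ n * exp (- y) \<le> fact (n + 2) / y\<^sup>2"
    using y(1) by (simp add: pos_le_divide_eq exp_minus del: fact_Suc flip: divide_inverse)
      (simp add: divide_le_eq del: fact_Suc)
  then show ?thesis
    using True y by (simp add: flat_def power_divide)
qed (simp add: flat_def)

lemma flat_0: "flat n 0 = 0"
  by (simp add: flat_def)

lemma flat_has_derivative:
  "(flat n has_real_derivative flat (n + 2) x - real n * flat (n + 1) x) (at x)"
proof -
  consider "x > 0" | "x < 0" | "x = 0" by linarith
  then show ?thesis
  proof cases
    case 1
    have "((\<lambda>x. (1 / x) ^ n * exp (- (1 / x))) has_real_derivative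
        flat (n + 2) x - real n * flat (n + 1) x) (at x)"
    proof (rule DERIV_cong)
      show "((\<lambda>x. (1 / x) ^ n * exp (- (1 / x))) has_real_derivative
          (real n * (1 / x) ^ (n - 1) * (- ((1 / x) ^ 2))) * exp (- (1 / x)) + (1 / x) ^ n * (exp (- (1 / x)) * (1 / x) ^ 2)) (at x)"
        using 1 by (auto intro!: derivative_eq_intros simp: power2_eq_square)
      have "real n * y ^ (n - 1) * - (y ^ 2) * d + y ^ n * (d * y ^ 2) = y ^ (n + 2) * d - real n * (y ^ (n + 1) * d)" for y d :: real
        by (cases n) (auto simp: power2_eq_square algebra_simps)
      then show "(real n * (1 / x) ^ (n - 1) * (- ((1 / x) ^ 2))) * exp (- (1 / x)) + (1 / x) ^ n * (exp (- (1 / x)) * (1 / x) ^ 2)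
          = flat (n + 2) x - real n * flat (n + 1) x"
        unfolding flat_def using 1 by (simp only: if_True)
    qed
    then show ?thesis
      by (rule has_field_derivative_transform_within_open[where S = "{0<..}"])
         (use 1 in \<open>auto simp: flat_def\<close>)
  next
    case 2
    have "((\<lambda>x. 0) has_real_derivative flat (n + 2) x - real n * flat (n + 1) x) (at x)"
      using 2 by (auto simp: flat_def)
    then show ?thesis
      by (rule has_field_derivative_transform_within_open[where S = "{..<0}"])
         (use 2 in \<open>auto simp: flat_def\<close>)
  next
    case 3
    have "((\<lambda>h. flat n h / h) \<longlongrightarrow> 0) (at 0)"
    proof (rule Lim_null_comparison)
      show "\<forall>\<^sub>F h in at 0. norm (flat n h / h) \<le> fact (n + 2) * \<bar>h\<bar>"
      proof (rule always_eventually, rule allI)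
        fix h :: real
        have "h\<^sup>2 = \<bar>h\<bar> * \<bar>h\<bar>" by (simp add: power2_eq_square)
        then show "norm (flat n h / h) \<le> fact (n + 2) * \<bar>h\<bar>"
          using flat_bound[of n h] by (cases "h = 0") (auto simp: abs_divide divide_le_eq mult_ac simp del: fact_Suc abs_mult_self_eq)
      qed
      show "((\<lambda>h::real. fact (n + 2) * \<bar>h\<bar>) \<longlongrightarrow> 0) (at 0)"
        by (auto intro!: tendsto_eq_intros)
    qed
    then show ?thesis
      using 3 flat_0[of n] flat_0[of "n + 1"] flat_0[of "n + 2"] by (simp add: DERIV_def)
  qed
qed

text \<open>Smoothness is proved directly for the composite with a smooth \<open>q\<close>,
  generalised over \<open>n\<close>, so that no chain rule for \<open>Ck\<close> is
  involved.\<close>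

lemma Ck_flat:
  assumes "\<And>k. Ck k q"
  shows "Ck k (\<lambda>x. flat n (q x))"
proof (induction k arbitrary: n)
  case 0
  have "continuous_on UNIV (flat n)"
    by (intro continuous_at_imp_continuous_on ballI DERIV_isCont[OF flat_has_derivative])
  then have "continuous_on UNIV (flat n \<circ> q)"
    using assms[of 0] by (intro continuous_on_compose) (auto intro: continuous_on_subset)
  then show ?case
    by (simp add: o_def)
next
  case (Suc k)
  have q: "(q has_derivative frechet_derivative q (at x)) (at x)" for x
    using Ck_Suc_has_derivative assms by blast
  have qk: "Ck k (\<lambda>x. frechet_derivative q (at x) v)" for v
    using assms[of "Suc k"] by simp
  have "((\<lambda>x. flat n (q x)) has_derivative
      (\<lambda>v. frechet_derivative q (at x) v * (flat (n + 2) (q x) - real n * flat (n + 1) (q x)))) (at x)" for x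
    by (rule DERIV_compose_FDERIV[OF flat_has_derivative q])
  then have "((\<lambda>x. flat n (q x)) has_derivative
      (\<lambda>v. (flat (n + 2) (q x) + - real n * flat (n + 1) (q x)) * frechet_derivative q (at x) v)) (at x)" for x
    by (simp add: mult.commute)
  then show ?case
  proof (rule Ck_SucI)
    fix v
    have "Ck k (\<lambda>x. - real n * flat (n + 1) (q x))"
      by (rule Ck_mult[OF Ck_const]) (rule Suc)
    then have "Ck k (\<lambda>x. flat (n + 2) (q x) + - real n * flat (n + 1) (q x))"
      using Ck_add Suc by blast
    then show "Ck k (\<lambda>x. (flat (n + 2) (q x) + - real n * flat (n + 1) (q x)) * frechet_derivative q (at x) v)"
      by (rule Ck_mult) (rule qk)
  qed
qed

lemma Ck_inner: "Ck k (\<lambda>x::'a::euclidean_space. x \<bullet> c)"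
proof (cases k)
  case 0
  then show ?thesis by (auto intro: continuous_intros)
next
  case (Suc l)
  show ?thesis
    unfolding Suc by (rule Ck_SucI[where h' = "\<lambda>_ v. v \<bullet> c"])
      (auto intro!: derivative_eq_intros Ck_const)
qed

lemma Ck_norm2: "Ck k (\<lambda>x::'a::euclidean_space. x \<bullet> x)"
proof (cases k)
  case 0
  then show ?thesis by (auto intro: continuous_intros)
next
  case (Suc l)
  have "((\<lambda>x. x \<bullet> x) has_derivative (\<lambda>v. 2 * (x \<bullet> v))) (at x)" for x :: 'a
    by (auto intro!: derivative_eq_intros simp: inner_commute)
  then show ?thesis
    unfolding Suc
  proof (rule Ck_SucI)
    show "Ck l (\<lambda>x::'a. 2 * (x \<bullet> v))" for v
      using Ck_mult[OF Ck_const[of l 2] Ck_inner[of l v]] .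
  qed
qed

section \<open>Convolutions\<close>

definition cv :: "('a::euclidean_space \<Rightarrow> real) \<Rightarrow> ('a \<Rightarrow> real) \<Rightarrow> 'a \<Rightarrow> real" where
  "cv f k z = (LINT y|lborel. f y * k (z - y))"

text \<open>Over a fixed box, continuity and differentiability in \<open>z\<close> become questions
  about parameter integrals on a compact set.\<close>

lemma cv_cbox:
  assumes "continuous_on UNIV f" "\<And>y. y \<notin> cbox a b \<Longrightarrow> f y = 0" "continuous_on UNIV k"
  shows "cv f k z = integral (cbox a b) (\<lambda>y. f y * k (z - y))"
proof -
  have c: "continuous_on (cbox a b) (\<lambda>y. f y * k (z - y))"
    by (intro continuous_intros continuous_on_compose2[OF assms(3)] continuous_on_subset[OF assms(1)]) auto
  have "cv f k z = (LINT y:cbox a b|lborel. f y * k (z - y))"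
    unfolding cv_def set_lebesgue_integral_def
    by (intro Bochner_Integration.integral_cong) (auto simp: indicator_def assms(2))
  also have "\<dots> = integral (cbox a b) (\<lambda>y. f y * k (z - y))"
    by (intro set_borel_integral_eq_integral) (unfold set_integrable_def, rule borel_integrable_compact[OF compact_cbox c])
  finally show ?thesis .
qed

lemma continuous_on_cv:
  assumes "continuous_on UNIV f" "\<And>y. y \<notin> cbox a b \<Longrightarrow> f y = 0" "continuous_on UNIV k"
  shows "continuous_on UNIV (cv f k)"
proof -
  have "continuous_on UNIV (\<lambda>z. integral (cbox a b) (\<lambda>y. f y * k (z - y)))"
    unfolding split_beta
    by (intro integral_continuous_on_param)
       (auto simp: split_beta intro!: continuous_intros continuous_on_compose2[OF assms(1)] continuous_on_compose2[OF assms(3)])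
  then show ?thesis
    using cv_cbox[OF assms] by (simp cong: continuous_on_cong)
qed

text \<open>Differentiation under the integral sign wants a continuous family of bounded linear
  maps. The directional data \<open>k'\<close> are therefore packed into \<open>B\<close>, whose
  continuity is checked direction by direction.\<close>

lemma cv_has_derivative:
  assumes f: "continuous_on UNIV f" "\<And>y. y \<notin> cbox a b \<Longrightarrow> f y = 0"
    and k: "\<And>x. (k has_derivative k' x) (at x)" "\<And>v. continuous_on UNIV (\<lambda>x. k' x v)"
  shows "(cv f k has_derivative (\<lambda>v. cv f (\<lambda>x. k' x v) z)) (at z)"
proof -
  have kc: "continuous_on UNIV k"
    using k(1) by (meson continuous_at_imp_continuous_on has_derivative_continuous)
  define B where "B x = Blinfun (k' x)" for x
  have B: "blinfun_apply (B x) = k' x" for x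
    unfolding B_def by (intro bounded_linear_Blinfun_apply has_derivative_bounded_linear[OF k(1)])
  have Bc: "continuous_on UNIV B"
    by (rule continuous_on_blinfun_componentwise) (simp add: B k(2))
  have c1: "continuous_on (cbox a b) (\<lambda>y. f y * h (z - y))" if "continuous_on UNIV h" for h z
    by (intro continuous_intros continuous_on_compose2[OF that] continuous_on_subset[OF f(1)]) auto
  have c2: "continuous_on (cbox a b) (\<lambda>y. f y *\<^sub>R B (z - y))" for z
    by (intro continuous_intros continuous_on_compose2[OF Bc] continuous_on_subset[OF f(1)]) auto
  have "((\<lambda>z. integral (cbox a b) (\<lambda>y. f y * k (z - y))) has_derivative
      blinfun_apply (integral (cbox a b) (\<lambda>y. f y *\<^sub>R B (z - y)))) (at z)"
  proof (rule leibniz_rule)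
    fix x t
    have "((\<lambda>x. k (x - t)) has_derivative (\<lambda>v. k' (x - t) v)) (at x)"
      by (rule has_derivative_compose[OF _ k(1), of "\<lambda>x. x - t" "\<lambda>v. v" x UNIV])
         (auto intro!: derivative_eq_intros)
    then show "((\<lambda>x. f t * k (x - t)) has_derivative blinfun_apply (f t *\<^sub>R B (x - t))) (at x)"
      by (auto intro!: derivative_eq_intros simp: blinfun.scaleR_left B)
  next
    show "(\<lambda>y. f y * k (x - y)) integrable_on cbox a b" for x
      by (intro integrable_continuous c1 kc)
  next
    show "continuous_on (UNIV \<times> cbox a b) (\<lambda>(x, t). f t *\<^sub>R B (x - t))"
      unfolding split_beta
      by (auto simp: split_beta intro!: continuous_intros continuous_on_compose2[OF f(1)] continuous_on_compose2[OF Bc])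
  qed auto
  moreover
  have "blinfun_apply (integral (cbox a b) (\<lambda>y. f y *\<^sub>R B (z - y))) v = cv f (\<lambda>x. k' x v) z" for v
  proof -
    have "blinfun_apply (integral (cbox a b) (\<lambda>y. f y *\<^sub>R B (z - y))) v =
        integral (cbox a b) ((\<lambda>T. blinfun_apply T v) \<circ> (\<lambda>y. f y *\<^sub>R B (z - y)))"
      by (rule integral_linear[symmetric])
         (auto intro!: integrable_continuous c2 bounded_linear_intros)
    also have "\<dots> = cv f (\<lambda>x. k' x v) z"
      by (subst cv_cbox[OF f k(2)]) (auto simp: o_def blinfun.scaleR_left B)
    finally show ?thesis .
  qed
  then have "blinfun_apply (integral (cbox a b) (\<lambda>y. f y *\<^sub>R B (z - y))) = (\<lambda>v. cv f (\<lambda>x. k' x v) z)"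
    by (rule ext)
  moreover have "cv f k = (\<lambda>z. integral (cbox a b) (\<lambda>y. f y * k (z - y)))"
    using cv_cbox[OF f kc] by auto
  ultimately show ?thesis by simp
qed

lemma Ck_cv:
  assumes f: "continuous_on UNIV f" "\<And>y. y \<notin> cbox a b \<Longrightarrow> f y = 0"
    and "Ck j k"
  shows "Ck j (cv f k)"
  using assms(3)
proof (induction j arbitrary: k)
  case 0
  then show ?case using continuous_on_cv[OF f] by simp
next
  case (Suc j)
  have "continuous_on UNIV (\<lambda>x. frechet_derivative k (at x) v)" for v
  proof -
    have "Ck j (\<lambda>x. frechet_derivative k (at x) v)" using Suc.prems by simp
    then have "Ck 0 (\<lambda>x. frechet_derivative k (at x) v)"
      by (induction j) (use Ck_SucD in blast)+
    then show ?thesis by simp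
  qed
  then have "(cv f k has_derivative (\<lambda>v. cv f (\<lambda>x. frechet_derivative k (at x) v) z)) (at z)" for z
    by (intro cv_has_derivative[OF f] Ck_Suc_has_derivative[OF Suc.prems])
  then show ?case
    by (rule Ck_SucI) (use Suc in auto)
qed

text \<open>The substitution y -> z - y. It allows a derivative to fall on either factor: on the
  kernel to obtain smoothness, on the mollified function to identify the derivative.\<close>

lemma cv_commute:
  assumes [measurable]: "f \<in> borel_measurable borel" "k \<in> borel_measurable borel"
  shows "cv f k z = cv k f z"
proof -
  have "cv f k z = (LINT y|density (distr lborel borel (\<lambda>x. z + (-1) *\<^sub>R x)) (\<lambda>_. ennreal (\<bar>-1\<bar> ^ DIM('a))). f y * k (z - y))"
    unfolding cv_def using lborel_affine[of "-1" z] by (simp add: ennreal_power)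
  also have "\<dots> = cv k f z"
    unfolding cv_def by (subst integral_density) (auto simp: integral_distr mult.commute)
  finally show ?thesis .
qed

section \<open>Mollifying kernels\<close>

definition bump :: "real \<Rightarrow> 'a::euclidean_space \<Rightarrow> real" where
  "bump e x = flat 0 (e\<^sup>2 + (-1) * (x \<bullet> x))"

lemma Ck_bump: "Ck k (bump e)"
  unfolding bump_def[abs_def]
  using Ck_add[OF Ck_const[of _ "e\<^sup>2"] Ck_mult[OF Ck_const[of _ "-1"] Ck_norm2]] by (rule Ck_flat)

lemma continuous_on_bump: "continuous_on UNIV (bump e)"
  using Ck_bump[of 0] by simp

lemma bump_nonneg: "0 \<le> bump e x"
  by (simp add: bump_def flat_def)

lemma bump_eq_0: "e > 0 \<Longrightarrow> e \<le> norm x \<Longrightarrow> bump e x = 0"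
  by (auto simp: bump_def flat_def dot_square_norm not_less power_mono)

lemma bump_pos: "norm x < e \<Longrightarrow> 0 < bump e x"
  by (auto simp: bump_def flat_def dot_square_norm power_strict_mono)

lemma integrable_continuous_compact_support:
  fixes f :: "'a::euclidean_space \<Rightarrow> real"
  assumes "continuous_on UNIV f" "compact K" "\<And>x. x \<notin> K \<Longrightarrow> f x = 0"
  shows "integrable lborel f"
proof -
  have "(\<lambda>x. indicator K x *\<^sub>R f x) = f" using assms(3) by (auto simp: indicator_def fun_eq_iff)
  with borel_integrable_compact[OF assms(2) continuous_on_subset[OF assms(1)]] show ?thesis by simp
qed

lemma integrable_bump: "e > 0 \<Longrightarrow> integrable lborel (bump e)"
  by (rule integrable_continuous_compact_support[OF continuous_on_bump, of "cball 0 e"])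
     (auto intro: bump_eq_0)

lemma integral_bump_pos:
  assumes "e > 0" shows "0 < (LINT x|lborel. bump e (x::'a::euclidean_space))"
proof -
  have "(LINT x|lborel. bump e (x::'a)) \<noteq> 0"
  proof
    assume "(LINT x|lborel. bump e (x::'a)) = 0"
    then have "AE x in lborel. bump e (x::'a) = 0"
      using integral_nonneg_eq_0_iff_AE[OF integrable_bump[OF assms]] bump_nonneg by auto
    then have "AE x in lborel. x \<notin> ball (0::'a) e"
      by eventually_elim (use bump_pos in fastforce)
    then have "ball (0::'a) e \<in> null_sets lborel"
      by (subst AE_iff_null_sets) auto
    then show False using open_not_negligible[of "ball (0::'a) e"] assms
      by (simp add: negligible_iff_null_sets null_sets_completionI)
  qed
  moreover have "0 \<le> (LINT x|lborel. bump e (x::'a))"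
    by (rule integral_nonneg_AE, rule AE_I2, rule bump_nonneg)
  ultimately show ?thesis by linarith
qed

definition ker :: "real \<Rightarrow> 'a::euclidean_space \<Rightarrow> real" where
  "ker e x = inverse (LINT x|lborel. bump e (x::'a)) * bump e x"

definition moll :: "real \<Rightarrow> ('a::euclidean_space \<Rightarrow> real) \<Rightarrow> 'a \<Rightarrow> real" where
  "moll e f = cv f (ker e)"

lemma Ck_ker: "Ck k (ker e :: 'a::euclidean_space \<Rightarrow> real)"
  unfolding ker_def[abs_def]
  using Ck_mult[OF Ck_const[of k "inverse (LINT x|lborel. bump e (x::'a))"] Ck_bump[of k e]] .

lemma continuous_on_ker: "continuous_on UNIV (ker e)"
  using Ck_ker[of 0] by simp

lemma ker:
  fixes x :: "'a::euclidean_space"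
  assumes "e > 0"
  shows "0 \<le> ker e x" "e \<le> norm x \<Longrightarrow> ker e x = 0" "integrable lborel (ker e :: 'a \<Rightarrow> real)"
    "(LINT x|lborel. ker e (x::'a)) = 1"
  using integral_bump_pos[where 'a='a, OF assms] bump_nonneg[where 'a='a] bump_eq_0[where 'a='a] assms
    integrable_bump[where 'a='a, OF assms]
  unfolding ker_def[abs_def] by (auto simp: less_imp_le)

locale compact_support =
  fixes f :: "'a::euclidean_space \<Rightarrow> real" and K
  assumes cont: "continuous_on UNIV f" and K: "compact K" and supp: "\<And>z. z \<notin> K \<Longrightarrow> f z = 0"
begin

lemma cbox: obtains a b where "\<And>z. z \<notin> cbox a b \<Longrightarrow> f z = 0"
  using bounded_subset_cbox_symmetric[OF compact_imp_bounded[OF K]] supp by (metis subsetD)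

lemma Ck_moll: "Ck j (moll e f)"
  unfolding moll_def using cbox Ck_cv[OF cont _ Ck_ker] by metis

lemma meas: "f \<in> borel_measurable borel"
  using cont by (rule borel_measurable_continuous_onI)

lemma moll_alt: "moll e f z = (LINT y|lborel. ker e y * f (z - y))"
  unfolding moll_def
  by (subst cv_commute) (auto simp: cv_def intro!: borel_measurable_continuous_onI meas continuous_on_ker)

lemma integrable_moll: "e > 0 \<Longrightarrow> integrable lborel (\<lambda>y. ker e y * f (z - y))"
  by (rule integrable_continuous_compact_support[where K = "cball 0 e"])
     (auto intro!: continuous_intros continuous_on_ker ker continuous_on_compose2[OF cont])

lemma moll_eq_0:
  assumes "e > 0" "\<And>y. y \<in> K \<Longrightarrow> e \<le> dist z y"
  shows "moll e f z = 0"
proof -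
  have "ker e y * f (z - y) = 0" for y
  proof (cases "z - y \<in> K")
    case True
    then show ?thesis using assms(2)[OF True] ker(2)[OF assms(1), of y] by (simp add: dist_norm)
  qed (simp add: supp)
  then have "(\<lambda>y. ker e y * f (z - y)) = (\<lambda>_. 0)" by (rule ext)
  then show ?thesis unfolding moll_alt by (simp only: Bochner_Integration.integral_zero)
qed

lemma moll_nonneg: "e > 0 \<Longrightarrow> (\<And>z. 0 \<le> f z) \<Longrightarrow> 0 \<le> moll e f z"
  unfolding moll_alt by (intro integral_nonneg_AE) (auto intro!: mult_nonneg_nonneg ker)

text \<open>The kernel is a probability density supported in the ball of radius \<open>e\<close>, so
  averaging cannot move values farther from \<open>c\<close> than they are on that ball. With c = 0
  this is a uniform bound, with c = f z it gives pointwise convergence.\<close>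

lemma moll_dist:
  assumes "e > 0" "\<And>y. dist z y \<le> e \<Longrightarrow> \<bar>f y - c\<bar> \<le> d"
  shows "\<bar>moll e f z - c\<bar> \<le> d"
proof -
  have "moll e f z - c = (LINT y|lborel. ker e y * f (z - y)) - (LINT y|lborel. ker e (y::'a) * c)"
    unfolding moll_alt using ker[OF assms(1), where 'a='a] by simp
  also have "\<dots> = (LINT y|lborel. ker e y * (f (z - y) - c))"
    using ker[OF assms(1), where 'a='a] integrable_moll[OF assms(1)]
    by (subst Bochner_Integration.integral_diff[symmetric]) (auto simp: algebra_simps)
  finally have eq: "moll e f z - c = (LINT y|lborel. ker e y * (f (z - y) - c))" .
  have i: "integrable lborel (\<lambda>y. ker e y * (f (z - y) - c))"
    using ker[OF assms(1), where 'a='a] integrable_moll[OF assms(1)]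
    by (auto simp: algebra_simps)
  have "\<bar>moll e f z - c\<bar> \<le> (LINT y|lborel. \<bar>ker e y * (f (z - y) - c)\<bar>)"
    unfolding eq by (rule integral_abs_bound)
  also have "\<dots> \<le> (LINT y|lborel. ker e (y::'a) * d)"
  proof (rule integral_mono)
    show "integrable lborel (\<lambda>y. \<bar>ker e y * (f (z - y) - c)\<bar>)" using i by (rule integrable_abs)
    show "integrable lborel (\<lambda>y::'a. ker e y * d)" using ker[OF assms(1), where 'a='a] by simp
    fix y :: 'a
    show "\<bar>ker e y * (f (z - y) - c)\<bar> \<le> ker e y * d"
    proof (cases "e \<le> norm y")
      case True
      then show ?thesis using ker(2)[OF assms(1) True] by simp
    next
      case False
      then have "\<bar>f (z - y) - c\<bar> \<le> d" by (intro assms(2)) (simp add: dist_norm)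
      then show ?thesis using ker(1)[OF assms(1), of y] by (simp add: abs_mult mult_left_mono)
    qed
  qed
  also have "\<dots> = d" using ker[OF assms(1), where 'a='a] by simp
  finally show ?thesis .
qed

lemma moll_bound: "e > 0 \<Longrightarrow> (\<And>z. \<bar>f z\<bar> \<le> B) \<Longrightarrow> \<bar>moll e f z\<bar> \<le> B"
  using moll_dist[of e z 0 B] by simp

lemma moll_tendsto: "(\<lambda>n. moll (inverse (real (Suc n))) f z) \<longlonglongrightarrow> f z"
proof (rule LIMSEQ_I)
  fix r :: real assume "0 < r"
  have "isCont f z" using cont by (simp add: continuous_on_eq_continuous_at)
  then obtain d where d: "d > 0" "\<And>y. dist y z < d \<Longrightarrow> dist (f y) (f z) < r / 2"
    using \<open>0 < r\<close> unfolding continuous_at_eps_delta by (meson half_gt_zero)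
  obtain N where N: "inverse (real (Suc N)) < d" using reals_Archimedean[OF d(1)] by auto
  have "norm (moll (inverse (real (Suc n))) f z - f z) < r" if "n \<ge> N" for n
  proof -
    have "inverse (real (Suc n)) \<le> inverse (real (Suc N))" using that by (simp add: field_simps)
    then have "dist (f y) (f z) < r / 2" if "dist z y \<le> inverse (real (Suc n))" for y
      using N that dist_commute[of y z] by (intro d(2)) linarith
    then have "\<bar>moll (inverse (real (Suc n))) f z - f z\<bar> \<le> r / 2"
      by (intro moll_dist) (auto simp: dist_real_def intro: less_imp_le)
    with \<open>0 < r\<close> show ?thesis by simp
  qed
  then show "\<exists>N. \<forall>n\<ge>N. norm (moll (inverse (real (Suc n))) f z - f z) < r" by blast
qed

text \<open>After commuting the convolution the derivative falls on \<open>f\<close>. Derivatives of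
  the mollified function are thus mollified derivatives, and they converge along with it.\<close>

lemma moll_has_derivative:
  assumes "e > 0" "\<And>x. (f has_derivative f' x) (at x)" "\<And>v. continuous_on UNIV (\<lambda>x. f' x v)"
  shows "(moll e f has_derivative (\<lambda>v. moll e (\<lambda>x. f' x v) z)) (at z)"
proof -
  have k: "compact_support (ker e :: 'a \<Rightarrow> real) (cball 0 e)"
    using ker(2)[where 'a='a, OF assms(1)] by unfold_locales (auto intro: continuous_on_ker)
  obtain a b :: 'a where ab: "\<And>y. y \<notin> cbox a b \<Longrightarrow> ker e y = 0" using compact_support.cbox[OF k] by metis
  have m: "ker e \<in> borel_measurable borel" "(\<lambda>x. f' x v) \<in> borel_measurable borel" for v
    by (auto intro!: borel_measurable_continuous_onI assms continuous_on_ker)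
  have "moll e f = cv (ker e) f" "moll e (\<lambda>x. f' x v) z = cv (ker e) (\<lambda>x. f' x v) z" for v
    unfolding moll_def using cv_commute meas m by (auto simp: fun_eq_iff)
  with cv_has_derivative[OF continuous_on_ker ab assms(2,3)] show ?thesis by simp
qed

end

section \<open>Test functions and weak identities\<close>

text \<open>The positive and negative parts of \<open>h\<close> are densities of two finite measures
  that agree on open sets, an intersection-stable generator of the Borel sets. So the measures
  coincide, and by uniqueness of densities so do the two parts.\<close>

lemma AE_zero_if_open_integrals_zero:
  fixes h :: "'a::euclidean_space \<Rightarrow> real"
  assumes i: "integrable lborel h"
    and z: "\<And>A. open A \<Longrightarrow> (LINT x|lborel. indicator A x * h x) = 0"
  shows "AE x in lborel. h x = 0"
proof -
  define P where "P x = max 0 (h x)" for x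
  define N where "N x = max 0 (- h x)" for x
  have ip: "integrable lborel P" and iN: "integrable lborel N"
    unfolding P_def[abs_def] N_def[abs_def] using i by (auto intro!: integrable_max)
  have ii: "integrable lborel (\<lambda>x. indicator A x * P x)" "integrable lborel (\<lambda>x. indicator A x * N x)"
    if "A \<in> sets borel" for A
    using integrable_mult_indicator[OF _ ip, of A] integrable_mult_indicator[OF _ iN, of A] that by simp_all
  have em: "emeasure (density lborel (\<lambda>x. ennreal (P x))) A = ennreal (LINT x|lborel. indicator A x * P x)"
    "emeasure (density lborel (\<lambda>x. ennreal (N x))) A = ennreal (LINT x|lborel. indicator A x * N x)"
    if [measurable]: "A \<in> sets borel" for A
  proof -
    have [measurable]: "P \<in> borel_measurable borel" "N \<in> borel_measurable borel"
      using borel_measurable_integrable[OF ip] borel_measurable_integrable[OF iN] by simp_all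
    have [simp]: "0 \<le> P x" "0 \<le> N x" for x by (auto simp: P_def N_def)
    show "emeasure (density lborel (\<lambda>x. ennreal (P x))) A = ennreal (LINT x|lborel. indicator A x * P x)"
      using ii[OF that] by (subst emeasure_density)
        (auto simp: nn_integral_eq_integral[symmetric] mult.commute ennreal_mult'' ennreal_indicator intro!: nn_integral_cong split: split_indicator)
    show "emeasure (density lborel (\<lambda>x. ennreal (N x))) A = ennreal (LINT x|lborel. indicator A x * N x)"
      using ii[OF that] by (subst emeasure_density)
        (auto simp: nn_integral_eq_integral[symmetric] mult.commute ennreal_mult'' ennreal_indicator intro!: nn_integral_cong split: split_indicator)
  qed
  have eqo: "(LINT x|lborel. indicator A x * P x) = (LINT x|lborel. indicator A x * N x)" if "open A" for A
  proof -
    have "(\<lambda>x. indicator A x * h x) = (\<lambda>x. indicator A x * P x - indicator A x * N x)"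
      by (auto simp: P_def N_def indicator_def fun_eq_iff)
    then show ?thesis using z[OF that] ii[OF borel_open[OF that]] by simp
  qed
  have eqm: "density lborel (\<lambda>x. ennreal (P x)) = density lborel (\<lambda>x. ennreal (N x))"
  proof (rule measure_eqI_generator_eq[where E = "{A. open A}" and \<Omega> = UNIV and A = "\<lambda>_. UNIV"])
    show "Int_stable {A :: 'a set. open A}" by (auto simp: Int_stable_def)
    show "emeasure (density lborel (\<lambda>x. ennreal (P x))) X = emeasure (density lborel (\<lambda>x. ennreal (N x))) X"
      if "X \<in> {A. open A}" for X
      using that em[of X] eqo[of X] by simp
    show "emeasure (density lborel (\<lambda>x. ennreal (P x))) UNIV \<noteq> \<infinity>" using em(1)[of UNIV] by simp
  qed (auto simp: borel_def)
  have "AE x in lborel. P x = N x"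
  proof (rule density_unique_real[OF ip iN])
    fix A :: "'a set" assume A: "A \<in> sets lborel"
    have "0 \<le> (LINT x|lborel. indicator A x * P x)" "0 \<le> (LINT x|lborel. indicator A x * N x)"
      by (auto intro!: integral_nonneg_AE simp: P_def N_def)
    then have "(LINT x|lborel. indicator A x * P x) = (LINT x|lborel. indicator A x * N x)"
      using em[of A] eqm A by (simp)
    then show "(LINT x:A|lborel. P x) = (LINT x:A|lborel. N x)"
      by (simp add: set_lebesgue_integral_def)
  qed
  moreover have "h x = 0" if "P x = N x" for x
    using that unfolding P_def N_def by linarith
  ultimately show ?thesis by auto
qed

section \<open>Cylinders and local integrability in space-time\<close>

definition cyl :: "real \<Rightarrow> real \<Rightarrow> real \<Rightarrow> ((real ^ 'n) \<times> real) set" where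
  "cyl r a b = cball 0 r \<times> {a..b}"

lemma compact_cyl: "compact (cyl r a b)"
  unfolding cyl_def by (intro compact_Times) auto

lemma cyl_borel [measurable]: "cyl r a b \<in> sets borel"
  by (intro borel_compact compact_cyl)

lemma cyl_lebesgue [measurable]: "cyl r a b \<in> sets lebesgue"
  by (intro sets_completionI_sets) (simp add: cyl_borel)

lemma cyl_subset_S_inf: "0 < a \<Longrightarrow> cyl r a b \<subseteq> S_inf"
  by (auto simp: cyl_def S_inf_def)

lemma S_inf_open: "open S_inf"
  unfolding S_inf_def by (intro open_Times) auto

lemma S_inf_lebesgue [measurable]: "S_inf \<in> sets lebesgue"
  using borel_open[OF S_inf_open] by (intro sets_completionI_sets) simp

text \<open>The time coordinate attains a positive minimum on a nonempty compact subset of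
  \<open>S_inf\<close>, which serves as the bottom. Local properties can therefore be tested on
  cylinders alone.\<close>

lemma compact_subset_cyl:
  assumes "compact K" "K \<subseteq> S_inf"
  obtains r a b where "0 < a" "K \<subseteq> cyl r a b"
proof (cases "K = {}")
  case True
  then show ?thesis using that[of 1] by auto
next
  case False
  have "bounded (fst ` K)" "bounded (snd ` K)"
    using assms(1) bounded_fst bounded_snd compact_imp_bounded by blast+
  then obtain r b where r: "\<And>z. z \<in> K \<Longrightarrow> norm (fst z) \<le> r" and b: "\<And>z. z \<in> K \<Longrightarrow> norm (snd z) \<le> b"
    unfolding bounded_iff by blast
  obtain z0 where z0: "z0 \<in> K" "\<And>z. z \<in> K \<Longrightarrow> snd z0 \<le> snd z"
    using continuous_attains_inf[OF assms(1) False, of snd] continuous_on_snd[OF continuous_on_id] by blast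
  have "0 < snd z0" using z0(1) assms(2) by (auto simp: S_inf_def)
  moreover have "K \<subseteq> cyl r (snd z0) b"
  proof
    fix z assume "z \<in> K"
    with r[of z] b[of z] z0(2)[of z] show "z \<in> cyl r (snd z0) b"
      by (cases z) (auto simp: cyl_def)
  qed
  ultimately show ?thesis by (rule that)
qed

text \<open>Integrability refers to \<open>lebesgue\<close> on all of space-time, so that pairings
  with test functions are unrestricted integrals; \<open>Lp_loc_1_iff\<close> matches this with
  \<open>Lp_loc 1\<close>.\<close>

definition L1loc :: "((real ^ 'n) \<times> real \<Rightarrow> 'b::{banach, second_countable_topology}) \<Rightarrow> bool" where
  "L1loc h \<longleftrightarrow> (\<forall>r a b. 0 < a \<longrightarrow> set_integrable lebesgue (cyl r a b) h)"

lemma L1loc_bounded_linear: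
  assumes "L1loc h" "bounded_linear T"
  shows "L1loc (\<lambda>z. T (h z))"
  unfolding L1loc_def set_integrable_def
proof (intro allI impI)
  fix r a b :: real assume "0 < a"
  then have "integrable lebesgue (\<lambda>z. T (indicator (cyl r a b) z *\<^sub>R h z))"
    using assms(1) by (intro integrable_bounded_linear[OF assms(2)]) (auto simp: L1loc_def set_integrable_def)
  then show "integrable lebesgue (\<lambda>z. indicator (cyl r a b) z *\<^sub>R T (h z))"
    by (simp add: linear_cmul[OF bounded_linear.linear[OF assms(2)]])
qed

lemma L1loc_zero: "L1loc (\<lambda>_. 0)"
  by (simp add: L1loc_def set_integrable_def)

lemma L1loc_add: "L1loc f \<Longrightarrow> L1loc g \<Longrightarrow> L1loc (\<lambda>z. f z + g z)"
  by (simp add: L1loc_def set_integral_add)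

lemma L1loc_Pair:
  assumes "L1loc f" "L1loc g"
  shows "L1loc (\<lambda>z. (f z, g z))"
proof -
  have "L1loc (\<lambda>z. (f z, 0) + (0, g z))"
    using assms by (intro L1loc_add L1loc_bounded_linear[of f "\<lambda>x. (x, 0)"] L1loc_bounded_linear[of g "\<lambda>x. (0, x)"])
      (auto intro!: bounded_linear_Pair bounded_linear_ident bounded_linear_zero)
  then show ?thesis by simp
qed

section \<open>Continuous and C^1 test functions\<close>

definition C0c :: "((real ^ 'n) \<times> real \<Rightarrow> real) \<Rightarrow> bool" where
  "C0c \<phi> \<longleftrightarrow> continuous_on UNIV \<phi> \<and> (\<exists>r a b. 0 < a \<and> (\<forall>z. z \<notin> cyl r a b \<longrightarrow> \<phi> z = 0))"

text \<open>The derivative is carried along explicitly, because derivatives of products and of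
  compositions with radial maps are needed as concrete formulas.\<close>

definition C1c :: "((real ^ 'n) \<times> real \<Rightarrow> real) \<Rightarrow> ((real ^ 'n) \<times> real \<Rightarrow> (real ^ 'n) \<times> real \<Rightarrow> real) \<Rightarrow> bool" where
  "C1c \<phi> \<phi>' \<longleftrightarrow> C0c \<phi> \<and> (\<forall>z. (\<phi> has_derivative \<phi>' z) (at z)) \<and> (\<forall>v. continuous_on UNIV (\<lambda>z. \<phi>' z v))"

lemma derivative_zero_outside:
  assumes "(\<phi> has_derivative D) (at z)" "\<And>z. z \<notin> cyl r a b \<Longrightarrow> \<phi> z = 0" "z \<notin> cyl r a b"
  shows "D v = 0"
proof -
  have o: "open (- cyl r a b)" by (simp add: compact_cyl compact_imp_closed open_Compl)
  have "((\<lambda>_. 0) has_derivative D) (at z)"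
    using has_derivative_transform_within_open[OF assms(1) o, of "\<lambda>_. 0"] assms(2,3) by auto
  then have "D = (\<lambda>_. 0)"
    using has_derivative_unique has_derivative_const by blast
  then show ?thesis by simp
qed

lemma C1cD:
  assumes "C1c \<phi> \<phi>'"
  shows "C0c \<phi>" "(\<phi> has_derivative \<phi>' z) (at z)" "continuous_on UNIV (\<lambda>z. \<phi>' z v)" "C0c (\<lambda>z. \<phi>' z v)"
    "linear (\<phi>' z)"
proof -
  show 1: "C0c \<phi>" "(\<phi> has_derivative \<phi>' z) (at z)" "continuous_on UNIV (\<lambda>z. \<phi>' z v)" for z v
    using assms unfolding C1c_def by blast+
  show "linear (\<phi>' z)" using 1(2) has_derivative_linear by blast
  obtain r a b where "0 < a" "\<And>z. z \<notin> cyl r a b \<Longrightarrow> \<phi> z = 0" using 1(1) by (auto simp: C0c_def)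
  then show "C0c (\<lambda>z. \<phi>' z v)"
    using 1(3) derivative_zero_outside[OF 1(2)] unfolding C0c_def by blast
qed

lemma C0c_bounded:
  assumes "C0c \<phi>" obtains B where "\<And>z. \<bar>\<phi> z\<bar> \<le> B"
proof -
  obtain r a b where s: "\<And>z. z \<notin> cyl r a b \<Longrightarrow> \<phi> z = 0" using assms by (auto simp: C0c_def)
  have "bounded (\<phi> ` cyl r a b)"
    using assms by (intro compact_imp_bounded compact_continuous_image compact_cyl)
      (auto simp: C0c_def intro: continuous_on_subset)
  then obtain B where B: "\<And>z. z \<in> cyl r a b \<Longrightarrow> \<bar>\<phi> z\<bar> \<le> B" unfolding bounded_iff by auto
  have "\<bar>\<phi> z\<bar> \<le> max B 0" for z
    using B[of z] s[of z] by (cases "z \<in> cyl r a b") auto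
  then show ?thesis by (rule that)
qed

lemma C0c_mult: "C0c \<phi> \<Longrightarrow> continuous_on UNIV h \<Longrightarrow> C0c (\<lambda>z. h z * \<phi> z)"
  unfolding C0c_def using continuous_on_mult by (metis mult_zero_right)

lemma C0c_borel: "C0c \<phi> \<Longrightarrow> \<phi> \<in> borel_measurable borel"
  unfolding C0c_def by (auto intro: borel_measurable_continuous_onI)

lemma integrable_C0c:
  assumes "L1loc h" "C0c \<phi>"
  shows "integrable lebesgue (\<lambda>z. \<phi> z *\<^sub>R h z)"
proof -
  obtain r a b where s: "0 < a" "\<And>z. z \<notin> cyl r a b \<Longrightarrow> \<phi> z = 0" using assms(2) by (auto simp: C0c_def)
  obtain B where B: "\<And>z. \<bar>\<phi> z\<bar> \<le> B" using C0c_bounded[OF assms(2)] by metis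
  have i: "integrable lebesgue (\<lambda>z. indicator (cyl r a b) z *\<^sub>R h z)"
    using assms(1) s(1) by (auto simp: L1loc_def set_integrable_def)
  have m: "\<phi> \<in> borel_measurable lebesgue"
    using C0c_borel[OF assms(2)] by (simp add: measurable_completion)
  have "integrable lebesgue (\<lambda>z. \<phi> z *\<^sub>R (indicator (cyl r a b) z *\<^sub>R h z))"
  proof (rule Bochner_Integration.integrable_bound)
    show "integrable lebesgue (\<lambda>z. B * norm (indicator (cyl r a b) z *\<^sub>R h z))"
      by (intro integrable_mult_right integrable_norm i)
    show "(\<lambda>z. \<phi> z *\<^sub>R (indicator (cyl r a b) z *\<^sub>R h z)) \<in> borel_measurable lebesgue"
      by (intro borel_measurable_scaleR m borel_measurable_integrable[OF i])
    show "AE z in lebesgue. norm (\<phi> z *\<^sub>R (indicator (cyl r a b) z *\<^sub>R h z))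
        \<le> norm (B * norm (indicator (cyl r a b) z *\<^sub>R h z))"
    proof (rule AE_I2)
      fix z
      have "B \<ge> 0" using B[of z] by linarith
      then show "norm (\<phi> z *\<^sub>R (indicator (cyl r a b) z *\<^sub>R h z))
        \<le> norm (B * norm (indicator (cyl r a b) z *\<^sub>R h z))"
        using mult_right_mono[OF B[of z], of "norm (indicator (cyl r a b) z *\<^sub>R h z)"]
        by (simp add: abs_mult mult.assoc)
    qed
  qed
  moreover have "(\<lambda>z. \<phi> z *\<^sub>R (indicator (cyl r a b) z *\<^sub>R h z)) = (\<lambda>z. \<phi> z *\<^sub>R h z)"
    using s(2) by (auto simp: indicator_def fun_eq_iff)
  ultimately show ?thesis by simp
qed

text \<open>A common support and a common bound give domination by a multiple of |h| on one
  cylinder. The limit need not be continuous, which admits indicators of open sets and functions cut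
  off on the axis.\<close>

lemma tendsto_integral_C0c:
  fixes h :: "(real ^ 'n) \<times> real \<Rightarrow> real"
  assumes h: "L1loc h" and "0 < a"
    and z: "\<And>n z. z \<notin> cyl r a b \<Longrightarrow> \<psi> n z = 0" and B: "\<And>n z. \<bar>\<psi> n z\<bar> \<le> B"
    and c: "\<And>n. continuous_on UNIV (\<psi> n)" and l: "\<And>z. (\<lambda>n. \<psi> n z) \<longlonglongrightarrow> \<phi> z"
  shows "(\<lambda>n. LINT z|lebesgue. \<psi> n z * h z) \<longlonglongrightarrow> (LINT z|lebesgue. \<phi> z * h z)"
proof -
  have i: "integrable lebesgue (\<lambda>z. indicator (cyl r a b) z *\<^sub>R h z)"
    using h \<open>0 < a\<close> by (auto simp: L1loc_def set_integrable_def)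
  have [measurable]: "\<psi> n \<in> borel_measurable lebesgue" for n
    using borel_measurable_continuous_onI[OF c] by (simp add: measurable_completion)
  have [measurable]: "\<phi> \<in> borel_measurable lebesgue"
    by (rule borel_measurable_LIMSEQ_real[OF l]) measurable
  have [measurable]: "(\<lambda>z. indicator (cyl r a b) z *\<^sub>R h z) \<in> borel_measurable lebesgue"
    using i by auto
  have nb: "norm (\<psi> n z * k) \<le> B * norm k" for n z and k :: real
    using mult_right_mono[OF B, of "\<bar>k\<bar>"] by (simp add: abs_mult)
  have \<phi>: "\<phi> z = 0" if "z \<notin> cyl r a b" for z
    using l[of z] z[OF that] by (simp add: LIMSEQ_const_iff)
  have eq: "\<psi> n z * h z = \<psi> n z * (indicator (cyl r a b) z *\<^sub>R h z)" "\<phi> z * h z = \<phi> z * (indicator (cyl r a b) z *\<^sub>R h z)" for n z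
    using z \<phi> by (cases "z \<in> cyl r a b"; simp)+
  show ?thesis unfolding eq
  proof (rule integral_dominated_convergence[where w = "\<lambda>z. B * norm (indicator (cyl r a b) z *\<^sub>R h z)"])
    show "integrable lebesgue (\<lambda>z. B * norm (indicator (cyl r a b) z *\<^sub>R h z))"
      by (intro integrable_mult_right integrable_norm i)
    show "AE z in lebesgue. (\<lambda>n. \<psi> n z * (indicator (cyl r a b) z *\<^sub>R h z)) \<longlonglongrightarrow> \<phi> z * (indicator (cyl r a b) z *\<^sub>R h z)"
      by (intro AE_I2 tendsto_intros l)
    show "AE z in lebesgue. norm (\<psi> n z * (indicator (cyl r a b) z *\<^sub>R h z)) \<le> B * norm (indicator (cyl r a b) z *\<^sub>R h z)" for n
      by (intro AE_I2 nb)
  qed measurable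
qed

lemma test_funI:
  assumes "\<And>k. Ck k \<eta>" "0 < a" "\<And>z. z \<notin> cyl r a b \<Longrightarrow> \<eta> z = 0"
  shows "test_fun \<eta>"
proof -
  have "closure {z. \<eta> z \<noteq> 0} \<subseteq> cyl r a b"
    using assms(3) by (intro closure_minimal) (auto simp: compact_imp_closed[OF compact_cyl])
  moreover from this have "compact (closure {z. \<eta> z \<noteq> 0})"
    using compact_cyl by (metis closed_closure compact_Int_closed inf.absorb_iff2)
  ultimately show ?thesis
    using assms cyl_subset_S_inf[OF assms(2)] unfolding test_fun_def by blast
qed

lemma test_fun_C1c:
  assumes "test_fun \<eta>"
  shows "C1c \<eta> (\<lambda>z. frechet_derivative \<eta> (at z))"
proof -
  have 2: "Ck (Suc (Suc 0)) \<eta>" and K: "compact (closure {z. \<eta> z \<noteq> 0})" "closure {z. \<eta> z \<noteq> 0} \<subseteq> S_inf"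
    using assms by (auto simp: test_fun_def simp del: Ck.simps)
  obtain r a b where "0 < a" "closure {z. \<eta> z \<noteq> 0} \<subseteq> cyl r a b"
    using compact_subset_cyl[OF K] by metis
  moreover from this have "\<eta> z = 0" if "z \<notin> cyl r a b" for z
    using that closure_subset[of "{z. \<eta> z \<noteq> 0}"] by auto
  moreover have "continuous_on UNIV \<eta>" using Ck_SucD[OF Ck_SucD[OF 2]] by simp
  moreover have "continuous_on UNIV (\<lambda>z. frechet_derivative \<eta> (at z) v)" for v
  proof -
    have "Ck (Suc 0) (\<lambda>z. frechet_derivative \<eta> (at z) v)" using 2 Ck.simps(2)[of "Suc 0" \<eta>] by blast
    from Ck_SucD[OF this] show ?thesis by (simp only: Ck.simps(1))
  qed
  ultimately show ?thesis
    using Ck_Suc_has_derivative[OF 2] unfolding C1c_def C0c_def by blast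
qed

section \<open>Approximation of C^1 test functions by smooth ones\<close>

locale cyl_support =
  fixes \<phi> :: "(real ^ 'n) \<times> real \<Rightarrow> real" and r a b
  assumes cont: "continuous_on UNIV \<phi>" and a: "0 < a" and supp: "\<And>z. z \<notin> cyl r a b \<Longrightarrow> \<phi> z = 0"
begin

sublocale compact_support \<phi> "cyl r a b"
  using cont supp by unfold_locales (auto simp: compact_cyl)

text \<open>Mollification enlarges the support by at most \<open>e\<close>. Keeping \<open>e\<close>
  below a/2 leaves it at positive times.\<close>

lemma moll_outside:
  assumes e: "0 < e" "e \<le> a / 2" and z: "z \<notin> cyl (r + a / 2) (a / 2) (b + a / 2)"
  shows "moll e \<phi> z = 0"
proof (rule moll_eq_0[OF e(1)])
  fix y :: "(real ^ 'n) \<times> real" assume y: "y \<in> cyl r a b"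
  show "e \<le> dist z y"
  proof (rule ccontr)
    assume "\<not> e \<le> dist z y"
    then have d: "dist z y < a / 2" using e(2) by linarith
    have "dist (fst z) (fst y) \<le> dist z y" "dist (snd z) (snd y) \<le> dist z y"
      by (rule dist_fst_le, rule dist_snd_le)
    moreover have "norm (fst z) \<le> norm (fst y) + dist (fst z) (fst y)"
      by (metis dist_norm norm_triangle_sub)
    ultimately have "z \<in> cyl (r + a / 2) (a / 2) (b + a / 2)"
      using d y by (cases z, cases y) (auto simp: cyl_def dist_real_def)
    with z show False by contradiction
  qed
qed

lemma test_fun_moll: "0 < e \<Longrightarrow> e \<le> a / 2 \<Longrightarrow> test_fun (moll e \<phi>)"
  using a moll_outside by (intro test_funI[where a = "a / 2"] Ck_moll) auto

lemma moll_integral_tendsto: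
  assumes "L1loc h"
  shows "(\<lambda>n. LINT z|lebesgue. moll (inverse (real (Suc (n + nat \<lceil>2 / a\<rceil>)))) \<phi> z * h z)
    \<longlonglongrightarrow> (LINT z|lebesgue. \<phi> z * h z)"
proof -
  \<comment> \<open>Shifting the index by 2/a makes every radius at most a/2, so that all mollified
    functions live in one cylinder.\<close>
  define N where "N = nat \<lceil>2 / a\<rceil>"
  have e: "0 < inverse (real (Suc (n + N)))" "inverse (real (Suc (n + N))) \<le> a / 2" for n
  proof -
    have "2 / a \<le> real (Suc (n + N))" unfolding N_def by linarith
    then have "inverse (real (Suc (n + N))) \<le> inverse (2 / a)" using a by (intro le_imp_inverse_le) auto
    then show "inverse (real (Suc (n + N))) \<le> a / 2" by simp
  qed simp
  have "C0c \<phi>" using cont a supp by (auto simp: C0c_def)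
  then obtain B where B: "\<And>z. \<bar>\<phi> z\<bar> \<le> B" using C0c_bounded by metis
  show ?thesis
    unfolding N_def[symmetric]
  proof (rule tendsto_integral_C0c[OF assms, of "a / 2" "r + a / 2" "b + a / 2"])
    show "0 < a / 2" using a by simp
    show "moll (inverse (real (Suc (n + N)))) \<phi> z = 0" if "z \<notin> cyl (r + a / 2) (a / 2) (b + a / 2)" for n z
      using moll_outside e that by blast
    show "\<bar>moll (inverse (real (Suc (n + N)))) \<phi> z\<bar> \<le> B" for n z
      using moll_bound[OF e(1) B] .
    show "continuous_on UNIV (moll (inverse (real (Suc (n + N)))) \<phi>)" for n
      using Ck_moll[of 0] by simp
    show "(\<lambda>n. moll (inverse (real (Suc (n + N)))) \<phi> z) \<longlonglongrightarrow> \<phi> z" for z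
      using LIMSEQ_ignore_initial_segment[OF moll_tendsto, of N] .
  qed
qed

end

lemma inverse_Suc_le:
  assumes "0 < (a::real)"
  shows "0 < inverse (real (Suc (n + nat \<lceil>2 / a\<rceil>)))" "inverse (real (Suc (n + nat \<lceil>2 / a\<rceil>))) \<le> a / 2"
proof -
  have "2 / a \<le> real (Suc (n + nat \<lceil>2 / a\<rceil>))" by linarith
  then have "inverse (real (Suc (n + nat \<lceil>2 / a\<rceil>))) \<le> inverse (2 / a)"
    using assms by (intro le_imp_inverse_le) auto
  then show "inverse (real (Suc (n + nat \<lceil>2 / a\<rceil>))) \<le> a / 2" by simp
qed simp

lemma test_approx_C0c:
  assumes "C0c \<phi>" "L1loc c"
  obtains \<eta> where "\<And>n::nat. test_fun (\<eta> n)"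
    "(\<lambda>n. LINT z|lebesgue. \<eta> n z * c z) \<longlonglongrightarrow> (LINT z|lebesgue. \<phi> z * c z)"
proof -
  obtain r a b where "cyl_support \<phi> r a b"
    using assms(1) by (auto simp: C0c_def cyl_support_def)
  then interpret cyl_support \<phi> r a b .
  show ?thesis
    using that[OF test_fun_moll[OF inverse_Suc_le[OF a]] moll_integral_tendsto[OF assms(2)]] .
qed

text \<open>A single space-time field \<open>V\<close> serves both weak notions: for the equation it
  carries the flux in its space slot and minus the density in its time slot, for a weak derivative
  it is \<open>w\<close> times a coordinate direction.\<close>

definition wint :: "((real ^ 'n) \<times> real \<Rightarrow> real) \<Rightarrow> ((real ^ 'n) \<times> real \<Rightarrow> (real ^ 'n) \<times> real) \<Rightarrow>
    ((real ^ 'n) \<times> real \<Rightarrow> real) \<Rightarrow> ((real ^ 'n) \<times> real \<Rightarrow> (real ^ 'n) \<times> real \<Rightarrow> real) \<Rightarrow> real" where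
  "wint c V \<phi> \<phi>' = (LINT z|lebesgue. \<phi> z * c z + \<phi>' z (V z))"

lemma L1loc_inner: "L1loc V \<Longrightarrow> L1loc (\<lambda>z. V z \<bullet> b)"
  by (rule L1loc_bounded_linear[of V "\<lambda>x. x \<bullet> b"]) (auto intro: bounded_linear_inner_left)

lemma C1c_expand:
  assumes "C1c \<phi> \<phi>'"
  shows "\<phi>' z (V z) = (\<Sum>b\<in>Basis. \<phi>' z b * (V z \<bullet> b))"
proof -
  have "\<phi>' z (V z) = \<phi>' z (\<Sum>b\<in>Basis. (V z \<bullet> b) *\<^sub>R b)" by (simp add: euclidean_representation)
  also have "\<dots> = (\<Sum>b\<in>Basis. \<phi>' z b * (V z \<bullet> b))"
    using C1cD(5)[OF assms] by (simp add: linear_sum linear_cmul mult.commute)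
  finally show ?thesis .
qed

lemma integrable_C1c:
  assumes "C1c \<phi> \<phi>'" "L1loc V"
  shows "integrable lebesgue (\<lambda>z. \<phi>' z (V z))"
  unfolding C1c_expand[OF assms(1)]
  using integrable_C0c[OF L1loc_inner[OF assms(2)] C1cD(4)[OF assms(1)]]
  by (intro Bochner_Integration.integrable_sum) simp

lemma wint_expand:
  assumes "C1c \<phi> \<phi>'" "L1loc c" "L1loc V"
  shows "wint c V \<phi> \<phi>' = (LINT z|lebesgue. \<phi> z * c z) + (\<Sum>b\<in>Basis. LINT z|lebesgue. \<phi>' z b * (V z \<bullet> b))"
proof -
  have i: "integrable lebesgue (\<lambda>z. \<phi> z * c z)" "integrable lebesgue (\<lambda>z. \<phi>' z b * (V z \<bullet> b))" for b
    using integrable_C0c[OF assms(2) C1cD(1)[OF assms(1)]]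
      integrable_C0c[OF L1loc_inner[OF assms(3)] C1cD(4)[OF assms(1)]] by simp_all
  show ?thesis
    unfolding wint_def C1c_expand[OF assms(1)]
    by (subst Bochner_Integration.integral_add) (auto intro!: i simp: i)
qed

text \<open>In coordinates \<open>wint\<close> is a finite sum of scalar pairings, each of which
  converges because mollification commutes with differentiation. Sign preservation is what
  supersolutions and subsolutions need.\<close>

lemma test_approx_C1c:
  assumes "C1c \<phi> \<phi>'" "L1loc c" "L1loc V"
  obtains \<eta> where "\<And>n::nat. test_fun (\<eta> n)" "\<And>n z. (\<And>z. 0 \<le> \<phi> z) \<Longrightarrow> 0 \<le> \<eta> n z"
    "(\<lambda>n. wint c V (\<eta> n) (\<lambda>z. frechet_derivative (\<eta> n) (at z))) \<longlonglongrightarrow> wint c V \<phi> \<phi>'"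
proof -
  obtain r a b where \<phi>: "cyl_support \<phi> r a b"
    using C1cD(1)[OF assms(1)] by (auto simp: C0c_def cyl_support_def)
  then interpret cyl_support \<phi> r a b .
  have \<phi>': "cyl_support (\<lambda>z. \<phi>' z v) r a b" for v
    using C1cD(3)[OF assms(1)] derivative_zero_outside[OF C1cD(2)[OF assms(1)] supp] a
    by unfold_locales auto
  define \<eta> where "\<eta> n = moll (inverse (real (Suc (n + nat \<lceil>2 / a\<rceil>)))) \<phi>" for n
  note e = inverse_Suc_le[OF a]
  have t: "test_fun (\<eta> n)" for n
    unfolding \<eta>_def by (rule test_fun_moll[OF e])
  have d: "frechet_derivative (\<eta> n) (at z) = (\<lambda>v. moll (inverse (real (Suc (n + nat \<lceil>2 / a\<rceil>)))) (\<lambda>x. \<phi>' x v) z)" for n z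
    unfolding \<eta>_def
    by (rule frechet_derivative_at[symmetric], rule moll_has_derivative[OF e(1) C1cD(2,3)[OF assms(1)]])
  have "(\<lambda>n. wint c V (\<eta> n) (\<lambda>z. frechet_derivative (\<eta> n) (at z))) \<longlonglongrightarrow> wint c V \<phi> \<phi>'"
    unfolding wint_expand[OF test_fun_C1c[OF t] assms(2,3)] unfolding wint_expand[OF assms] d
    unfolding \<eta>_def
    by (intro tendsto_add tendsto_sum moll_integral_tendsto assms
        cyl_support.moll_integral_tendsto[OF \<phi>'] L1loc_inner)
  moreover have "0 \<le> \<eta> n z" if "\<And>z. 0 \<le> \<phi> z" for n z
    unfolding \<eta>_def using moll_nonneg[OF e(1) that] .
  ultimately show ?thesis using that[of \<eta>] t by simp
qed

lemma wint_C1c_eq_0: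
  assumes "C1c \<phi> \<phi>'" "L1loc c" "L1loc V"
    and "\<And>\<eta>. test_fun \<eta> \<Longrightarrow> wint c V \<eta> (\<lambda>z. frechet_derivative \<eta> (at z)) = 0"
  shows "wint c V \<phi> \<phi>' = 0"
proof -
  obtain \<eta> where "\<And>n::nat. test_fun (\<eta> n)"
    "(\<lambda>n. wint c V (\<eta> n) (\<lambda>z. frechet_derivative (\<eta> n) (at z))) \<longlonglongrightarrow> wint c V \<phi> \<phi>'"
    by (rule test_approx_C1c[OF assms(1-3)]) blast
  then show ?thesis using assms(4) by (simp add: LIMSEQ_const_iff)
qed

lemma wint_C1c_nonneg:
  fixes \<phi> :: "(real ^ 'n) \<times> real \<Rightarrow> real"
  assumes "C1c \<phi> \<phi>'" "L1loc c" "L1loc V" "\<And>z. 0 \<le> \<phi> z"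
    and "\<And>\<eta>. test_fun \<eta> \<Longrightarrow> (\<And>z. 0 \<le> \<eta> z) \<Longrightarrow> 0 \<le> wint c V \<eta> (\<lambda>z. frechet_derivative \<eta> (at z))"
  shows "0 \<le> wint c V \<phi> \<phi>'"
proof (rule test_approx_C1c[OF assms(1-3)])
  fix \<eta> :: "nat \<Rightarrow> (real ^ 'n) \<times> real \<Rightarrow> real"
  assume t: "\<And>n. test_fun (\<eta> n)" and n: "\<And>n z. (\<And>z. 0 \<le> \<phi> z) \<Longrightarrow> 0 \<le> \<eta> n z"
    and l: "(\<lambda>n. wint c V (\<eta> n) (\<lambda>z. frechet_derivative (\<eta> n) (at z))) \<longlonglongrightarrow> wint c V \<phi> \<phi>'"
  have "0 \<le> wint c V (\<eta> n) (\<lambda>z. frechet_derivative (\<eta> n) (at z))" for n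
    by (rule assms(5)[OF t n[OF assms(4)]])
  then show "0 \<le> wint c V \<phi> \<phi>'" by (intro LIMSEQ_le_const[OF l]) blast
qed

text \<open>Smooth tests give continuous ones by mollification; truncated multiples of the distance
  to the complement increase to indicators of open sets inside \<Omega> n; then vanishing integrals
  over open sets force the function to vanish. The sets \<Omega> n exhaust
  \<open>S_inf\<close>.\<close>

lemma AE_zero_if_test_integrals_zero:
  fixes c :: "(real ^ 'n) \<times> real \<Rightarrow> real"
  assumes c: "L1loc c" and t: "\<And>\<eta>. test_fun \<eta> \<Longrightarrow> (LINT z|lebesgue. \<eta> z * c z) = 0"
  shows "AE z in lebesgue. z \<in> S_inf \<longrightarrow> c z = 0"
proof -
  have t0: "(LINT z|lebesgue. \<phi> z * c z) = 0" if \<phi>: "C0c \<phi>" for \<phi>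
  proof (rule test_approx_C0c[OF \<phi> c])
    fix \<eta> :: "nat \<Rightarrow> (real ^ 'n) \<times> real \<Rightarrow> real"
    assume "\<And>n. test_fun (\<eta> n)"
      and l: "(\<lambda>n. LINT z|lebesgue. \<eta> n z * c z) \<longlonglongrightarrow> (LINT z|lebesgue. \<phi> z * c z)"
    then have "(LINT z|lebesgue. \<eta> n z * c z) = 0" for n using t by blast
    with l show ?thesis by (simp add: LIMSEQ_const_iff)
  qed
  define \<Omega> :: "nat \<Rightarrow> ((real ^ 'n) \<times> real) set" where "\<Omega> n = ball 0 (real n) \<times> {inverse (real n)<..<real n}" for n
  have \<Omega>: "open (\<Omega> n)" for n unfolding \<Omega>_def by (intro open_Times) auto
  have \<Omega>c: "\<Omega> n \<subseteq> cyl (real n) (inverse (real n)) (real n)" for n by (auto simp: \<Omega>_def cyl_def)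
  have "AE z in lebesgue. indicator (\<Omega> n) z * c z = 0" for n
  proof (cases "n = 0")
    case False
    then have n: "0 < inverse (real n)" by simp
    have i: "integrable lebesgue (\<lambda>z. indicator (cyl (real n) (inverse (real n)) (real n)) z *\<^sub>R c z)"
      using c n by (auto simp: L1loc_def set_integrable_def)
    have ih: "integrable lebesgue (\<lambda>z. indicator (\<Omega> n) z * c z)"
    proof -
      have "\<Omega> n \<in> sets lebesgue" using borel_open[OF \<Omega>] by (intro sets_completionI_sets) simp
      from integrable_mult_indicator[OF this i] show ?thesis
        using \<Omega>c[of n] by (auto simp: indicator_def fun_eq_iff elim!: back_subst[of "integrable lebesgue"])
    qed
    \<comment> \<open>The argument with open sets concerns \<open>lborel\<close>, whereas
      \<open>c\<close> is only Lebesgue measurable; hence a Borel representative.\<close>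
    obtain h where h: "h \<in> borel_measurable lborel" "AE z in lborel. indicator (\<Omega> n) z * c z = h z"
      using completion_ex_borel_measurable_real[OF borel_measurable_integrable[OF ih]] by auto
    have h2: "AE z in lebesgue. indicator (\<Omega> n) z * c z = h z" using h(2) by (rule AE_completion)
    have hl: "integrable lebesgue h"
      using integrable_cong_AE[of "\<lambda>z. indicator (\<Omega> n) z * c z" lebesgue h] ih h2 h(1)
      by (simp add: measurable_completion borel_measurable_integrable[OF ih])
    then have hb: "integrable lborel h" using h(1) by (simp add: integrable_completion)
    have "AE z in lborel. h z = 0"
    proof (rule AE_zero_if_open_integrals_zero[OF hb])
      fix A :: "((real ^ 'n) \<times> real) set" assume A: "open A"
      define C where "C = - (A \<inter> \<Omega> n)"
      have C: "closed C" unfolding C_def using A \<Omega> by auto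
      \<comment> \<open>The distance to the empty set is 0 by convention, so \<open>infdist\<close>
        separates points from \<open>C\<close> only once \<open>C\<close> is known to be
        nonempty.\<close>
      have Cne: "C \<noteq> {}"
      proof
        assume "C = {}"
        then have "(0, -1) \<in> \<Omega> n" by (auto simp: C_def)
        then have "inverse (real n) < - 1" by (auto simp: \<Omega>_def)
        with n show False by linarith
      qed
      define \<psi> where "\<psi> k z = min 1 (real k * infdist z C)" for k z
      have \<psi>C0c: "C0c (\<psi> k)" for k
        unfolding C0c_def
      proof
        show "continuous_on UNIV (\<psi> k)" unfolding \<psi>_def by (intro continuous_intros)
        have "\<psi> k z = 0" if "z \<notin> cyl (real n) (inverse (real n)) (real n)" for z
        proof -
          have "z \<in> C" using that \<Omega>c by (auto simp: C_def)
          then show ?thesis by (simp add: \<psi>_def infdist_zero)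
        qed
        then show "\<exists>r a b. 0 < a \<and> (\<forall>z. z \<notin> cyl r a b \<longrightarrow> \<psi> k z = 0)" using n by blast
      qed
      have \<psi>b: "\<bar>\<psi> k z\<bar> \<le> 1" for k z using infdist_nonneg[of z C] by (auto simp: \<psi>_def)
      have \<psi>l: "(\<lambda>k. \<psi> k z) \<longlonglongrightarrow> indicator (A \<inter> \<Omega> n) z" for z
      proof (cases "z \<in> C")
        case True
        then have "indicator (A \<inter> \<Omega> n) z = (0::real)" by (simp add: C_def)
        with True show ?thesis by (simp add: \<psi>_def infdist_zero)
      next
        case False
        then have d: "0 < infdist z C" using C Cne infdist_pos_not_in_closed by blast
        have "\<forall>\<^sub>F k in sequentially. \<psi> k z = 1"
        proof (rule eventually_sequentiallyI)
          fix k assume "nat \<lceil>1 / infdist z C\<rceil> \<le> k"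
          then have "1 / infdist z C \<le> real k" by linarith
          then show "\<psi> k z = 1" using d by (simp add: \<psi>_def divide_le_eq min_def)
        qed
        then have "(\<lambda>k. \<psi> k z) \<longlonglongrightarrow> 1" by (rule tendsto_eventually)
        then show ?thesis using False by (simp add: indicator_def C_def)
      qed
      have "(\<lambda>k. LINT z|lebesgue. \<psi> k z * c z) \<longlonglongrightarrow> (LINT z|lebesgue. indicator (A \<inter> \<Omega> n) z * c z)"
      proof (rule tendsto_integral_C0c[OF c n, of "real n" "real n"])
        show "\<psi> k z = 0" if "z \<notin> cyl (real n) (inverse (real n)) (real n)" for k z
        proof -
          have "z \<in> C" using that \<Omega>c by (auto simp: C_def)
          then show ?thesis by (simp add: \<psi>_def infdist_zero)
        qed
      qed (use \<psi>C0c \<psi>b \<psi>l in \<open>auto simp: C0c_def\<close>)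
      then have z: "(LINT z|lebesgue. indicator (A \<inter> \<Omega> n) z * c z) = 0"
        using t0[OF \<psi>C0c] by (simp add: LIMSEQ_const_iff)
      have "(LINT z|lborel. indicator A z * h z) = (LINT z|lebesgue. indicator A z * h z)"
        using h(1) borel_open[OF A] by (subst integral_completion) auto
      also have "\<dots> = (LINT z|lebesgue. indicator (A \<inter> \<Omega> n) z * c z)"
      proof (rule integral_cong_AE)
        have Am: "A \<in> sets lebesgue" using borel_open[OF A] by (intro sets_completionI_sets) simp
        show "(\<lambda>z. indicator A z * h z) \<in> borel_measurable lebesgue"
          using Am h(1) by (intro borel_measurable_times borel_measurable_indicator) (auto simp: measurable_completion)
        have "(\<lambda>z. indicator A z * (indicator (\<Omega> n) z * c z)) \<in> borel_measurable lebesgue"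
          by (rule borel_measurable_times[OF borel_measurable_indicator[OF Am] borel_measurable_integrable[OF ih]])
        then show "(\<lambda>z. indicator (A \<inter> \<Omega> n) z * c z) \<in> borel_measurable lebesgue"
          by (simp add: indicator_inter_arith mult.assoc)
        show "AE z in lebesgue. indicator A z * h z = indicator (A \<inter> \<Omega> n) z * c z"
          using h2 by eventually_elim (simp add: indicator_inter_arith mult.assoc)
      qed
      finally show "(LINT z|lborel. indicator A z * h z) = 0" using z by simp
    qed
    then have "AE z in lebesgue. h z = 0" by (rule AE_completion)
    with h2 show ?thesis by eventually_elim simp
  qed (simp add: \<Omega>_def)
  then have "AE z in lebesgue. \<forall>n. indicator (\<Omega> n) z * c z = 0" unfolding AE_all_countable by blast
  then show ?thesis
  proof eventually_elim
    case (elim z)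
    show ?case
    proof
      assume "z \<in> S_inf"
      then have s: "0 < snd z" by (auto simp: S_inf_def)
      define n where "n = nat \<lceil>max (norm (fst z)) (max (snd z) (inverse (snd z)))\<rceil> + 1"
      have "norm (fst z) < real n" "snd z < real n" and i: "inverse (snd z) < real n" unfolding n_def by linarith+
      moreover have "inverse (real n) < snd z"
        using less_imp_inverse_less[OF i] s by simp
      ultimately have "z \<in> \<Omega> n" by (cases z) (auto simp: \<Omega>_def)
      with elim[rule_format, of n] show "c z = 0" by simp
    qed
  qed
qed

section \<open>Jacobians of radial maps\<close>

text \<open>Double counting with the unit ball B: integrate 1_A(Qx) 1_B(y - Qx) over x and y.
  Integrating in y first gives |Q^(-1)A| |B|. Shifting x by c with Qc = y and using that Q preserves
  B gives |A| |B|. No determinant enters.\<close>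

lemma lborel_orthogonal:
  fixes Q :: "'a::euclidean_space \<Rightarrow> 'a"
  assumes lin: "linear Q" and nm: "\<And>x. norm (Q x) = norm x"
  shows "distr lborel borel Q = lborel"
proof (rule measure_eqI)
  fix A assume "A \<in> sets (distr lborel borel Q)"
  then have A [measurable]: "A \<in> sets borel" by simp
  have "continuous_on UNIV Q" using lin linear_continuous_on linear_conv_bounded_linear by blast
  then have Qm [measurable]: "Q \<in> borel_measurable borel" by (rule borel_measurable_continuous_onI)
  have "inj Q"
    using nm by (intro linear_injective_0[OF lin, THEN iffD2]) (metis norm_eq_zero)
  then have surj: "surj Q" using lin by (metis linear_injective_imp_surjective)
  define B :: "'a set" where "B = ball 0 1"
  have [measurable]: "B \<in> sets borel" by (simp add: B_def)
  have tr: "(\<integral>\<^sup>+x. F (c + x) \<partial>lborel) = (\<integral>\<^sup>+x. F x \<partial>lborel)"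
    if [measurable]: "F \<in> borel_measurable borel" for F :: "'a \<Rightarrow> ennreal" and c
    using nn_integral_distr[of "(+) c" lborel borel F] by (simp add: lborel_distr_plus)
  have "emeasure lborel (Q -` A) * emeasure lborel B =
      (\<integral>\<^sup>+x. \<integral>\<^sup>+y. indicator A (Q x) * indicator B (y - Q x) \<partial>lborel \<partial>lborel)"
  proof -
    have "(\<integral>\<^sup>+y. indicator A (Q x) * indicator B (y - Q x) \<partial>lborel) = indicator (Q -` A) x * emeasure lborel B" for x
      using tr[of "\<lambda>y. indicator B y" "- Q x"] by (simp add: nn_integral_cmult indicator_vimage)
    moreover have "Q -` A \<in> sets lborel" using measurable_sets[OF Qm A] by simp
    ultimately show ?thesis by (simp add: nn_integral_multc)
  qed
  also have "\<dots> = (\<integral>\<^sup>+y. \<integral>\<^sup>+x. indicator A (Q x) * indicator B (y - Q x) \<partial>lborel \<partial>lborel)"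
    by (rule lborel_pair.Fubini'[symmetric]) measurable
  also have "\<dots> = (\<integral>\<^sup>+y. \<integral>\<^sup>+x. indicator A (y + Q x) * indicator B x \<partial>lborel \<partial>lborel)"
  proof (rule nn_integral_cong)
    fix y
    obtain c where c: "Q c = y" using surj by (metis surjD)
    have "(\<integral>\<^sup>+x. indicator A (Q (c + x)) * indicator B (y - Q (c + x)) \<partial>lborel) =
        (\<integral>\<^sup>+x. indicator A (Q x) * indicator B (y - Q x) \<partial>lborel)"
      by (rule tr) measurable
    moreover have "indicator B (y - Q (c + x)) = (indicator B x :: ennreal)" for x
      using c nm[of x] by (simp add: linear_add[OF lin] B_def indicator_def)
    ultimately show "(\<integral>\<^sup>+x. indicator A (Q x) * indicator B (y - Q x) \<partial>lborel) =
        (\<integral>\<^sup>+x. indicator A (y + Q x) * indicator B x \<partial>lborel)"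
      using c by (simp add: linear_add[OF lin])
  qed
  also have "\<dots> = (\<integral>\<^sup>+x. \<integral>\<^sup>+y. indicator A (y + Q x) * indicator B x \<partial>lborel \<partial>lborel)"
    by (rule lborel_pair.Fubini') measurable
  also have "\<dots> = emeasure lborel A * emeasure lborel B"
  proof -
    have "(\<integral>\<^sup>+y. indicator A (y + Q x) * indicator B x \<partial>lborel) = emeasure lborel A * indicator B x" for x
      using tr[of "\<lambda>y. indicator A y" "Q x"] by (simp add: nn_integral_multc add.commute)
    then show ?thesis by (simp add: nn_integral_cmult)
  qed
  finally have "emeasure lborel (Q -` A) * emeasure lborel B = emeasure lborel A * emeasure lborel B" .
  moreover have "emeasure lborel B \<noteq> 0"
    using open_not_negligible[of B] by (auto simp: B_def negligible_iff_null_sets null_sets_def)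
  moreover have "emeasure lborel B \<noteq> \<infinity>"
    using emeasure_lborel_ball_finite[of "0::'a" 1] by (simp add: B_def)
  ultimately have "emeasure lborel (Q -` A) = emeasure lborel A"
    by (metis ennreal_mult_cancel_left infinity_ennreal_def mult.commute)
  then show "emeasure (distr lborel borel Q) A = emeasure lborel A"
    by (simp add: emeasure_distr)
qed simp

text \<open>\<open>\<Psi>\<close> maps the measure \<open>J dz\<close> to Lebesgue measure, that is, \<open>J = |det D\<Psi>|\<close>.\<close>

locale jacobian =
  fixes \<Psi> :: "'a::euclidean_space \<Rightarrow> 'a" and J :: "'a \<Rightarrow> real"
  assumes \<Psi>_borel: "\<Psi> \<in> borel_measurable borel" and J_borel: "J \<in> borel_measurable borel"
    and J_pos: "\<And>z. 0 < J z"
    and distr_lborel: "distr (density lborel (\<lambda>z. ennreal (J z))) borel \<Psi> = lborel"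
begin

lemma J_lebesgue [measurable]: "J \<in> borel_measurable lebesgue"
  using J_borel by (simp add: measurable_completion)

lemma density_lebesgue: "density lebesgue (\<lambda>z. ennreal (J z)) = completion (density lborel (\<lambda>z. ennreal (J z)))"
  using J_borel J_pos by (intro completion_density_eq[symmetric]) (auto intro!: AE_I2)

lemma distr_lebesgue_lborel: "distr (density lebesgue (\<lambda>z. ennreal (J z))) lborel \<Psi> = lborel"
proof -
  have "distr (density lebesgue (\<lambda>z. ennreal (J z))) lborel \<Psi> = distr (density lborel (\<lambda>z. ennreal (J z))) lborel \<Psi>"
    unfolding density_lebesgue using \<Psi>_borel by (intro distr_completion) simp
  also have "\<dots> = lborel" using distr_lborel by (simp cong: distr_cong)
  finally show ?thesis .
qed

text \<open>Borel measurability alone would not make preimages of Lebesgue sets measurable. The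
  push-forward identity does: preimages of null sets are null for the measure with density
  \<open>J\<close>, which is complete.\<close>

lemma \<Psi>_lebesgue: "\<Psi> \<in> lebesgue \<rightarrow>\<^sub>M lebesgue"
  and distr_lebesgue: "distr (density lebesgue (\<lambda>z. ennreal (J z))) lebesgue \<Psi> = lebesgue"
proof -
  interpret complete_measure "density lebesgue (\<lambda>z. ennreal (J z))"
    unfolding density_lebesgue by (rule completion.complete_measure_axioms)
  have m: "\<Psi> \<in> density lebesgue (\<lambda>z. ennreal (J z)) \<rightarrow>\<^sub>M lborel"
    using \<Psi>_borel by (simp add: measurable_completion)
  have "\<Psi> \<in> density lebesgue (\<lambda>z. ennreal (J z)) \<rightarrow>\<^sub>M lebesgue"
    by (rule measurable_completion2[OF m]) (simp add: distr_lebesgue_lborel)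
  then show "\<Psi> \<in> lebesgue \<rightarrow>\<^sub>M lebesgue" by simp
  show "distr (density lebesgue (\<lambda>z. ennreal (J z))) lebesgue \<Psi> = lebesgue"
    using completion_distr_eq[OF m] distr_lebesgue_lborel by simp
qed

lemma AE_comp:
  assumes "AE z in lebesgue. P z" shows "AE z in lebesgue. P (\<Psi> z)"
proof -
  have "AE z in density lebesgue (\<lambda>z. ennreal (J z)). P (\<Psi> z)"
  proof (rule AE_distrD[where M' = lebesgue and f = \<Psi> and P = P])
    show "\<Psi> \<in> density lebesgue (\<lambda>z. ennreal (J z)) \<rightarrow>\<^sub>M lebesgue" using \<Psi>_lebesgue by simp
    show "AE z in distr (density lebesgue (\<lambda>z. ennreal (J z))) lebesgue \<Psi>. P z"
      unfolding distr_lebesgue by (rule assms)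
  qed
  then show ?thesis
    using J_pos by (subst (asm) AE_density) auto
qed

lemma measurable_comp: "F \<in> lebesgue \<rightarrow>\<^sub>M M \<Longrightarrow> (\<lambda>z. F (\<Psi> z)) \<in> lebesgue \<rightarrow>\<^sub>M M"
  using measurable_compose[OF \<Psi>_lebesgue] .

lemma integrable_comp_iff:
  fixes F :: "'a \<Rightarrow> 'b::{banach, second_countable_topology}"
  assumes F: "F \<in> borel_measurable lebesgue"
  shows "integrable lebesgue (\<lambda>z. J z *\<^sub>R F (\<Psi> z)) \<longleftrightarrow> integrable lebesgue F"
proof -
  have "integrable lebesgue F \<longleftrightarrow> integrable (distr (density lebesgue (\<lambda>z. ennreal (J z))) lebesgue \<Psi>) F"
    by (simp add: distr_lebesgue)
  also have "\<dots> \<longleftrightarrow> integrable (density lebesgue (\<lambda>z. ennreal (J z))) (\<lambda>z. F (\<Psi> z))"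
    using F \<Psi>_lebesgue by (intro integrable_distr_eq) auto
  also have "\<dots> \<longleftrightarrow> integrable lebesgue (\<lambda>z. J z *\<^sub>R F (\<Psi> z))"
    using measurable_comp[OF F] J_pos by (intro integrable_density) (auto intro: less_imp_le)
  finally show ?thesis ..
qed

lemma integral_comp:
  fixes F :: "'a \<Rightarrow> 'b::{banach, second_countable_topology}"
  assumes F: "F \<in> borel_measurable lebesgue"
  shows "(LINT z|lebesgue. J z *\<^sub>R F (\<Psi> z)) = (LINT z|lebesgue. F z)"
proof -
  have "(LINT z|lebesgue. F z) = (LINT z|distr (density lebesgue (\<lambda>z. ennreal (J z))) lebesgue \<Psi>. F z)"
    by (simp add: distr_lebesgue)
  also have "\<dots> = (LINT z|density lebesgue (\<lambda>z. ennreal (J z)). F (\<Psi> z))"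
    using F \<Psi>_lebesgue by (intro integral_distr) auto
  also have "\<dots> = (LINT z|lebesgue. J z *\<^sub>R F (\<Psi> z))"
    using measurable_comp[OF F] J_pos by (intro integral_density) (auto intro: less_imp_le)
  finally show ?thesis ..
qed

end

text \<open>By Fubini time is a mere parameter: the identity holds on each time slice.\<close>

lemma jacobian_Times:
  fixes \<Psi> :: "'a::euclidean_space \<Rightarrow> 'a"
  assumes "jacobian \<Psi> J"
  shows "jacobian (\<lambda>z :: 'a \<times> real. (\<Psi> (fst z), snd z)) (\<lambda>z. J (fst z))"
proof
  interpret jacobian \<Psi> J by fact
  note [measurable] = \<Psi>_borel J_borel
  have [measurable]: "(\<lambda>z :: 'a \<times> real. (\<Psi> (fst z), snd z)) \<in> borel_measurable borel"
    by (simp add: borel_prod[symmetric])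
  show "(\<lambda>z :: 'a \<times> real. (\<Psi> (fst z), snd z)) \<in> borel_measurable borel" by measurable
  show [measurable]: "(\<lambda>z :: 'a \<times> real. J (fst z)) \<in> borel_measurable borel"
    by (simp add: borel_prod[symmetric])
  show "0 < J (fst z)" for z :: "'a \<times> real" by (rule J_pos)
  show "distr (density lborel (\<lambda>z. ennreal (J (fst z)))) borel (\<lambda>z :: 'a \<times> real. (\<Psi> (fst z), snd z)) = lborel"
  proof (rule measure_eqI)
    fix A :: "('a \<times> real) set" assume "A \<in> sets (distr (density lborel (\<lambda>z. ennreal (J (fst z)))) borel (\<lambda>z. (\<Psi> (fst z), snd z)))"
    then have A [measurable]: "A \<in> sets borel" by simp
    have A' [measurable]: "A \<in> sets (borel \<Otimes>\<^sub>M borel)" unfolding borel_prod by (rule A)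
    have "emeasure (distr (density lborel (\<lambda>z. ennreal (J (fst z)))) borel (\<lambda>z :: 'a \<times> real. (\<Psi> (fst z), snd z))) A
       = (\<integral>\<^sup>+z. ennreal (J (fst z)) * indicator A (\<Psi> (fst z), snd z) \<partial>lborel)"
      by (subst nn_integral_indicator[symmetric], simp, subst nn_integral_distr, simp, simp, subst nn_integral_density)
         auto
    also have "\<dots> = (\<integral>\<^sup>+z. ennreal (J (fst z)) * indicator A (\<Psi> (fst z), snd z) \<partial>(lborel \<Otimes>\<^sub>M lborel))"
      by (simp add: lborel_prod)
    also have "\<dots> = (\<integral>\<^sup>+t. \<integral>\<^sup>+x. ennreal (J x) * indicator A (\<Psi> x, t) \<partial>lborel \<partial>lborel)"
      by (subst lborel_pair.nn_integral_snd[symmetric]) (auto simp: split_beta)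
    also have "\<dots> = (\<integral>\<^sup>+t. \<integral>\<^sup>+x. indicator A (x, t) \<partial>lborel \<partial>lborel)"
    proof (rule nn_integral_cong)
      fix t :: real
      have "(\<integral>\<^sup>+x. indicator A (x, t) \<partial>lborel) = (\<integral>\<^sup>+x. indicator A (x, t) \<partial>distr (density lborel (\<lambda>z. ennreal (J z))) borel \<Psi>)"
        by (simp add: distr_lborel)
      also have "\<dots> = (\<integral>\<^sup>+x. ennreal (J x) * indicator A (\<Psi> x, t) \<partial>lborel)"
        by (subst nn_integral_distr, measurable, subst nn_integral_density) auto
      finally show "(\<integral>\<^sup>+x. ennreal (J x) * indicator A (\<Psi> x, t) \<partial>lborel) = (\<integral>\<^sup>+x. indicator A (x, t) \<partial>lborel)" ..
    qed
    also have "\<dots> = (\<integral>\<^sup>+z. indicator A z \<partial>(lborel \<Otimes>\<^sub>M lborel))"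
      by (subst lborel_pair.nn_integral_snd[symmetric]) (auto simp: split_beta)
    also have "\<dots> = emeasure lborel A" by (simp add: lborel_prod)
    finally show "emeasure (distr (density lborel (\<lambda>z. ennreal (J (fst z)))) borel (\<lambda>z :: 'a \<times> real. (\<Psi> (fst z), snd z))) A
        = emeasure lborel A" .
  qed simp
qed

section \<open>Truncated cones\<close>

definition cone :: "'a::euclidean_space set \<Rightarrow> real \<Rightarrow> real \<Rightarrow> 'a set" where
  "cone A a b = {x. sgn x \<in> A \<and> a < norm x \<and> norm x \<le> b}"

lemma sgn_borel [measurable]: "(sgn :: 'a::euclidean_space \<Rightarrow> 'a) \<in> borel_measurable borel"
  unfolding sgn_div_norm[abs_def] by measurable

lemma cone_borel [measurable]:
  assumes [measurable]: "A \<in> sets borel"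
  shows "cone A a b \<in> sets borel"
  unfolding cone_def by measurable

text \<open>Scaling by b carries the cone of radii (0,1] to that of radii (0,b], and the general
  case is a difference of two such cones. The constant is the solid angle of \<open>A\<close>
  divided by the dimension, obtained without surface measure.\<close>

lemma emeasure_cone:
  fixes A :: "'a::euclidean_space set"
  assumes A [measurable]: "A \<in> sets borel" and ab: "0 \<le> a" "a \<le> b"
  shows "emeasure lborel (cone A a b) = ennreal (measure lborel (cone A 0 1) * (b ^ DIM('a) - a ^ DIM('a)))"
proof -
  have fin: "emeasure lborel (cone A 0 b) < \<infinity>" for b
    by (rule le_less_trans[OF emeasure_mono emeasure_lborel_cball_finite[of 0 b]]) (auto simp: cone_def)
  have 0: "emeasure lborel (cone A 0 b) = ennreal (measure lborel (cone A 0 1) * b ^ DIM('a))" if "0 \<le> b" for b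
  proof (cases "b = 0")
    case True
    then have "cone A 0 b = {}" by (auto simp: cone_def)
    then show ?thesis using True by (simp add: power_0_left)
  next
    case False
    with that have b: "0 < b" by simp
    have "cone A 0 b = (\<lambda>x. b *\<^sub>R x + 0) ` cone A 0 1"
    proof (intro equalityI subsetI)
      fix x assume x: "x \<in> cone A 0 b"
      have "inverse b *\<^sub>R x \<in> cone A 0 1" using x b by (simp add: cone_def sgn_scaleR field_simps)
      moreover have "x = b *\<^sub>R (inverse b *\<^sub>R x) + 0" using b by simp
      ultimately show "x \<in> (\<lambda>x. b *\<^sub>R x + 0) ` cone A 0 1" by (rule rev_image_eqI)
    qed (use b in \<open>auto simp: cone_def sgn_scaleR mult_le_one\<close>)
    then have "emeasure lebesgue (cone A 0 b) = \<bar>b\<bar> ^ DIM('a) * emeasure lebesgue (cone A 0 1)"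
      using emeasure_lebesgue_affine[of b 0 "cone A 0 1"] by simp
    then show ?thesis
      using b fin[of 1] by (simp add: emeasure_eq_ennreal_measure less_top ennreal_mult' mult.commute)
  qed
  have "cone A a b = cone A 0 b - cone A 0 a" using ab by (auto simp: cone_def)
  then have "emeasure lborel (cone A a b) = emeasure lborel (cone A 0 b) - emeasure lborel (cone A 0 a)"
    using ab fin[of a] by (simp add: emeasure_Diff less_top cone_def Collect_mono_iff)
  also have "\<dots> = ennreal (measure lborel (cone A 0 1) * b ^ DIM('a) - measure lborel (cone A 0 1) * a ^ DIM('a))"
    using ab by (simp add: 0 ennreal_minus)
  finally show ?thesis by (simp add: right_diff_distrib)
qed

text \<open>A point is recovered from norm and direction as \<open>norm x *\<^sub>R sgn x\<close>,
  and both are measurable for the sigma-algebra generated by cones. The inner radius -1 keeps the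
  origin, where \<open>sgn\<close> is 0.\<close>

lemma sigma_sets_cones:
  "sets borel = sigma_sets UNIV {cone A a b | (A :: 'a::euclidean_space set) a b. A \<in> sets borel}"
proof -
  define E :: "'a set set" where "E = {cone A a b | A a b. A \<in> sets borel}"
  define M where "M = sigma UNIV E"
  have M: "sets M = sigma_sets UNIV E" "space M = UNIV" by (auto simp: M_def)
  have cE: "cone A a b \<in> sets M" if "A \<in> sets borel" for A a b
    unfolding M(1) E_def by (rule sigma_sets.Basic) (use that in blast)
  have m1: "- 1 < norm x" for x :: 'a
    using norm_ge_zero[of x] by linarith
  have n: "norm \<in> borel_measurable M"
  proof (rule borel_measurableI_le)
    fix y :: real
    have "{x :: 'a. norm x \<le> y} = cone UNIV (-1) y" unfolding cone_def using m1 by blast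
    then show "{x \<in> space M. norm x \<le> y} \<in> sets M" using M(2) cE[of UNIV "-1" y] by simp
  qed
  have s: "sgn \<in> borel_measurable M"
  proof (rule measurableI)
    fix A :: "'a set" assume A: "A \<in> sets borel"
    have "sgn -` A = (\<Union>n::nat. cone A (-1) (real n))"
      unfolding cone_def using m1 real_arch_simple by blast
    then show "sgn -` A \<inter> space M \<in> sets M" using M(2) cE[OF A] by auto
  qed auto
  have "(\<lambda>x. norm x *\<^sub>R sgn x) \<in> borel_measurable M" by (intro borel_measurable_scaleR n s)
  moreover have "norm x *\<^sub>R sgn x = x" for x :: 'a by (cases "x = 0") (auto simp: sgn_div_norm)
  ultimately have id: "(\<lambda>x :: 'a. x) \<in> borel_measurable M" by simp
  have "sets borel \<subseteq> sets M"
  proof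
    fix A :: "'a set" assume "A \<in> sets borel"
    from measurable_sets[OF id this] show "A \<in> sets M" using M by simp
  qed
  moreover have "sets M \<subseteq> sets borel"
    unfolding M by (rule sets.sigma_sets_subset') (auto simp: E_def)
  ultimately show ?thesis using M(1) by (simp add: E_def)
qed

lemma Int_stable_cones: "Int_stable {cone A a b | (A :: 'a::euclidean_space set) a b. A \<in> sets borel}"
proof (rule Int_stableI)
  fix X Y :: "'a set"
  assume "X \<in> {cone A a b | A a b. A \<in> sets borel}" "Y \<in> {cone A a b | A a b. A \<in> sets borel}"
  then obtain A a b A' a' b' where "A \<in> sets borel" "A' \<in> sets borel" "X = cone A a b" "Y = cone A' a' b'" by blast
  moreover have "cone A a b \<inter> cone A' a' b' = cone (A \<inter> A') (max a a') (min b b')" by (auto simp: cone_def)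
  ultimately show "X \<inter> Y \<in> {cone A a b | A a b. A \<in> sets borel}" using sets.Int by blast
qed

section \<open>Radial maps and their derivatives\<close>

definition radq :: "(real \<Rightarrow> real) \<Rightarrow> (real \<Rightarrow> real) \<Rightarrow> real \<Rightarrow> real" where
  "radq S S' r = (if r = 0 then S' 0 else S r / r)"

definition radmap :: "(real \<Rightarrow> real) \<Rightarrow> (real \<Rightarrow> real) \<Rightarrow> 'a::euclidean_space \<Rightarrow> 'a" where
  "radmap S S' x = radq S S' (norm x) *\<^sub>R x"

text \<open>This is the determinant of the linear map \<open>radD S S' x\<close>: one factor per
  tangential direction and one for the radial direction.\<close>

definition radjac :: "(real \<Rightarrow> real) \<Rightarrow> (real \<Rightarrow> real) \<Rightarrow> 'a::euclidean_space \<Rightarrow> real" where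
  "radjac S S' x = radq S S' (norm x) ^ (DIM('a) - 1) * S' (norm x)"

text \<open>Tangential directions are stretched by S(r)/r and the radial one by S'(r). At the origin
  both factors equal S'(0) and the correction vanishes.\<close>

definition radD :: "(real \<Rightarrow> real) \<Rightarrow> (real \<Rightarrow> real) \<Rightarrow> 'a::euclidean_space \<Rightarrow> 'a \<Rightarrow> 'a" where
  "radD S S' x v = radq S S' (norm x) *\<^sub>R v + ((S' (norm x) - radq S S' (norm x)) * (v \<bullet> sgn x)) *\<^sub>R sgn x"

text \<open>A one-sided derivative at 0 that is positive and continuous is just what makes the
  induced map C^1 across the origin, and the conditions are inherited by the inverse.\<close>

locale radial_diffeo =
  fixes S S' :: "real \<Rightarrow> real"
  assumes bij: "bij_betw S {0..} {0..}" and mono: "strict_mono_on {0..} S"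
    and deriv: "\<And>r. 0 \<le> r \<Longrightarrow> (S has_real_derivative S' r) (at r within {0..})"
    and cont': "continuous_on {0..} S'" and pos': "\<And>r. 0 \<le> r \<Longrightarrow> 0 < S' r"
begin

lemma nonneg: "0 \<le> r \<Longrightarrow> 0 \<le> S r"
  using bij by (auto simp: bij_betw_def)

lemma less_iff: "0 \<le> r \<Longrightarrow> 0 \<le> r' \<Longrightarrow> S r < S r' \<longleftrightarrow> r < r'"
  using strict_mono_on_less[OF mono] by simp

lemma le_iff: "0 \<le> r \<Longrightarrow> 0 \<le> r' \<Longrightarrow> S r \<le> S r' \<longleftrightarrow> r \<le> r'"
  using less_iff[of r' r] by (auto simp: not_less[symmetric])

lemma zero: "S 0 = 0"
proof -
  obtain r where r: "0 \<le> r" "S r = 0" using bij by (metis atLeast_iff bij_betw_iff_bijections order_refl)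
  then have "S 0 \<le> 0" using le_iff[of 0 r] by simp
  with nonneg[of 0] show ?thesis by simp
qed

lemma pos: "0 < r \<Longrightarrow> 0 < S r"
  using less_iff[of 0 r] zero by simp

lemma deriv_at: "0 < r \<Longrightarrow> (S has_real_derivative S' r) (at r)"
  using deriv[of r] at_within_interior[of r "{0..}"] by simp

lemma cont: "continuous_on {0..} S"
  using deriv DERIV_continuous_on by (metis atLeast_iff)

lemma radq_pos: "0 \<le> r \<Longrightarrow> 0 < radq S S' r"
  using pos pos' by (auto simp: radq_def)

lemma radq_mult: "0 \<le> r \<Longrightarrow> radq S S' r * r = S r"
  using zero by (auto simp: radq_def)

lemma continuous_on_radq: "continuous_on {0..} (radq S S')"
  unfolding continuous_on_eq_continuous_within
proof
  fix r :: real assume "r \<in> {0..}"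
  then have r: "0 \<le> r" by simp
  show "continuous (at r within {0..}) (radq S S')"
  proof (cases "r = 0")
    case True
    have "((\<lambda>y. (S y - S 0) / (y - 0)) \<longlongrightarrow> S' 0) (at 0 within {0..})"
      using deriv[of 0] by (simp add: has_field_derivative_iff)
    then have "(radq S S' \<longlongrightarrow> S' 0) (at 0 within {0..})"
    proof (rule Lim_transform_eventually)
      show "\<forall>\<^sub>F y in at 0 within {0..}. (S y - S 0) / (y - 0) = radq S S' y"
        using zero by (auto simp: eventually_at_filter radq_def)
    qed
    then show ?thesis using True by (simp add: continuous_within radq_def)
  next
    case False
    have "continuous (at r within {0..}) (\<lambda>y. S y / y)"
      using cont r False by (intro continuous_intros) (auto simp: continuous_on_eq_continuous_within)
    then show ?thesis
    proof (rule continuous_transform_within[where \<delta> = r])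
      show "S y / y = radq S S' y" if "y \<in> {0..}" "dist y r < r" for y
        using that r by (auto simp: radq_def dist_real_def)
    qed (use r False in auto)
  qed
qed

lemma norm_radmap: "norm (radmap S S' x) = S (norm x)"
  using radq_pos[of "norm x"] radq_mult[of "norm x"] by (simp add: radmap_def)

lemma radmap_eq_0: "radmap S S' x = 0 \<longleftrightarrow> x = 0"
  using radq_pos[of "norm x"] by (simp add: radmap_def)

lemma sgn_radmap: "sgn (radmap S S' x) = sgn x"
  using radq_pos[of "norm x"] by (simp add: radmap_def sgn_scaleR)

lemma continuous_on_radq_norm: "continuous_on UNIV (\<lambda>x :: 'a::euclidean_space. radq S S' (norm x))"
  by (intro continuous_on_compose2[OF continuous_on_radq]) (auto intro: continuous_intros)

lemma continuous_on_deriv_norm: "continuous_on UNIV (\<lambda>x :: 'a::euclidean_space. S' (norm x))"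
  by (intro continuous_on_compose2[OF cont']) (auto intro: continuous_intros)

lemma continuous_on_radmap: "continuous_on UNIV (radmap S S' :: 'a::euclidean_space \<Rightarrow> 'a)"
  unfolding radmap_def[abs_def] by (intro continuous_intros continuous_on_radq_norm)

lemma continuous_on_radjac: "continuous_on UNIV (radjac S S' :: 'a::euclidean_space \<Rightarrow> real)"
  unfolding radjac_def[abs_def] by (intro continuous_intros continuous_on_radq_norm continuous_on_deriv_norm)

lemma radjac_pos: "0 < radjac S S' x"
  unfolding radjac_def using radq_pos pos' by simp

lemma radmap_has_derivative: "(radmap S S' has_derivative radD S S' x) (at x)"
proof (cases "x = 0")
  case True
  have "((\<lambda>y. norm (radmap S S' y - S' 0 *\<^sub>R y) / norm y) \<longlongrightarrow> 0) (at (0 :: 'a))"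
  proof -
    have "isCont (\<lambda>x :: 'a. radq S S' (norm x)) 0"
      using continuous_on_radq_norm[where 'a='a] by (simp add: continuous_on_eq_continuous_at)
    then have "((\<lambda>y :: 'a. radq S S' (norm y) - S' 0) \<longlongrightarrow> 0) (at 0)"
      by (auto simp: isCont_def radq_def intro!: tendsto_eq_intros)
    then have "((\<lambda>y :: 'a. \<bar>radq S S' (norm y) - S' 0\<bar>) \<longlongrightarrow> 0) (at 0)"
      by (rule tendsto_rabs_zero)
    then show ?thesis
    proof (rule Lim_transform_eventually)
      show "\<forall>\<^sub>F y :: 'a in at 0. \<bar>radq S S' (norm y) - S' 0\<bar> = norm (radmap S S' y - S' 0 *\<^sub>R y) / norm y"
        by (auto simp: eventually_at_filter radmap_def simp flip: scaleR_diff_left)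
    qed
  qed
  then have "(radmap S S' has_derivative (\<lambda>v. S' 0 *\<^sub>R v)) (at (0 :: 'a))"
    by (simp add: has_derivative_at radmap_def bounded_linear_scaleR_right)
  moreover have "radD S S' (0 :: 'a) = (\<lambda>v. S' 0 *\<^sub>R v)" by (simp add: radD_def radq_def fun_eq_iff)
  ultimately show ?thesis using True by simp
next
  case False
  define r where "r = norm x"
  have r: "0 < r" using False by (simp add: r_def)
  have "((\<lambda>y. S y) has_real_derivative S' r) (at r)"
    using r by (rule deriv_at)
  then have "((\<lambda>y. S y / y) has_real_derivative (S' r * r - S r) / (r * r)) (at r)"
    using r by (auto intro!: derivative_eq_intros)
  moreover have n: "(norm has_derivative (\<lambda>h. h \<bullet> sgn x)) (at x)"
    using False by (rule has_derivative_norm)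
  ultimately have "((\<lambda>y. S (norm y) / norm y) has_derivative (\<lambda>h. (h \<bullet> sgn x) * ((S' r * r - S r) / (r * r)))) (at x)"
    unfolding r_def by (rule DERIV_compose_FDERIV)
  then have "((\<lambda>y. (S (norm y) / norm y) *\<^sub>R y) has_derivative
      (\<lambda>h. (S (norm x) / norm x) *\<^sub>R h + ((h \<bullet> sgn x) * ((S' r * r - S r) / (r * r))) *\<^sub>R x)) (at x)"
    using has_derivative_ident by (rule has_derivative_scaleR)
  moreover have "(S (norm x) / norm x) *\<^sub>R h + ((h \<bullet> sgn x) * ((S' r * r - S r) / (r * r))) *\<^sub>R x = radD S S' x h" for h
  proof -
    have x: "x = r *\<^sub>R sgn x" using r by (simp add: r_def sgn_div_norm)
    have "((h \<bullet> sgn x) * ((S' r * r - S r) / (r * r))) *\<^sub>R x = ((h \<bullet> sgn x) * ((S' r * r - S r) / (r * r)) * r) *\<^sub>R sgn x"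
      by (subst (2) x) simp
    also have "(h \<bullet> sgn x) * ((S' r * r - S r) / (r * r)) * r = (S' r - S r / r) * (h \<bullet> sgn x)"
      using r by (simp add: field_simps)
    finally show ?thesis using r by (simp add: radD_def radq_def flip: r_def)
  qed
  ultimately have "((\<lambda>y. (S (norm y) / norm y) *\<^sub>R y) has_derivative radD S S' x) (at x)"
    by simp
  then show ?thesis
    by (rule has_derivative_transform_within_open[where s = "- {0}"]) (use False in \<open>auto simp: radmap_def radq_def\<close>)
qed

text \<open>\<open>sgn\<close> is discontinuous at the origin, but its coefficient, the difference
  of the radial and tangential factors, tends to 0 there.\<close>

lemma continuous_on_radD: "continuous_on UNIV (\<lambda>x :: 'a::euclidean_space. radD S S' x v)"
proof -
  have "continuous_on UNIV (\<lambda>x :: 'a. ((S' (norm x) - radq S S' (norm x)) * (v \<bullet> sgn x)) *\<^sub>R sgn x)"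
    unfolding continuous_on_eq_continuous_at[OF open_UNIV]
  proof
    fix x :: 'a
    have c': "isCont (\<lambda>x :: 'a. S' (norm x)) x" "isCont (\<lambda>x :: 'a. radq S S' (norm x)) x"
      using continuous_on_deriv_norm[where 'a='a] continuous_on_radq_norm[where 'a='a]
      by (auto simp: continuous_on_eq_continuous_at)
    then have c: "isCont (\<lambda>x :: 'a. S' (norm x) - radq S S' (norm x)) x"
      by (intro continuous_intros)
    show "isCont (\<lambda>x. ((S' (norm x) - radq S S' (norm x)) * (v \<bullet> sgn x)) *\<^sub>R sgn x) x"
    proof (cases "x = 0")
      case False
      then show ?thesis using c' by (intro continuous_intros isCont_sgn) auto
    next
      case True
      have "((\<lambda>x. ((S' (norm x) - radq S S' (norm x)) * (v \<bullet> sgn x)) *\<^sub>R sgn x) \<longlongrightarrow> 0) (at (0::'a))"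
      proof (rule Lim_null_comparison)
        show "\<forall>\<^sub>F x :: 'a in at 0. norm (((S' (norm x) - radq S S' (norm x)) * (v \<bullet> sgn x)) *\<^sub>R sgn x)
            \<le> \<bar>S' (norm x) - radq S S' (norm x)\<bar> * norm v"
        proof (rule always_eventually, rule allI)
          fix x :: 'a
          have "\<bar>v \<bullet> sgn x\<bar> \<le> norm v * norm (sgn x)" by (rule Cauchy_Schwarz_ineq2)
          also have "\<dots> \<le> norm v * 1" by (intro mult_left_mono) (auto simp: norm_sgn)
          finally have "\<bar>v \<bullet> sgn x\<bar> * norm (sgn x) \<le> norm v * 1"
            by (intro mult_mono) (auto simp: norm_sgn)
          then show "norm (((S' (norm x) - radq S S' (norm x)) * (v \<bullet> sgn x)) *\<^sub>R sgn x)
            \<le> \<bar>S' (norm x) - radq S S' (norm x)\<bar> * norm v"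
            by (simp add: abs_mult mult.assoc mult_left_mono)
        qed
        have "((\<lambda>x :: 'a. S' (norm x) - radq S S' (norm x)) \<longlongrightarrow> 0) (at 0)"
          using c True by (simp add: isCont_def radq_def)
        then show "((\<lambda>x :: 'a. \<bar>S' (norm x) - radq S S' (norm x)\<bar> * norm v) \<longlongrightarrow> 0) (at 0)"
          by (intro tendsto_mult_left_zero tendsto_rabs_zero)
      qed
      then show ?thesis using True by (simp add: isCont_def)
    qed
  qed
  from continuous_on_add[OF continuous_on_scaleR[OF continuous_on_radq_norm continuous_on_const] this]
  show ?thesis unfolding radD_def .
qed

end

section \<open>Polar integration over cones\<close>

lemma emeasure_cone_max:
  assumes [measurable]: "A \<in> sets borel"
  shows "emeasure lborel (cone A a b) = emeasure lborel (cone (A :: 'a::euclidean_space set) (max 0 a) b)"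
proof (rule emeasure_eq_AE)
  show "AE x in lborel. x \<in> cone A a b \<longleftrightarrow> x \<in> cone A (max 0 a) b"
    using AE_lborel_singleton[of "0 :: 'a"] by eventually_elim (auto simp: cone_def)
qed measurable

lemma nn_integral_power:
  fixes a b k :: real
  assumes "0 \<le> a" "a \<le> b" "0 \<le> k" "0 < n"
  shows "(\<integral>\<^sup>+s. ennreal (k * (real n * s ^ (n - 1))) * indicator {a<..b} s \<partial>lborel) = ennreal (k * (b ^ n - a ^ n))"
proof -
  have "((\<lambda>s. k * (real n * s ^ (n - 1))) has_integral k * b ^ n - k * a ^ n) {a..b}"
    using assms(2) by (intro fundamental_theorem_of_calculus)
      (auto intro!: derivative_eq_intros simp: has_real_derivative_iff_has_vector_derivative[symmetric])
  then have "(\<integral>\<^sup>+s. ennreal (k * (real n * s ^ (n - 1))) * indicator {a..b} s \<partial>lborel) = ennreal (k * b ^ n - k * a ^ n)"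
    using assms by (intro nn_integral_has_integral_lebesgue') auto
  moreover have "(\<integral>\<^sup>+s. ennreal (k * (real n * s ^ (n - 1))) * indicator {a<..b} s \<partial>lborel)
      = (\<integral>\<^sup>+s. ennreal (k * (real n * s ^ (n - 1))) * indicator {a..b} s \<partial>lborel)"
    using AE_lborel_singleton[of a] by (intro nn_integral_cong_AE, eventually_elim) (auto simp: indicator_def)
  ultimately show ?thesis by (simp add: right_diff_distrib)
qed

text \<open>The distribution of the norm on a cone is compared with the measure of density k N
  s^(N-1) on half-lines, where the volume formula for cones applies. Half-lines determine such a
  finite measure.\<close>

lemma nn_integral_cone:
  fixes A :: "'a::euclidean_space set"
  assumes A [measurable]: "A \<in> sets borel" and h [measurable]: "h \<in> borel_measurable borel" and a: "0 \<le> a"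
  shows "(\<integral>\<^sup>+x. h (norm x) * indicator (cone A a b) x \<partial>lborel) =
    (\<integral>\<^sup>+s. h s * (ennreal (measure lborel (cone A 0 1) * (real DIM('a) * s ^ (DIM('a) - 1))) * indicator {a<..b} s) \<partial>lborel)"
proof -
  define k where "k = measure lborel (cone A 0 1)"
  have k: "0 \<le> k" by (simp add: k_def)
  define M where "M = distr (density lborel (indicator (cone A a b))) borel (norm :: 'a \<Rightarrow> real)"
  define N where "N = density lborel (\<lambda>s. ennreal (k * (real DIM('a) * s ^ (DIM('a) - 1))) * indicator {a<..b} s)"
  have Mc: "emeasure M {c<..} = emeasure lborel (cone A (max a c) b)" for c
  proof -
    have "emeasure M {c<..} = (\<integral>\<^sup>+x. indicator (cone A a b) x * indicator {x :: 'a. c < norm x} x \<partial>lborel)"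
      unfolding M_def by (subst emeasure_distr) (auto simp: emeasure_density vimage_def)
    also have "\<dots> = (\<integral>\<^sup>+x. indicator (cone A (max a c) b) x \<partial>lborel)"
      by (intro nn_integral_cong) (auto simp: cone_def indicator_def)
    finally show ?thesis by simp
  qed
  have Nc: "emeasure N {c<..} = (\<integral>\<^sup>+s. ennreal (k * (real DIM('a) * s ^ (DIM('a) - 1))) * indicator {max a c<..b} s \<partial>lborel)" for c
    unfolding N_def by (subst emeasure_density) (auto intro!: nn_integral_cong simp: indicator_def)
  have eq: "emeasure M {c<..} = emeasure N {c<..}" for c
  proof (cases "max a c \<le> b")
    case True
    then show ?thesis
      unfolding Mc Nc using a k emeasure_cone[OF A, of "max a c" b]
      by (subst nn_integral_power) (auto simp: k_def)
  next
    case False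
    then have e: "cone A (max a c) b = {}" "{max a c<..b} = {}" by (auto simp: cone_def)
    show ?thesis unfolding Mc Nc e by simp
  qed
  have "M = N"
  proof (rule measure_eqI_lessThan)
    show "emeasure M {c<..} < \<infinity>" for c
      unfolding Mc
      by (rule le_less_trans[OF emeasure_mono emeasure_lborel_cball_finite[of 0 b]]) (auto simp: cone_def)
  qed (auto simp: M_def N_def eq[unfolded M_def N_def])
  have "(\<integral>\<^sup>+x. h (norm x) * indicator (cone A a b) x \<partial>lborel) = (\<integral>\<^sup>+s. h s \<partial>M)"
    unfolding M_def by (subst nn_integral_distr) (auto simp: nn_integral_density mult.commute)
  also have "\<dots> = (\<integral>\<^sup>+s. h s * (ennreal (k * (real DIM('a) * s ^ (DIM('a) - 1))) * indicator {a<..b} s) \<partial>lborel)"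
    unfolding \<open>M = N\<close> N_def by (subst nn_integral_density) (auto simp: mult.commute)
  finally show ?thesis by (simp add: k_def)
qed

section \<open>The inverse radial map and the Jacobian formula\<close>

context radial_diffeo
begin

definition R where "R = inv_into {0..} S"

definition R' where "R' s = inverse (S' (R s))"

lemma R_nonneg: "0 \<le> s \<Longrightarrow> 0 \<le> R s"
  unfolding R_def using bij by (metis atLeast_iff bij_betw_def inv_into_into)

lemma RS: "0 \<le> r \<Longrightarrow> R (S r) = r"
  unfolding R_def using bij by (simp add: bij_betw_def)

lemma SR: "0 \<le> s \<Longrightarrow> S (R s) = s"
  unfolding R_def using bij by (simp add: bij_betw_inv_into_right)

lemma R_less_iff: "0 \<le> s \<Longrightarrow> 0 \<le> s' \<Longrightarrow> R s < R s' \<longleftrightarrow> s < s'"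
  using less_iff[of "R s" "R s'"] R_nonneg SR by simp

text \<open>Extended by the identity to negative arguments, \<open>R\<close> becomes a monotone
  surjection of the line; a monotone function with open range is continuous.\<close>

lemma continuous_on_R: "continuous_on {0..} R"
proof -
  define T where "T s = (if s < 0 then s else R s)" for s
  have "surj T"
  proof (rule surjI)
    show "T (if s < 0 then s else S s) = s" for s
      using nonneg[of s] RS[of s] by (auto simp: T_def)
  qed
  then have "continuous_on UNIV T"
  proof (intro continuous_onI_mono)
    fix s s' :: real assume "s \<le> s'"
    then show "T s \<le> T s'"
      using R_less_iff[of s s'] R_nonneg[of s'] by (cases "s = s'") (auto simp: T_def)
  qed simp
  then have "continuous_on {0..} T" by (rule continuous_on_subset) simp
  then show ?thesis by (rule continuous_on_eq) (simp add: T_def)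
qed

text \<open>The difference quotient of \<open>R\<close> is the reciprocal of that of
  \<open>S\<close> composed with \<open>R\<close>. With this every fact about \<open>S\<close> is
  available for \<open>R\<close>.\<close>

lemma inverse: "radial_diffeo R R'"
proof
  show "bij_betw R {0..} {0..}" unfolding R_def by (rule bij_betw_inv_into[OF bij])
  show "strict_mono_on {0..} R" using R_less_iff by (auto intro!: strict_mono_onI)
  show "continuous_on {0..} R'"
    unfolding R'_def using pos' R_nonneg
    by (intro continuous_intros continuous_on_compose2[OF cont' continuous_on_R]) (auto simp: less_imp_neq[symmetric] dest: less_imp_neq)
  show "0 < R' s" if "0 \<le> s" for s using pos' R_nonneg that by (simp add: R'_def)
  fix s :: real assume s: "0 \<le> s"
  have "((\<lambda>r. (S r - S (R s)) / (r - R s)) \<longlongrightarrow> S' (R s)) (at (R s) within {0..})"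
    using deriv[OF R_nonneg[OF s]] by (simp add: has_field_derivative_iff)
  then have "((\<lambda>r. inverse ((S r - S (R s)) / (r - R s))) \<longlongrightarrow> R' s) (at (R s) within {0..})"
    unfolding R'_def using pos'[OF R_nonneg[OF s]] by (intro tendsto_inverse) auto
  moreover have "filterlim R (at (R s) within {0..}) (at s within {0..})"
    unfolding filterlim_at
  proof
    show "(R \<longlongrightarrow> R s) (at s within {0..})"
      using continuous_on_R s by (simp add: continuous_on_def)
    show "\<forall>\<^sub>F y in at s within {0..}. R y \<in> {0..} \<and> R y \<noteq> R s"
      unfolding eventually_at_filter using R_nonneg SR s by (intro always_eventually) (metis atLeast_iff)
  qed
  ultimately have "((\<lambda>y. inverse ((S (R y) - S (R s)) / (R y - R s))) \<longlongrightarrow> R' s) (at s within {0..})"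
    by (rule filterlim_compose)
  then show "(R has_real_derivative R' s) (at s within {0..})"
    unfolding has_field_derivative_iff
  proof (rule Lim_transform_eventually)
    show "\<forall>\<^sub>F y in at s within {0..}. inverse ((S (R y) - S (R s)) / (R y - R s)) = (R y - R s) / (y - s)"
      unfolding eventually_at_filter using SR s by (intro always_eventually) auto
  qed
qed

lemma radmap_R:
  fixes x :: "'b::euclidean_space"
  shows "radmap R R' (radmap S S' x) = x" "radmap S S' (radmap R R' x) = x"
proof -
  interpret inv: radial_diffeo R R' by (rule inverse)
  have e: "y = z" if "norm y = norm z" "sgn y = sgn z" for y z :: 'b
    using that by (cases "z = 0") (auto simp: sgn_div_norm)
  show "radmap R R' (radmap S S' x) = x"
    by (rule e) (auto simp: inv.norm_radmap inv.sgn_radmap norm_radmap sgn_radmap RS)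
  show "radmap S S' (radmap R R' x) = x"
    by (rule e) (auto simp: inv.norm_radmap inv.sgn_radmap norm_radmap sgn_radmap SR)
qed

text \<open>The map preserves directions, so preimages of cones are cones with radii R a and R b. On
  these the mass is a one-dimensional integral of the derivative of k S(s)^N, and the fundamental
  theorem of calculus returns the volume of the image cone. Cones are an intersection-stable
  generator.\<close>

theorem jacobian_radmap: "jacobian (radmap S S' :: 'a::euclidean_space \<Rightarrow> 'a) (radjac S S')"
proof
  show \<Psi> [measurable]: "(radmap S S' :: 'a \<Rightarrow> 'a) \<in> borel_measurable borel"
    by (rule borel_measurable_continuous_onI[OF continuous_on_radmap])
  show J [measurable]: "(radjac S S' :: 'a \<Rightarrow> real) \<in> borel_measurable borel"
    by (rule borel_measurable_continuous_onI[OF continuous_on_radjac])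
  show "0 < radjac S S' z" for z :: 'a by (rule radjac_pos)
  define M where "M = distr (density lborel (\<lambda>z. ennreal (radjac S S' z))) borel (radmap S S' :: 'a \<Rightarrow> 'a)"
  have M: "emeasure M X = (\<integral>\<^sup>+x. ennreal (radjac S S' x) * indicator X (radmap S S' x) \<partial>lborel)"
    if [measurable]: "X \<in> sets borel" for X
    unfolding M_def
    by (subst nn_integral_indicator[symmetric], simp, subst nn_integral_distr, simp, simp, subst nn_integral_density) auto
  have core: "emeasure M (cone A a b) = emeasure lborel (cone A a b)"
    if A [measurable]: "A \<in> sets borel" and ab: "0 \<le> a" "a \<le> b" for A :: "'a set" and a b
  proof -
    define n where "n = DIM('a)"
    have n: "0 < n" by (simp add: n_def)
    define k where "k = measure lborel (cone A 0 1)"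
    have k: "0 \<le> k" by (simp add: k_def)
    define j where "j s = indicator {0..} s * (radq S S' s ^ (n - 1) * S' s)" for s
    have [measurable]: "j \<in> borel_measurable borel"
    proof -
      have "(\<lambda>s. indicator {0..} s *\<^sub>R (radq S S' s ^ (n - 1) * S' s)) \<in> borel_measurable borel"
        by (intro borel_measurable_continuous_on_indicator continuous_intros continuous_on_radq cont') auto
      then show ?thesis by (simp add: j_def[abs_def])
    qed
    have ra: "0 \<le> R a" "R a \<le> R b" using ab R_nonneg R_less_iff[of b a] by (auto simp: not_less[symmetric])
    have "radmap S S' x \<in> cone A a b \<longleftrightarrow> x \<in> cone A (R a) (R b)" for x :: 'a
      using less_iff[of "R a" "norm x"] le_iff[of "norm x" "R b"] ab R_nonneg SR
      by (auto simp: cone_def norm_radmap sgn_radmap)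
    then have "emeasure M (cone A a b) = (\<integral>\<^sup>+x. ennreal (j (norm x)) * indicator (cone A (R a) (R b)) x \<partial>lborel)"
      by (subst M) (auto simp: radjac_def j_def n_def indicator_def intro!: nn_integral_cong)
    also have "\<dots> = (\<integral>\<^sup>+s. ennreal (j s) * (ennreal (k * (real n * s ^ (n - 1))) * indicator {R a<..R b} s) \<partial>lborel)"
      unfolding k_def n_def by (rule nn_integral_cone) (use ra in auto)
    also have "\<dots> = (\<integral>\<^sup>+s. ennreal (k * (real n * S s ^ (n - 1) * S' s)) * indicator {R a..R b} s \<partial>lborel)"
    proof (rule nn_integral_cong_AE)
      show "AE s in lborel. ennreal (j s) * (ennreal (k * (real n * s ^ (n - 1))) * indicator {R a<..R b} s)
          = ennreal (k * (real n * S s ^ (n - 1) * S' s)) * indicator {R a..R b} s"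
        using AE_lborel_singleton[of "R a"]
      proof eventually_elim
        case (elim s)
        show ?case
        proof (cases "s \<in> {R a<..R b}")
          case True
          then have s: "0 \<le> s" using ra by auto
          have "j s * (k * (real n * s ^ (n - 1))) = k * (real n * (radq S S' s * s) ^ (n - 1) * S' s)"
            using s by (simp add: j_def power_mult_distrib)
          then have "j s * (k * (real n * s ^ (n - 1))) = k * (real n * S s ^ (n - 1) * S' s)"
            unfolding radq_mult[OF s] .
          moreover have "0 \<le> j s" using s radq_pos[OF s] pos'[OF s] by (simp add: j_def)
          ultimately have "ennreal (j s) * ennreal (k * (real n * s ^ (n - 1))) = ennreal (k * (real n * S s ^ (n - 1) * S' s))"
            by (metis ennreal_mult')
          moreover have "s \<in> {R a..R b}" using True by auto
          ultimately show ?thesis using True by (simp only: indicator_simps mult_1_right)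
        next
          case False
          then have "s \<notin> {R a..R b}" using elim by auto
          with False show ?thesis by simp
        qed
      qed
    qed
    also have "\<dots> = ennreal (k * S (R b) ^ n - k * S (R a) ^ n)"
    proof (rule nn_integral_has_integral_lebesgue')
      show "0 \<le> k * (real n * S s ^ (n - 1) * S' s)" if "s \<in> {R a..R b}" for s
        using that ra k nonneg[of s] pos'[of s] by simp
      show "((\<lambda>s. k * (real n * S s ^ (n - 1) * S' s)) has_integral k * S (R b) ^ n - k * S (R a) ^ n) {R a..R b}"
      proof (rule fundamental_theorem_of_calculus[OF ra(2)])
        fix s assume s: "s \<in> {R a..R b}"
        then have "(S has_real_derivative S' s) (at s within {R a..R b})"
          using ra by (intro DERIV_subset[OF deriv]) auto
        then show "((\<lambda>s. k * S s ^ n) has_vector_derivative k * (real n * S s ^ (n - 1) * S' s)) (at s within {R a..R b})"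
          unfolding has_real_derivative_iff_has_vector_derivative[symmetric]
          by (auto intro!: derivative_eq_intros)
      qed
    qed
    also have "\<dots> = emeasure lborel (cone A a b)"
      using ab SR by (simp add: emeasure_cone k_def n_def right_diff_distrib)
    finally show ?thesis .
  qed
  have max: "emeasure M (cone A a b) = emeasure M (cone A (max 0 a) b)"
    if [measurable]: "A \<in> sets borel" for A :: "'a set" and a b
  proof -
    have "(\<integral>\<^sup>+x. ennreal (radjac S S' (x :: 'a)) * indicator (cone A a b) (radmap S S' x) \<partial>lborel)
        = (\<integral>\<^sup>+x. ennreal (radjac S S' x) * indicator (cone A (max 0 a) b) (radmap S S' x) \<partial>lborel)"
    proof (rule nn_integral_cong_AE)
      show "AE x :: 'a in lborel. ennreal (radjac S S' x) * indicator (cone A a b) (radmap S S' x)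
          = ennreal (radjac S S' x) * indicator (cone A (max 0 a) b) (radmap S S' x)"
        using AE_lborel_singleton[of "0 :: 'a"]
        by eventually_elim (use pos in \<open>auto simp: cone_def indicator_def norm_radmap radmap_eq_0\<close>)
    qed
    then show ?thesis by (simp add: M)
  qed
  have eq: "emeasure M (cone A a b) = emeasure lborel (cone A a b)" if A: "A \<in> sets borel" for A :: "'a set" and a b
  proof (cases "max 0 a \<le> b")
    case True
    then show ?thesis using core[OF A, of "max 0 a" b] max[OF A] emeasure_cone_max[OF A] by simp
  next
    case False
    then have "x \<notin> cone A (max 0 a) b" for x
      using order_trans[OF norm_ge_zero, of x b] by (auto simp: cone_def)
    then have "cone A (max 0 a) b = {}" by blast
    then show ?thesis using max[OF A, of a b] emeasure_cone_max[OF A, of a b] by simp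
  qed
  have "M = lborel"
  proof (rule measure_eqI_generator_eq[OF Int_stable_cones, where \<Omega> = UNIV and A = "\<lambda>i. cone UNIV (-1) (real i)"])
    show "emeasure M X = emeasure lborel X" if "X \<in> {cone A a b | (A :: 'a set) a b. A \<in> sets borel}" for X
      using that eq by blast
    show "sets M = sigma_sets UNIV {cone A a b | (A :: 'a set) a b. A \<in> sets borel}"
      unfolding sigma_sets_cones[symmetric] by (simp add: M_def)
    show "sets lborel = sigma_sets UNIV {cone A a b | (A :: 'a set) a b. A \<in> sets borel}"
      unfolding sigma_sets_cones[symmetric] by simp
    show "range (\<lambda>i. cone UNIV (-1) (real i)) \<subseteq> {cone A a b | (A :: 'a set) a b. A \<in> sets borel}"
    proof (rule image_subsetI)
      show "cone UNIV (-1) (real i) \<in> {cone A a b | (A :: 'a set) a b. A \<in> sets borel}" for i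
        by (rule CollectI, rule exI[of _ UNIV], rule exI[of _ "-1"], rule exI[of _ "real i"]) simp
    qed
    have "x \<in> (\<Union>i. cone UNIV (-1) (real i))" for x :: 'a
    proof -
      have "- 1 < norm x" using norm_ge_zero[of x] by linarith
      then show ?thesis using real_arch_simple[of "norm x"] by (auto simp: cone_def)
    qed
    then show "(\<Union>i. cone UNIV (-1) (real i)) = (UNIV :: 'a set)" by blast
    show "emeasure M (cone UNIV (-1) (real i)) \<noteq> \<infinity>" for i
      using eq[of UNIV "-1" "real i"] emeasure_cone_max[of "UNIV :: 'a set" "-1" "real i"] by (simp add: emeasure_cone)
  qed simp
  then show "distr (density lborel (\<lambda>z. ennreal (radjac S S' z))) borel (radmap S S' :: 'a \<Rightarrow> 'a) = lborel"
    by (simp add: M_def)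
qed

end

section \<open>Weak gradients of radial functions\<close>

lemma L1loc_scale_bounded:
  fixes h :: "(real ^ 'n) \<times> real \<Rightarrow> real"
  assumes f: "L1loc f" and h: "h \<in> borel_measurable lebesgue"
    and B: "\<And>r a b. 0 < a \<Longrightarrow> \<exists>B. \<forall>z\<in>cyl r a b. \<bar>h z\<bar> \<le> B"
  shows "L1loc (\<lambda>z. h z *\<^sub>R f z)"
  unfolding L1loc_def set_integrable_def
proof (intro allI impI)
  fix r a b :: real assume a: "0 < a"
  have i: "integrable lebesgue (\<lambda>z. indicator (cyl r a b) z *\<^sub>R f z)"
    using f a by (auto simp: L1loc_def set_integrable_def)
  obtain B where B: "\<And>z. z \<in> cyl r a b \<Longrightarrow> \<bar>h z\<bar> \<le> B" using B[OF a] by blast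
  have "integrable lebesgue (\<lambda>z. h z *\<^sub>R (indicator (cyl r a b) z *\<^sub>R f z))"
  proof (rule Bochner_Integration.integrable_bound)
    show "integrable lebesgue (\<lambda>z. B * norm (indicator (cyl r a b) z *\<^sub>R f z))"
      by (intro integrable_mult_right integrable_norm i)
    show "(\<lambda>z. h z *\<^sub>R (indicator (cyl r a b) z *\<^sub>R f z)) \<in> borel_measurable lebesgue"
      by (intro borel_measurable_scaleR h borel_measurable_integrable[OF i])
    show "AE z in lebesgue. norm (h z *\<^sub>R (indicator (cyl r a b) z *\<^sub>R f z))
        \<le> norm (B * norm (indicator (cyl r a b) z *\<^sub>R f z))"
    proof (rule AE_I2)
      fix z
      show "norm (h z *\<^sub>R (indicator (cyl r a b) z *\<^sub>R f z)) \<le> norm (B * norm (indicator (cyl r a b) z *\<^sub>R f z))"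
      proof (cases "z \<in> cyl r a b")
        case True
        then have "\<bar>h z\<bar> * norm (f z) \<le> \<bar>B\<bar> * norm (f z)"
          using B by (intro mult_right_mono) fastforce+
        with True show ?thesis by (simp add: abs_mult)
      qed simp
    qed
  qed
  moreover have "(\<lambda>z. h z *\<^sub>R (indicator (cyl r a b) z *\<^sub>R f z)) = (\<lambda>z. indicator (cyl r a b) z *\<^sub>R (h z *\<^sub>R f z))"
    by (simp add: mult.commute)
  ultimately show "integrable lebesgue (\<lambda>z. indicator (cyl r a b) z *\<^sub>R (h z *\<^sub>R f z))" by simp
qed

lemma L1loc_scale_continuous:
  fixes h :: "(real ^ 'n) \<times> real \<Rightarrow> real"
  assumes f: "L1loc f" and h: "continuous_on UNIV h"
  shows "L1loc (\<lambda>z. h z *\<^sub>R f z)"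
proof (rule L1loc_scale_bounded[OF f])
  show "h \<in> borel_measurable lebesgue"
    using borel_measurable_continuous_onI[OF h] by (simp add: measurable_completion)
  fix r a b
  have "bounded (h ` cyl r a b)"
    by (intro compact_imp_bounded compact_continuous_image compact_cyl continuous_on_subset[OF h]) simp
  then show "\<exists>B. \<forall>z\<in>cyl r a b. \<bar>h z\<bar> \<le> B" unfolding bounded_iff by auto
qed

lemma C0c_add: "C0c \<phi> \<Longrightarrow> C0c \<psi> \<Longrightarrow> C0c (\<lambda>z. \<phi> z + \<psi> z)"
  unfolding C0c_def
proof (elim conjE exE, intro conjI)
  fix r a b r' a' b'
  assume c: "continuous_on UNIV \<phi>" "continuous_on UNIV \<psi>" and a: "0 < a" "0 < a'"
    and s: "\<forall>z. z \<notin> cyl r a b \<longrightarrow> \<phi> z = 0" "\<forall>z. z \<notin> cyl r' a' b' \<longrightarrow> \<psi> z = 0"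
  show "continuous_on UNIV (\<lambda>z. \<phi> z + \<psi> z)" using c by (intro continuous_intros)
  have "cyl r a b \<subseteq> cyl (max r r') (min a a') (max b b')" "cyl r' a' b' \<subseteq> cyl (max r r') (min a a') (max b b')"
    by (auto simp: cyl_def)
  then have "\<forall>z. z \<notin> cyl (max r r') (min a a') (max b b') \<longrightarrow> \<phi> z + \<psi> z = 0"
    using s by (metis add.right_neutral subsetD)
  moreover have "0 < min a a'" using a by simp
  ultimately show "\<exists>r a b. 0 < a \<and> (\<forall>z. z \<notin> cyl r a b \<longrightarrow> \<phi> z + \<psi> z = 0)" by blast
qed

lemma C0c_zero: "C0c (\<lambda>_. 0)"
  unfolding C0c_def by (auto intro!: exI[of _ "1::real"])

lemma C0c_sum: "finite A \<Longrightarrow> (\<And>i. i \<in> A \<Longrightarrow> C0c (f i)) \<Longrightarrow> C0c (\<lambda>z. \<Sum>i\<in>A. f i z)"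
  by (induction A rule: finite_induct) (auto intro: C0c_zero C0c_add)

lemma C1c_mult:
  assumes \<phi>: "C1c \<phi> \<phi>'" and h: "\<And>z. (h has_derivative h' z) (at z)" "\<And>v. continuous_on UNIV (\<lambda>z. h' z v)"
  shows "C1c (\<lambda>z. h z * \<phi> z) (\<lambda>z v. h z * \<phi>' z v + h' z v * \<phi> z)"
proof -
  have hc: "continuous_on UNIV h"
    using h(1) by (meson continuous_at_imp_continuous_on has_derivative_continuous)
  note d = C1cD[OF \<phi>]
  have pc: "continuous_on UNIV \<phi>" using d(1) by (simp add: C0c_def)
  have "continuous_on UNIV (\<lambda>z. h z * \<phi>' z v + h' z v * \<phi> z)" for v
    by (intro continuous_intros hc d(3) h(2) pc)
  then show ?thesis
    unfolding C1c_def using C0c_mult[OF d(1) hc] has_derivative_mult[OF h(1) d(2)] by blast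
qed

section \<open>Test functions vanishing near the axis\<close>

definition off_axis :: "((real ^ 'n) \<times> real \<Rightarrow> real) \<Rightarrow> bool" where
  "off_axis \<phi> \<longleftrightarrow> (\<exists>e>0. \<forall>z. norm (fst z) < e \<longrightarrow> \<phi> z = 0)"

lemma off_axis_derivative:
  assumes "C1c \<phi> \<phi>'" "0 < e" "\<And>z. norm (fst z) < e \<Longrightarrow> \<phi> z = 0" "norm (fst z) < e"
  shows "\<phi>' z v = 0"
proof -
  have o: "open {z :: (real ^ 'n) \<times> real. norm (fst z) < e}"
    by (intro open_Collect_less continuous_intros)
  have "((\<lambda>_. 0) has_derivative \<phi>' z) (at z)"
    using has_derivative_transform_within_open[OF C1cD(2)[OF assms(1)] o, of z "\<lambda>_. 0"] assms(3,4) by auto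
  then have "\<phi>' z = (\<lambda>_. 0)" using has_derivative_unique has_derivative_const by blast
  then show ?thesis by simp
qed

text \<open>Space-time is covered by two open sets: off the axis, where \<open>h\<close> is regular,
  and near the axis, where the test function vanishes and the values of \<open>h\<close> do not
  matter.\<close>

lemma C1c_mult_off_axis:
  fixes \<phi> :: "(real ^ 'n) \<times> real \<Rightarrow> real"
  assumes \<phi>: "C1c \<phi> \<phi>'" "off_axis \<phi>"
    and h: "\<And>z. fst z \<noteq> 0 \<Longrightarrow> (h has_derivative h' z) (at z)" "\<And>v. continuous_on {z. fst z \<noteq> 0} (\<lambda>z. h' z v)"
  shows "C1c (\<lambda>z. h z * \<phi> z) (\<lambda>z v. h z * \<phi>' z v + h' z v * \<phi> z)" "off_axis (\<lambda>z. h z * \<phi> z)"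
proof -
  obtain e where e: "0 < e" "\<And>z. norm (fst z) < e \<Longrightarrow> \<phi> z = 0" using \<phi>(2) by (auto simp: off_axis_def)
  note d = C1cD[OF \<phi>(1)]
  note e' = off_axis_derivative[OF \<phi>(1) e]
  show "off_axis (\<lambda>z. h z * \<phi> z)" using e by (auto simp: off_axis_def)
  define A where "A = {z :: (real ^ 'n) \<times> real. fst z \<noteq> 0}"
  define B where "B = {z :: (real ^ 'n) \<times> real. norm (fst z) < e}"
  have o: "open A" "open B" "A \<union> B = UNIV"
    using e(1) unfolding A_def B_def by (auto intro!: open_Collect_neq open_Collect_less continuous_intros)
  have c: "continuous_on UNIV F" if "continuous_on A F" "\<And>z. z \<in> B \<Longrightarrow> F z = 0" for F :: "(real ^ 'n) \<times> real \<Rightarrow> real"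
  proof -
    have "continuous_on B F" using that(2) by (simp cong: continuous_on_cong)
    then show ?thesis using continuous_on_open_Un[OF o(1,2) that(1)] o(3) by simp
  qed
  have hc: "continuous_on A h"
    using h(1) has_derivative_continuous unfolding A_def by (intro continuous_at_imp_continuous_on) blast
  have pc: "continuous_on A \<phi>" "continuous_on A (\<lambda>z. \<phi>' z v)" for v
  proof -
    have "continuous_on UNIV \<phi>" using d(1) by (simp add: C0c_def)
    then show "continuous_on A \<phi>" by (rule continuous_on_subset) simp
    show "continuous_on A (\<lambda>z. \<phi>' z v)" by (rule continuous_on_subset[OF d(3)]) simp
  qed
  have 1: "continuous_on UNIV (\<lambda>z. h z * \<phi> z)"
    by (rule c) (auto intro!: continuous_intros hc pc simp: B_def e)
  have 2: "continuous_on UNIV (\<lambda>z. h z * \<phi>' z v + h' z v * \<phi> z)" for v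
    by (rule c) (auto intro!: continuous_intros hc pc h(2)[folded A_def] simp: B_def e e')
  have 3: "((\<lambda>z. h z * \<phi> z) has_derivative (\<lambda>v. h z * \<phi>' z v + h' z v * \<phi> z)) (at z)" for z
  proof (cases "z \<in> B")
    case True
    have "((\<lambda>z. h z * \<phi> z) has_derivative (\<lambda>_. 0)) (at z)"
      by (rule has_derivative_transform_within_open[OF has_derivative_const o(2) True]) (simp add: B_def e)
    then show ?thesis using True e e' by (simp add: B_def)
  next
    case False
    then have "z \<in> A" using o(3) by blast
    then show ?thesis using has_derivative_mult[OF h(1) d(2)] by (simp add: A_def)
  qed
  have "C0c (\<lambda>z. h z * \<phi> z)"
    using 1 d(1) unfolding C0c_def by (metis mult_zero_right)
  then show "C1c (\<lambda>z. h z * \<phi> z) (\<lambda>z v. h z * \<phi>' z v + h' z v * \<phi> z)"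
    unfolding C1c_def using 2 3 by blast
qed

section \<open>Rotations in a coordinate plane\<close>

definition rotgen :: "'n \<Rightarrow> 'n \<Rightarrow> real ^ 'n \<Rightarrow> real ^ 'n" where
  "rotgen i j x = x $ i *\<^sub>R axis j 1 - x $ j *\<^sub>R axis i 1"

text \<open>Rotation by the angle \<open>s\<close> in the plane of coordinates i and j, as the
  identity plus a correction in that plane. Its velocity at s = 0 is
  \<open>rotgen i j\<close>.\<close>

definition rot :: "'n \<Rightarrow> 'n \<Rightarrow> real \<Rightarrow> real ^ 'n \<Rightarrow> real ^ 'n" where
  "rot i j s x = x + ((cos s - 1) * x $ i - sin s * x $ j) *\<^sub>R axis i 1 + ((cos s - 1) * x $ j + sin s * x $ i) *\<^sub>R axis j 1"

lemma inner_axis1: "x \<bullet> axis i 1 = x $ i" "axis i 1 \<bullet> x = x $ i" for x :: "real ^ 'n"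
  by (simp_all add: inner_axis inner_commute[of "axis i 1"])

lemma norm_rot:
  assumes "i \<noteq> j" shows "norm (rot i j s x) = norm x"
proof -
  define p where "p = (cos s - 1) * x $ i - sin s * x $ j"
  define q where "q = (cos s - 1) * x $ j + sin s * x $ i"
  have e: "axis i (1::real) $ i = 1" "axis i (1::real) $ j = 0" "axis j (1::real) $ i = 0" "axis j (1::real) $ j = 1"
    using assms by (simp_all add: axis_def)
  have "rot i j s x \<bullet> rot i j s x = x \<bullet> x + 2 * p * x $ i + 2 * q * x $ j + p * p + q * q"
    using assms unfolding rot_def p_def[symmetric] q_def[symmetric]
    by (simp add: inner_add_left inner_add_right inner_axis1 e algebra_simps)
  also have "\<dots> = x \<bullet> x + ((x $ i + p)\<^sup>2 + (x $ j + q)\<^sup>2) - ((x $ i)\<^sup>2 + (x $ j)\<^sup>2)"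
    by (simp add: power2_eq_square algebra_simps)
  also have "(x $ i + p)\<^sup>2 + (x $ j + q)\<^sup>2 = (x $ i)\<^sup>2 + (x $ j)\<^sup>2"
  proof -
    have "(a + ((C - 1) * a - D * b))\<^sup>2 + (b + ((C - 1) * b + D * a))\<^sup>2 = (D\<^sup>2 + C\<^sup>2) * (a\<^sup>2 + b\<^sup>2)" for a b C D :: real
      by (simp add: power2_eq_square algebra_simps)
    then show ?thesis unfolding p_def q_def by simp
  qed
  finally show ?thesis by (simp add: norm_eq_sqrt_inner)
qed

lemma linear_rot: "linear (rot i j s)"
  by (rule linearI) (simp_all add: rot_def algebra_simps scaleR_add_left scaleR_diff_left)

lemma jacobian_rot: "i \<noteq> j \<Longrightarrow> jacobian (\<lambda>z :: (real ^ 'n) \<times> real. (rot i j s (fst z), snd z)) (\<lambda>_. 1)"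
proof -
  assume ij: "i \<noteq> j"
  have "jacobian (rot i j s :: real ^ 'n \<Rightarrow> _) (\<lambda>_. 1)"
  proof
    show "rot i j s \<in> borel_measurable borel"
      using linear_rot by (intro borel_measurable_continuous_onI linear_continuous_on) (simp add: linear_conv_bounded_linear)
    show "distr (density lborel (\<lambda>_. ennreal 1)) borel (rot i j s) = lborel"
      using lborel_orthogonal[OF linear_rot norm_rot[OF ij]] by (simp add: density_1)
  qed auto
  from jacobian_Times[OF this] show ?thesis .
qed

lemma rot_has_derivative:
  "((\<lambda>s. rot i j s x) has_vector_derivative
    ((- sin s * x $ i - cos s * x $ j) *\<^sub>R axis i 1 + (cos s * x $ i - sin s * x $ j) *\<^sub>R axis j 1)) (at s)"
  unfolding rot_def has_vector_derivative_def
  by (auto intro!: derivative_eq_intros simp: algebra_simps scaleR_add_left)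

definition radial :: "((real ^ 'n) \<times> real \<Rightarrow> 'b) \<Rightarrow> bool" where
  "radial w \<longleftrightarrow> (\<forall>x y t. norm x = norm y \<longrightarrow> w (x, t) = w (y, t))"

text \<open>For radial \<open>w\<close> the integral of \<psi>(Q_s z) w(z) does not depend on the
  angle s, since rotations preserve both \<open>w\<close> and the measure. Its derivative at s = 0
  is the claim; only the test function is differentiated.\<close>

lemma radial_rotgen:
  fixes w :: "(real ^ 'n) \<times> real \<Rightarrow> real"
  assumes w: "L1loc w" "radial w" and \<psi>: "C1c \<psi> \<psi>'" and ij: "i \<noteq> j"
  shows "(LINT z|lebesgue. \<psi>' z (rotgen i j (fst z), 0) * w z) = 0"
proof -
  define Q :: "real \<Rightarrow> (real ^ 'n) \<times> real \<Rightarrow> (real ^ 'n) \<times> real" where "Q s z = (rot i j s (fst z), snd z)" for s z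
  define D where "D s z = - sin s * fst z $ i - cos s * fst z $ j" for s and z :: "(real ^ 'n) \<times> real"
  define E where "E s z = cos s * fst z $ i - sin s * fst z $ j" for s and z :: "(real ^ 'n) \<times> real"
  note d = C1cD[OF \<psi>]
  have Q0: "Q 0 z = z" for z by (simp add: Q_def rot_def)
  have der: "((\<lambda>s. \<psi> (Q s z)) has_real_derivative \<psi>' (Q s z) (axis i 1, 0) * D s z + \<psi>' (Q s z) (axis j 1, 0) * E s z) (at s)" for s z
  proof -
    have "((\<lambda>s. Q s z) has_vector_derivative (D s z *\<^sub>R axis i 1 + E s z *\<^sub>R axis j 1, 0)) (at s)"
      unfolding Q_def D_def E_def
      using has_vector_derivative_Pair[OF rot_has_derivative has_vector_derivative_const] .
    then have "((\<lambda>s. Q s z) has_derivative (\<lambda>h. h *\<^sub>R (D s z *\<^sub>R axis i 1 + E s z *\<^sub>R axis j 1, 0))) (at s)"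
      by (simp add: has_vector_derivative_def)
    from has_derivative_compose[OF this d(2)]
    have "((\<lambda>s. \<psi> (Q s z)) has_derivative (\<lambda>h. \<psi>' (Q s z) (h *\<^sub>R (D s z *\<^sub>R axis i 1 + E s z *\<^sub>R axis j 1, 0)))) (at s)" .
    moreover have "(h *\<^sub>R (D s z *\<^sub>R axis i 1 + E s z *\<^sub>R axis j 1, 0)) = (h * D s z) *\<^sub>R (axis i 1, 0) + (h * E s z) *\<^sub>R (axis j (1::real), 0::real)" for h
      by (simp add: algebra_simps)
    then have "\<psi>' (Q s z) (h *\<^sub>R (D s z *\<^sub>R axis i 1 + E s z *\<^sub>R axis j 1, 0)) =
        (\<psi>' (Q s z) (axis i 1, 0) * D s z + \<psi>' (Q s z) (axis j 1, 0) * E s z) * h" for h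
      by (simp only: linear_add[OF d(5)] linear_cmul[OF d(5)] real_scaleR_def) (simp add: algebra_simps)
    ultimately show ?thesis
      by (simp only: has_field_derivative_def)
  qed
  obtain r a b where a: "0 < a" and s: "\<And>z. z \<notin> cyl r a b \<Longrightarrow> \<psi> z = 0"
    using d(1) by (auto simp: C0c_def)
  have Qcyl: "Q s z \<in> cyl r a b \<longleftrightarrow> z \<in> cyl r a b" for s z
    by (cases z) (simp add: Q_def cyl_def norm_rot[OF ij])
  obtain B1 where B1: "\<And>z. \<bar>\<psi>' z (axis i 1, 0)\<bar> \<le> B1" using C0c_bounded[OF d(4)] by metis
  obtain B2 where B2: "\<And>z. \<bar>\<psi>' z (axis j 1, 0)\<bar> \<le> B2" using C0c_bounded[OF d(4)] by metis
  have DE: "\<bar>D s z\<bar> \<le> 2 * norm (fst z)" "\<bar>E s z\<bar> \<le> 2 * norm (fst z)" for s z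
  proof -
    have b: "\<bar>sin s * fst z $ k\<bar> \<le> norm (fst z)" "\<bar>cos s * fst z $ k\<bar> \<le> norm (fst z)" for k
      using mult_mono[OF abs_sin_le_one[of s] component_le_norm_cart[of "fst z" k]]
        mult_mono[OF abs_cos_le_one[of s] component_le_norm_cart[of "fst z" k]] by (simp_all add: abs_mult)
    show "\<bar>D s z\<bar> \<le> 2 * norm (fst z)" "\<bar>E s z\<bar> \<le> 2 * norm (fst z)"
      using b(1)[of i] b(1)[of j] b(2)[of i] b(2)[of j] unfolding D_def E_def by linarith+
  qed
  \<comment> \<open>Difference quotients along the rotation. Their integrals against
    \<open>w\<close> all vanish, and the mean value theorem supplies the uniform bound for dominated
    convergence.\<close>
  define F where "F n z = (\<psi> (Q (inverse (real (Suc n))) z) - \<psi> z) / inverse (real (Suc n))" for n z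
  have "(\<lambda>n. LINT z|lebesgue. F n z * w z) \<longlonglongrightarrow> (LINT z|lebesgue. \<psi>' z (rotgen i j (fst z), 0) * w z)"
  proof (rule tendsto_integral_C0c[OF w(1) a])
    show "F n z = 0" if "z \<notin> cyl r a b" for n z
      using that s Qcyl by (simp add: F_def)
    show "\<bar>F n z\<bar> \<le> (B1 + B2) * (2 * \<bar>r\<bar>)" for n z
    proof (cases "z \<in> cyl r a b")
      case False
      then have "F n z = 0" using s Qcyl by (simp add: F_def)
      moreover have "0 \<le> B1" "0 \<le> B2" using B1[of z] B2[of z] by linarith+
      ultimately show ?thesis by simp
    next
      case True
      then have nz: "norm (fst z) \<le> \<bar>r\<bar>" by (auto simp: cyl_def)
      define h where "h = inverse (real (Suc n))"
      have h: "0 < h" by (simp add: h_def)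
      obtain c where c: "\<psi> (Q h z) - \<psi> (Q 0 z) = (h - 0) * (\<psi>' (Q c z) (axis i 1, 0) * D c z + \<psi>' (Q c z) (axis j 1, 0) * E c z)"
        using MVT2[OF h, of "\<lambda>s. \<psi> (Q s z)" "\<lambda>s. \<psi>' (Q s z) (axis i 1, 0) * D s z + \<psi>' (Q s z) (axis j 1, 0) * E s z"] der by blast
      have "F n z = \<psi>' (Q c z) (axis i 1, 0) * D c z + \<psi>' (Q c z) (axis j 1, 0) * E c z"
        using c h unfolding F_def h_def[symmetric] Q0 by simp
      moreover have "\<bar>\<psi>' (Q c z) (axis i 1, 0) * D c z\<bar> \<le> B1 * (2 * \<bar>r\<bar>)"
        unfolding abs_mult using B1[of "Q c z"] DE(1)[of c z] nz by (intro mult_mono) auto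
      moreover have "\<bar>\<psi>' (Q c z) (axis j 1, 0) * E c z\<bar> \<le> B2 * (2 * \<bar>r\<bar>)"
        unfolding abs_mult using B2[of "Q c z"] DE(2)[of c z] nz by (intro mult_mono) auto
      ultimately show ?thesis unfolding distrib_right by linarith
    qed
    show "continuous_on UNIV (F n)" for n
    proof -
      have pc: "continuous_on UNIV \<psi>" using d(1) by (simp add: C0c_def)
      have "continuous_on UNIV (Q s)" for s
        unfolding Q_def rot_def by (intro continuous_intros)
      then have "continuous_on UNIV (\<lambda>z. \<psi> (Q s z))" for s
        by (intro continuous_on_compose2[OF pc]) auto
      then show ?thesis unfolding F_def by (intro continuous_intros pc) auto
    qed
    show "(\<lambda>n. F n z) \<longlonglongrightarrow> \<psi>' z (rotgen i j (fst z), 0)" for z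
    proof -
      have "((\<lambda>h. (\<psi> (Q (0 + h) z) - \<psi> (Q 0 z)) / h) \<longlongrightarrow> \<psi>' z (axis i 1, 0) * D 0 z + \<psi>' z (axis j 1, 0) * E 0 z) (at 0)"
        using der[of z 0] unfolding DERIV_def Q0 .
      moreover have "\<psi>' z (axis i 1, 0) * D 0 z + \<psi>' z (axis j 1, 0) * E 0 z = \<psi>' z (rotgen i j (fst z), 0)"
      proof -
        have "(rotgen i j (fst z), 0) = D 0 z *\<^sub>R (axis i 1, 0) + E 0 z *\<^sub>R (axis j (1::real), 0::real)"
          by (simp add: rotgen_def D_def E_def)
        then show ?thesis
          by (simp only: linear_add[OF d(5)] linear_cmul[OF d(5)] real_scaleR_def mult.commute[of "\<psi>' z v" for v])
      qed
      moreover have "filterlim (\<lambda>n. inverse (real (Suc n))) (at 0) sequentially"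
        unfolding filterlim_at using LIMSEQ_inverse_real_of_nat by auto
      ultimately show ?thesis
        unfolding F_def using filterlim_compose by (fastforce simp: Q0)
    qed
  qed
  moreover have "(LINT z|lebesgue. F n z * w z) = 0" for n
  proof -
    define h where "h = inverse (real (Suc n))"
    interpret jacobian "Q h" "\<lambda>_. 1" unfolding Q_def by (rule jacobian_rot[OF ij])
    have i0: "integrable lebesgue (\<lambda>z. \<psi> z * w z)"
      using integrable_C0c[OF w(1) d(1)] by simp
    have m: "(\<lambda>z. \<psi> z * w z) \<in> borel_measurable lebesgue" by (rule borel_measurable_integrable[OF i0])
    have wQ: "w (Q h z) = w z" for z
    proof -
      have "w (rot i j h (fst z), snd z) = w (fst z, snd z)"
        using w(2) norm_rot[OF ij, of h "fst z"] unfolding radial_def by blast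
      then show ?thesis by (simp add: Q_def)
    qed
    have 1: "(LINT z|lebesgue. \<psi> (Q h z) * w z) = (LINT z|lebesgue. \<psi> z * w z)"
      using integral_comp[OF m] by (simp add: wQ)
    have 2: "integrable lebesgue (\<lambda>z. \<psi> (Q h z) * w z)"
      using integrable_comp_iff[OF m] i0 by (simp add: wQ)
    have "(LINT z|lebesgue. F n z * w z) = (LINT z|lebesgue. (\<psi> (Q h z) * w z - \<psi> z * w z) / h)"
      unfolding F_def h_def[symmetric] by (simp add: left_diff_distrib)
    also have "\<dots> = ((LINT z|lebesgue. \<psi> (Q h z) * w z) - (LINT z|lebesgue. \<psi> z * w z)) / h"
      using i0 2 by simp
    finally show ?thesis using 1 by simp
  qed
  ultimately show ?thesis by (simp add: LIMSEQ_const_iff)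
qed

section \<open>Radial weak gradients: parallelism and the Euler identity\<close>

lemma L1loc_nth: "L1loc G \<Longrightarrow> L1loc (\<lambda>z. G z $ i)"
  by (rule L1loc_bounded_linear) (auto intro: bounded_linear_vec_nth)

lemma integrable_C0c_real:
  fixes w :: "(real ^ 'n) \<times> real \<Rightarrow> real"
  shows "L1loc w \<Longrightarrow> C0c \<phi> \<Longrightarrow> integrable lebesgue (\<lambda>z. \<phi> z * w z)"
  using integrable_C0c[of w \<phi>] by simp

lemma C1c_space_expand:
  fixes \<phi> :: "(real ^ 'n) \<times> real \<Rightarrow> real"
  assumes "C1c \<phi> \<phi>'" shows "\<phi>' z (v, 0) = (\<Sum>i\<in>UNIV. v $ i * \<phi>' z (axis i 1, 0))"
proof -
  have "(v, 0) = (\<Sum>i\<in>UNIV. v $ i *\<^sub>R (axis i (1::real), 0::real))"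
  proof -
    have "v = (\<Sum>i\<in>UNIV. v $ i *\<^sub>R axis i 1)"
      using basis_expansion[of v] by (simp add: scalar_mult_eq_scaleR)
    then show ?thesis by (simp add: prod_eq_iff fst_sum snd_sum)
  qed
  then have "\<phi>' z (v, 0) = \<phi>' z (\<Sum>i\<in>UNIV. v $ i *\<^sub>R (axis i (1::real), 0::real))" by (rule arg_cong)
  also have "\<dots> = (\<Sum>i\<in>UNIV. v $ i * \<phi>' z (axis i 1, 0))"
    by (simp only: linear_sum[OF C1cD(5)[OF assms]] linear_cmul[OF C1cD(5)[OF assms]] real_scaleR_def)
  finally show ?thesis .
qed

lemma C1c_coord:
  fixes \<phi> :: "(real ^ 'n) \<times> real \<Rightarrow> real"
  assumes "C1c \<phi> \<phi>'"
  shows "C1c (\<lambda>z. fst z $ i * \<phi> z) (\<lambda>z v. fst z $ i * \<phi>' z v + fst v $ i * \<phi> z)"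
proof (rule C1c_mult[OF assms])
  have "bounded_linear (\<lambda>v :: (real ^ 'n) \<times> real. fst v $ i)"
    by (rule bounded_linear_compose[OF bounded_linear_vec_nth bounded_linear_fst])
  then show "((\<lambda>z. fst z $ i) has_derivative (\<lambda>v. fst v $ i)) (at z)" for z :: "(real ^ 'n) \<times> real"
    by (rule bounded_linear_imp_has_derivative)
qed (intro continuous_intros)

lemma C0c_coord: "C0c \<phi> \<Longrightarrow> C0c (\<lambda>z. fst z $ i * \<phi> z)"
  by (rule C0c_mult, assumption, intro continuous_intros)

lemma C0c_cmult: "C0c \<phi> \<Longrightarrow> C0c (\<lambda>z. c * \<phi> z)"
  by (rule C0c_mult) (auto intro: continuous_intros)

lemma C0c_euler:
  assumes "C1c \<psi> \<psi>'" shows "C0c (\<lambda>z. k * \<psi> z + \<psi>' z (fst z, 0))"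
proof -
  have "\<psi>' z (fst z, 0) = (\<Sum>i\<in>UNIV. fst z $ i * \<psi>' z (axis i 1, 0))" for z
    by (rule C1c_space_expand[OF assms])
  then show ?thesis
    by (simp only:) (rule C0c_add[OF C0c_cmult[OF C1cD(1)[OF assms]] C0c_sum[OF finite C0c_coord[OF C1cD(4)[OF assms]]]])
qed

lemma C0c_rotgen:
  fixes \<psi> :: "(real ^ 'n) \<times> real \<Rightarrow> real"
  assumes "C1c \<psi> \<psi>'" shows "C0c (\<lambda>z. \<psi>' z (rotgen i j (fst z), 0))"
proof -
  have "\<psi>' z (rotgen i j (fst z), 0) = fst z $ i * \<psi>' z (axis j 1, 0) + (- 1) * (fst z $ j * \<psi>' z (axis i 1, 0))" for z
  proof -
    have "(rotgen i j (fst z), 0) = fst z $ i *\<^sub>R (axis j (1::real), 0::real) + (- (fst z $ j)) *\<^sub>R (axis i 1, 0)"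
      by (simp add: rotgen_def)
    then show ?thesis
      by (simp only: linear_add[OF C1cD(5)[OF assms]] linear_cmul[OF C1cD(5)[OF assms]] real_scaleR_def mult_minus_left mult_1)
  qed
  moreover note C0c_add[OF C0c_coord[OF C1cD(4)[OF assms], of i "(axis j 1, 0)"]
      C0c_cmult[OF C0c_coord[OF C1cD(4)[OF assms], of j "(axis i 1, 0)"], of "- 1"]]
  ultimately show ?thesis by simp
qed

locale radial_weak_gradient =
  fixes w :: "(real ^ 'n) \<times> real \<Rightarrow> real" and G :: "(real ^ 'n) \<times> real \<Rightarrow> real ^ 'n"
  assumes wl: "L1loc w" and Gl: "L1loc G" and rad: "radial w"
    and weak: "\<And>\<phi> \<phi>' i. C1c \<phi> \<phi>' \<Longrightarrow>
      (LINT z|lebesgue. \<phi> z * G z $ i) + (LINT z|lebesgue. \<phi>' z (axis i 1, 0) * w z) = 0"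
begin

text \<open>Test the j-th identity with x_i \<eta> and the i-th with x_j \<eta>. In the difference
  only the rotation generator applied to \<eta> remains on the side of \<open>w\<close>, and radial
  functions annihilate it.\<close>

lemma parallel: "AE z in lebesgue. z \<in> S_inf \<longrightarrow> (\<forall>i j. fst z $ i * G z $ j = fst z $ j * G z $ i)"
proof -
  have "AE z in lebesgue. z \<in> S_inf \<longrightarrow> fst z $ i * G z $ j = fst z $ j * G z $ i" for i j
  proof (cases "i = j")
    case False
    define c where "c z = fst z $ i * G z $ j + (- fst z $ j) * G z $ i" for z
    have cl: "L1loc c"
    proof -
      have "L1loc (\<lambda>z. fst z $ i *\<^sub>R (G z $ j))" "L1loc (\<lambda>z. (- fst z $ j) *\<^sub>R (G z $ i))"
        by (rule L1loc_scale_continuous[OF L1loc_nth[OF Gl]], intro continuous_intros)+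
      from L1loc_add[OF this] show ?thesis by (simp only: c_def[abs_def] real_scaleR_def)
    qed
    have "AE z in lebesgue. z \<in> S_inf \<longrightarrow> c z = 0"
    proof (rule AE_zero_if_test_integrals_zero[OF cl])
      fix \<eta> :: "(real ^ 'n) \<times> real \<Rightarrow> real"
      assume "test_fun \<eta>"
      then obtain \<eta>' where \<eta>: "C1c \<eta> \<eta>'" using test_fun_C1c by blast
      have ax: "axis j (1::real) $ i = 0" "axis i (1::real) $ j = 0" using False by (auto simp: axis_def)
      note d = C1cD[OF \<eta>]
      note iG = integrable_C0c_real[OF L1loc_nth[OF Gl] C0c_coord[OF d(1)]]
      note iw = integrable_C0c_real[OF wl C0c_coord[OF d(4)]]
      have 1: "(LINT z|lebesgue. fst z $ i * \<eta> z * G z $ j) + (LINT z|lebesgue. fst z $ i * \<eta>' z (axis j 1, 0) * w z) = 0"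
        using weak[OF C1c_coord[OF \<eta>], of i j] by (simp add: ax)
      have 2: "(LINT z|lebesgue. fst z $ j * \<eta> z * G z $ i) + (LINT z|lebesgue. fst z $ j * \<eta>' z (axis i 1, 0) * w z) = 0"
        using weak[OF C1c_coord[OF \<eta>], of j i] by (simp add: ax)
      have "(LINT z|lebesgue. fst z $ i * \<eta>' z (axis j 1, 0) * w z) - (LINT z|lebesgue. fst z $ j * \<eta>' z (axis i 1, 0) * w z)
          = (LINT z|lebesgue. fst z $ i * \<eta>' z (axis j 1, 0) * w z - fst z $ j * \<eta>' z (axis i 1, 0) * w z)"
        by (rule Bochner_Integration.integral_diff[symmetric]) (rule iw)+
      also have "\<dots> = (LINT z|lebesgue. \<eta>' z (rotgen i j (fst z), 0) * w z)"
      proof (rule Bochner_Integration.integral_cong[OF refl])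
        fix z :: "(real ^ 'n) \<times> real"
        have "(rotgen i j (fst z), 0) = fst z $ i *\<^sub>R (axis j (1::real), 0::real) - (fst z $ j) *\<^sub>R (axis i 1, 0)"
          by (simp add: rotgen_def)
        then have "\<eta>' z (rotgen i j (fst z), 0) = fst z $ i * \<eta>' z (axis j 1, 0) - fst z $ j * \<eta>' z (axis i 1, 0)"
          by (simp only: linear_diff[OF d(5)] linear_cmul[OF d(5)] real_scaleR_def)
        then show "fst z $ i * \<eta>' z (axis j 1, 0) * w z - fst z $ j * \<eta>' z (axis i 1, 0) * w z = \<eta>' z (rotgen i j (fst z), 0) * w z"
          by (simp add: left_diff_distrib)
      qed
      also have "\<dots> = 0" by (rule radial_rotgen[OF wl rad \<eta> False])
      finally have 3: "(LINT z|lebesgue. fst z $ i * \<eta> z * G z $ j) - (LINT z|lebesgue. fst z $ j * \<eta> z * G z $ i) = 0"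
        using 1 2 by linarith
      have "(LINT z|lebesgue. \<eta> z * c z) = (LINT z|lebesgue. fst z $ i * \<eta> z * G z $ j - fst z $ j * \<eta> z * G z $ i)"
        by (intro Bochner_Integration.integral_cong refl) (simp add: c_def algebra_simps)
      also have "\<dots> = (LINT z|lebesgue. fst z $ i * \<eta> z * G z $ j) - (LINT z|lebesgue. fst z $ j * \<eta> z * G z $ i)"
        by (rule Bochner_Integration.integral_diff) (rule iG)+
      finally show "(LINT z|lebesgue. \<eta> z * c z) = 0" using 3 by simp
    qed
    then show ?thesis by eventually_elim (simp add: c_def)
  qed simp
  then have "AE z in lebesgue. \<forall>i j. z \<in> S_inf \<longrightarrow> fst z $ i * G z $ j = fst z $ j * G z $ i"
    unfolding AE_all_countable by blast
  then show ?thesis by eventually_elim blast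
qed

text \<open>The i-th identity is tested with x_i \<psi> and summed over i; the term N \<psi> comes
  from the divergence of the field x.\<close>

lemma euler:
  assumes \<psi>: "C1c \<psi> \<psi>'"
  shows "(LINT z|lebesgue. \<psi> z * (fst z \<bullet> G z)) + (LINT z|lebesgue. (real CARD('n) * \<psi> z + \<psi>' z (fst z, 0)) * w z) = 0"
proof -
  note d = C1cD[OF \<psi>]
  have 1: "(LINT z|lebesgue. fst z $ i * \<psi> z * G z $ i) + (LINT z|lebesgue. (fst z $ i * \<psi>' z (axis i 1, 0) + \<psi> z) * w z) = 0" for i
    using weak[OF C1c_coord[OF \<psi>], of i i] by simp
  have "(LINT z|lebesgue. \<psi> z * (fst z \<bullet> G z)) = (LINT z|lebesgue. (\<Sum>i\<in>UNIV. fst z $ i * \<psi> z * G z $ i))"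
    by (intro Bochner_Integration.integral_cong refl) (simp add: inner_vec_def sum_distrib_left mult_ac)
  also have "\<dots> = (\<Sum>i\<in>UNIV. LINT z|lebesgue. fst z $ i * \<psi> z * G z $ i)"
    by (rule Bochner_Integration.integral_sum) (rule integrable_C0c_real[OF L1loc_nth[OF Gl] C0c_coord[OF d(1)]])
  finally have 2: "(LINT z|lebesgue. \<psi> z * (fst z \<bullet> G z)) = (\<Sum>i\<in>UNIV. LINT z|lebesgue. fst z $ i * \<psi> z * G z $ i)" .
  have ex: "\<psi>' z (fst z, 0) = (\<Sum>i\<in>UNIV. fst z $ i * \<psi>' z (axis i 1, 0))" for z
    by (rule C1c_space_expand[OF \<psi>])
  have "(LINT z|lebesgue. (real CARD('n) * \<psi> z + \<psi>' z (fst z, 0)) * w z) = (LINT z|lebesgue. (\<Sum>i\<in>UNIV. (fst z $ i * \<psi>' z (axis i 1, 0) + \<psi> z) * w z))"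
    by (intro Bochner_Integration.integral_cong refl)
       (simp add: ex sum_distrib_right[symmetric] sum.distrib add.commute)
  also have "\<dots> = (\<Sum>i\<in>UNIV. LINT z|lebesgue. (fst z $ i * \<psi>' z (axis i 1, 0) + \<psi> z) * w z)"
    by (rule Bochner_Integration.integral_sum, rule integrable_C0c_real[OF wl], rule C0c_add[OF C0c_coord[OF d(4)] d(1)])
  finally show ?thesis unfolding 2 by (simp add: sum.distrib[symmetric] 1)
qed

end

text \<open>Converse of the two preceding facts. Off the axis e_i is x_i/|x|^2 times x plus the sum
  over j of x_j/|x|^2 times \<open>rotgen j i x\<close>. The Euler part is covered by
  \<open>eul\<close>, the tangential parts vanish against radial \<open>w\<close>, and parallelism
  recovers G_i from its pairing with x.\<close>

lemma weak_gradient_off_axis: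
  fixes w :: "(real ^ 'n) \<times> real \<Rightarrow> real" and G :: "(real ^ 'n) \<times> real \<Rightarrow> real ^ 'n"
  assumes wl: "L1loc w" and Gl: "L1loc G" and rad: "radial w"
    and par: "AE z in lebesgue. z \<in> S_inf \<longrightarrow> (\<forall>i j. fst z $ i * G z $ j = fst z $ j * G z $ i)"
    and eul: "\<And>\<kappa> \<kappa>'. C1c \<kappa> \<kappa>' \<Longrightarrow> off_axis \<kappa> \<Longrightarrow>
      (LINT z|lebesgue. \<kappa> z * (fst z \<bullet> G z)) + (LINT z|lebesgue. (real CARD('n) * \<kappa> z + \<kappa>' z (fst z, 0)) * w z) = 0"
    and \<phi>: "C1c \<phi> \<phi>'" and off: "off_axis \<phi>"
  shows "(LINT z|lebesgue. \<phi> z * G z $ i) + (LINT z|lebesgue. \<phi>' z (axis i 1, 0) * w z) = 0"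
proof -
  define h where "h j z = fst z $ j / (fst z \<bullet> fst z)" for j and z :: "(real ^ 'n) \<times> real"
  define h' where "h' j z v = fst v $ j / (fst z \<bullet> fst z) - fst z $ j * (2 * (fst z \<bullet> fst v)) / (fst z \<bullet> fst z)\<^sup>2"
    for j and z v :: "(real ^ 'n) \<times> real"
  have hd: "(h j has_derivative h' j z) (at z)" if "fst z \<noteq> 0" for j z
  proof -
    have 1: "((\<lambda>z :: (real ^ 'n) \<times> real. fst z $ j) has_derivative (\<lambda>v. fst v $ j)) (at z)"
      by (rule bounded_linear_imp_has_derivative, rule bounded_linear_compose[OF bounded_linear_vec_nth bounded_linear_fst])
    have 2: "((\<lambda>z :: (real ^ 'n) \<times> real. fst z \<bullet> fst z) has_derivative (\<lambda>v. 2 * (fst z \<bullet> fst v))) (at z)"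
      by (auto intro!: derivative_eq_intros simp: inner_commute)
    have nz: "fst z \<bullet> fst z \<noteq> 0" using that by simp
    show ?thesis unfolding h_def[abs_def] h'_def[abs_def]
      by (rule has_derivative_eq_rhs[OF has_derivative_divide[OF 1 2 nz]])
         (use nz in \<open>simp add: fun_eq_iff field_simps power2_eq_square\<close>)
  qed
  have hc: "continuous_on {z. fst z \<noteq> 0} (\<lambda>z. h' j z v)" for j v
    unfolding h'_def by (intro continuous_intros) auto
  note m = C1c_mult_off_axis[OF \<phi> off hd hc]
  define \<psi>' where "\<psi>' j z v = h j z * \<phi>' z v + h' j z v * \<phi> z" for j z v
  have \<psi>: "C1c (\<lambda>z. h j z * \<phi> z) (\<psi>' j)" for j
    using m(1)[of j] by (simp add: \<psi>'_def[abs_def])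
  have \<psi>off: "off_axis (\<lambda>z. h j z * \<phi> z)" for j by (rule m(2))
  obtain e where e: "0 < e" "\<And>z. norm (fst z) < e \<Longrightarrow> \<phi> z = 0" using off by (auto simp: off_axis_def)
  note d = C1cD[OF \<phi>]
  have E: "(LINT z|lebesgue. h i z * \<phi> z * (fst z \<bullet> G z)) +
      (LINT z|lebesgue. (real CARD('n) * (h i z * \<phi> z) + \<psi>' i z (fst z, 0)) * w z) = 0"
    using eul[OF \<psi> \<psi>off, of i] by simp
  have T: "(LINT z|lebesgue. \<psi>' j z (rotgen j i (fst z), 0) * w z) = 0" if "j \<noteq> i" for j
    by (rule radial_rotgen[OF wl rad \<psi> that])
  have iT: "integrable lebesgue (\<lambda>z. \<psi>' j z (rotgen j i (fst z), 0) * w z)" for j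
    by (rule integrable_C0c_real[OF wl C0c_rotgen[OF \<psi>]])
  have iE: "integrable lebesgue (\<lambda>z. (real CARD('n) * (h i z * \<phi> z) + \<psi>' i z (fst z, 0)) * w z)"
    by (rule integrable_C0c_real[OF wl C0c_euler[OF \<psi>]])
  \<comment> \<open>The zero-order terms cancel: the Euler field applied to h_i, homogeneous of
    degree -1, contributes - h_i \<phi>, and each of the N - 1 tangential derivatives contributes
    the same, against N h_i \<phi>.\<close>
  have pt: "real CARD('n) * (h i z * \<phi> z) + \<psi>' i z (fst z, 0) + (\<Sum>j\<in>UNIV - {i}. \<psi>' j z (rotgen j i (fst z), 0))
      = \<phi>' z (axis i 1, 0)" for z
  proof (cases "fst z = 0")
    case True
    then have "norm (fst z) < e" using e by simp
    then show ?thesis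
      using off_axis_derivative[OF \<phi> e] e(2) by (simp add: \<psi>'_def)
  next
    case False
    define x where "x = fst z"
    define P where "P k = \<phi>' z (axis k 1, 0)" for k
    define q where "q = x \<bullet> x"
    have q: "q \<noteq> 0" using False by (simp add: q_def x_def)
    have lin: "\<phi>' z (v, 0) = (\<Sum>k\<in>UNIV. v $ k * P k)" for v
      unfolding P_def by (rule C1c_space_expand[OF \<phi>])
    have rot: "\<phi>' z (rotgen j i x, 0) = x $ j * P i - x $ i * P j" for j
    proof -
      have "(rotgen j i x, 0) = x $ j *\<^sub>R (axis i (1::real), 0::real) - (x $ i) *\<^sub>R (axis j 1, 0)"
        by (simp add: rotgen_def)
      then show ?thesis unfolding P_def
        by (simp only: linear_diff[OF d(5)] linear_cmul[OF d(5)] real_scaleR_def)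
    qed
    have xr: "x \<bullet> rotgen j i x = 0" for j
      by (simp add: rotgen_def inner_diff_right inner_axis1)
    have "\<psi>' j z (rotgen j i x, 0) = ((x $ j)\<^sup>2 * P i - x $ i * (x $ j * P j) - x $ i * \<phi> z) / q" if "j \<noteq> i" for j
    proof -
      have "rotgen j i x $ j = - x $ i" using that by (simp add: rotgen_def axis_def)
      then show ?thesis
        by (simp add: \<psi>'_def h_def h'_def xr rot flip: x_def q_def) (simp add: add_divide_distrib diff_divide_distrib power2_eq_square algebra_simps)
    qed
    then have "(\<Sum>j\<in>UNIV - {i}. \<psi>' j z (rotgen j i x, 0)) = (\<Sum>j\<in>UNIV - {i}. ((x $ j)\<^sup>2 * P i - x $ i * (x $ j * P j) - x $ i * \<phi> z) / q)"
      by (intro sum.cong) auto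
    also have "\<dots> = (\<Sum>j\<in>UNIV. ((x $ j)\<^sup>2 * P i - x $ i * (x $ j * P j) - x $ i * \<phi> z) / q) + x $ i * \<phi> z / q"
      by (subst (2) sum.remove[of _ i]) (auto simp: power2_eq_square)
    also have "(\<Sum>j\<in>UNIV. ((x $ j)\<^sup>2 * P i - x $ i * (x $ j * P j) - x $ i * \<phi> z) / q)
        = ((\<Sum>j\<in>UNIV. (x $ j)\<^sup>2) * P i - x $ i * (\<Sum>j\<in>UNIV. x $ j * P j) - real CARD('n) * (x $ i * \<phi> z)) / q"
      by (simp add: sum_divide_distrib[symmetric] sum_subtractf sum_distrib_left sum_distrib_right)
    also have "(\<Sum>j\<in>UNIV. (x $ j)\<^sup>2) = q" by (simp add: q_def inner_vec_def power2_eq_square)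
    finally have 1: "(\<Sum>j\<in>UNIV - {i}. \<psi>' j z (rotgen j i x, 0)) =
        (q * P i - x $ i * (\<Sum>j\<in>UNIV. x $ j * P j) - real CARD('n) * (x $ i * \<phi> z)) / q + x $ i * \<phi> z / q" .
    have 2: "\<psi>' i z (x, 0) = x $ i * (\<Sum>k\<in>UNIV. x $ k * P k) / q - x $ i * \<phi> z / q"
      using q unfolding \<psi>'_def h_def h'_def lin[of x] fst_conv x_def[symmetric] q_def[symmetric]
      by (simp add: field_simps power2_eq_square)
    have 3: "real CARD('n) * (h i z * \<phi> z) = real CARD('n) * (x $ i * \<phi> z) / q"
      by (simp add: h_def x_def q_def)
    show ?thesis
      unfolding x_def[symmetric] 1 2 3 P_def[symmetric] using q by (simp add: add_divide_distrib diff_divide_distrib)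
  qed
  have "(LINT z|lebesgue. \<phi>' z (axis i 1, 0) * w z) =
      (LINT z|lebesgue. (real CARD('n) * (h i z * \<phi> z) + \<psi>' i z (fst z, 0)) * w z + (\<Sum>j\<in>UNIV - {i}. \<psi>' j z (rotgen j i (fst z), 0) * w z))"
    by (intro Bochner_Integration.integral_cong refl) (simp add: pt[symmetric] distrib_right sum_distrib_right)
  also have "\<dots> = (LINT z|lebesgue. (real CARD('n) * (h i z * \<phi> z) + \<psi>' i z (fst z, 0)) * w z)
      + (\<Sum>j\<in>UNIV - {i}. LINT z|lebesgue. \<psi>' j z (rotgen j i (fst z), 0) * w z)"
    by (subst Bochner_Integration.integral_add) (auto intro!: iT iE Bochner_Integration.integral_sum)
  also have "(\<Sum>j\<in>UNIV - {i}. LINT z|lebesgue. \<psi>' j z (rotgen j i (fst z), 0) * w z) = 0"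
    by (intro sum.neutral) (auto intro: T)
  finally have W: "(LINT z|lebesgue. \<phi>' z (axis i 1, 0) * w z) = (LINT z|lebesgue. (real CARD('n) * (h i z * \<phi> z) + \<psi>' i z (fst z, 0)) * w z)"
    by simp
  obtain r a b where "0 < a" and s: "\<And>z. z \<notin> cyl r a b \<Longrightarrow> \<phi> z = 0" using d(1) by (auto simp: C0c_def)
  then have sS: "\<phi> z = 0" if "z \<notin> S_inf" for z using that cyl_subset_S_inf[of a r b] by blast
  \<comment> \<open>Here parallelism enters: x_i (x . G) = |x|^2 G_i almost everywhere in
    \<open>S_inf\<close>.\<close>
  have "(LINT z|lebesgue. h i z * \<phi> z * (fst z \<bullet> G z)) = (LINT z|lebesgue. \<phi> z * G z $ i)"
  proof (rule integral_cong_AE)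
    have "(\<lambda>z. \<Sum>j\<in>UNIV. fst z $ j * (h i z * \<phi> z) * G z $ j) \<in> borel_measurable lebesgue"
      by (rule borel_measurable_sum, rule borel_measurable_integrable,
          rule integrable_C0c_real[OF L1loc_nth[OF Gl] C0c_coord[OF C1cD(1)[OF \<psi>]]])
    then show "(\<lambda>z. h i z * \<phi> z * (fst z \<bullet> G z)) \<in> borel_measurable lebesgue"
      by (simp add: inner_vec_def sum_distrib_left mult_ac)
    show "(\<lambda>z. \<phi> z * G z $ i) \<in> borel_measurable lebesgue"
      by (rule borel_measurable_integrable[OF integrable_C0c_real[OF L1loc_nth[OF Gl] d(1)]])
    show "AE z in lebesgue. h i z * \<phi> z * (fst z \<bullet> G z) = \<phi> z * G z $ i"
      using par
    proof eventually_elim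
      case (elim z)
      show ?case
      proof (cases "z \<in> S_inf \<and> fst z \<noteq> 0")
        case True
        have "fst z $ i * (fst z \<bullet> G z) = (\<Sum>k\<in>UNIV. fst z $ k * (fst z $ i * G z $ k))"
          by (simp add: inner_vec_def sum_distrib_left mult_ac)
        also have "\<dots> = (\<Sum>k\<in>UNIV. fst z $ k * (fst z $ k * G z $ i))" using elim True by simp
        also have "\<dots> = (fst z \<bullet> fst z) * G z $ i"
          by (simp add: inner_vec_def sum_distrib_left mult_ac)
        finally show ?thesis using True by (simp add: h_def field_simps)
      next
        case False
        then have "\<phi> z = 0" using sS[of z] e(1) e(2)[of z] by (cases "z \<in> S_inf") simp_all
        then show ?thesis by simp
      qed
    qed
  qed
  with E W show ?thesis by simp
qed

section \<open>Removal of the axis by a cutoff\<close>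

lemma continuous_on_flat: "continuous_on UNIV (flat n)"
  by (intro continuous_at_imp_continuous_on ballI DERIV_isCont[OF flat_has_derivative])

text \<open>The usual quotient of flat functions. Its denominator is positive because s - 1 and 2 -
  s are never both nonpositive.\<close>

lemma cutoff:
  obtains \<theta> \<theta>' :: "real \<Rightarrow> real" and C where
    "\<And>s. (\<theta> has_real_derivative \<theta>' s) (at s)" "continuous_on UNIV \<theta>'"
    "\<And>s. s \<le> 1 \<Longrightarrow> \<theta> s = 0" "\<And>s. 2 \<le> s \<Longrightarrow> \<theta> s = 1" "\<And>s. \<bar>\<theta> s\<bar> \<le> 1"
    "\<And>s. \<bar>\<theta>' s\<bar> \<le> C" "\<And>s. 2 < s \<Longrightarrow> \<theta>' s = 0"
proof -
  define D where "D s = flat 0 (s - 1) + flat 0 (2 - s)" for s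
  define \<theta> where "\<theta> s = flat 0 (s - 1) / D s" for s
  define \<theta>' where "\<theta>' s = (flat 2 (s - 1) * flat 0 (2 - s) + flat 0 (s - 1) * flat 2 (2 - s)) / (D s)\<^sup>2" for s
  have f0: "0 \<le> flat n s" "s \<le> 0 \<Longrightarrow> flat n s = 0" "0 < s \<Longrightarrow> 0 < flat n s" for n s
    by (auto simp: flat_def)
  have D: "0 < D s" for s
  proof (cases "1 < s")
    case True
    then show ?thesis using f0(3)[of "s - 1" 0] f0(1)[of 0 "2 - s"] by (simp add: D_def)
  next
    case False
    then show ?thesis using f0(1)[of 0 "s - 1"] f0(3)[of "2 - s" 0] by (simp add: D_def)
  qed
  have f2: "(flat 0 has_real_derivative flat 2 t) (at t)" for t
    using flat_has_derivative[of 0 t] by (simp add: numeral_2_eq_2)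
  have d1: "((\<lambda>s. flat 0 (s - 1)) has_real_derivative flat 2 (s - 1)) (at s)" for s
    by (rule DERIV_cong[OF DERIV_chain2[OF f2]]) (auto intro!: derivative_eq_intros)
  have d2: "((\<lambda>s. flat 0 (2 - s)) has_real_derivative - flat 2 (2 - s)) (at s)" for s
    by (rule DERIV_cong[OF DERIV_chain2[OF f2]]) (auto intro!: derivative_eq_intros)
  have der: "(\<theta> has_real_derivative \<theta>' s) (at s)" for s
  proof -
    have "D s \<noteq> 0" using D[of s] by simp
    from DERIV_divide[OF d1 DERIV_add[OF d1 d2] this[unfolded D_def]]
    show ?thesis unfolding \<theta>_def[abs_def] \<theta>'_def D_def
      by (rule DERIV_cong) (simp add: power2_eq_square algebra_simps)
  qed
  have fc: "continuous_on UNIV (\<lambda>s. flat n (s - 1))" "continuous_on UNIV (\<lambda>s. flat n (2 - s))" for n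
    by (rule continuous_on_compose2[OF continuous_on_flat], intro continuous_intros, simp)+
  have cont: "continuous_on UNIV \<theta>'"
    unfolding \<theta>'_def[abs_def] D_def using D by (intro continuous_intros fc) (auto simp: D_def less_imp_neq[symmetric])
  have z: "\<theta>' s = 0" if "s \<notin> {1..2}" for s
    using that f0(2)[of "s - 1"] f0(2)[of "2 - s"] by (auto simp: \<theta>'_def)
  have "bounded (\<theta>' ` {1..2})"
    by (intro compact_imp_bounded compact_continuous_image continuous_on_subset[OF cont]) auto
  then obtain C where "\<forall>y\<in>\<theta>' ` {1..2}. norm y \<le> C" unfolding bounded_iff by blast
  then have C: "\<And>s. s \<in> {1..2} \<Longrightarrow> \<bar>\<theta>' s\<bar> \<le> C" by simp
  have "\<bar>\<theta>' s\<bar> \<le> max C 0" for s using C[of s] z[of s] by (cases "s \<in> {1..2}") auto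
  moreover have "\<theta> s = 0" if "s \<le> 1" for s using that f0(2)[of "s - 1"] by (simp add: \<theta>_def)
  moreover have "\<theta> s = 1" if "2 \<le> s" for s using that f0(2)[of "2 - s" 0] D[of s] by (simp add: \<theta>_def D_def)
  moreover have "\<bar>\<theta> s\<bar> \<le> 1" for s
    using D[of s] f0(1)[of 0 "s - 1"] f0(1)[of 0 "2 - s"] by (simp add: \<theta>_def D_def)
  ultimately show ?thesis using that[OF der cont, of "max C 0"] z by simp
qed

lemma AE_off_axis: "AE z :: (real ^ 'n) \<times> real in lebesgue. fst z \<noteq> 0"
proof -
  fix k :: 'n
  have "negligible {z :: (real ^ 'n) \<times> real. (axis k 1, 0) \<bullet> z = 0}"
    by (rule negligible_hyperplane) (simp add: zero_prod_def)
  moreover have "{z :: (real ^ 'n) \<times> real. fst z = 0} \<subseteq> {z. (axis k 1, 0) \<bullet> z = 0}"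
    by (auto simp: inner_prod_def)
  ultimately have "negligible {z :: (real ^ 'n) \<times> real. fst z = 0}" by (rule negligible_subset)
  then have "{z :: (real ^ 'n) \<times> real. fst z = 0} \<in> null_sets lebesgue" by (simp add: negligible_iff_null_sets)
  then show ?thesis by (rule AE_I') simp
qed

lemma measure_cyl:
  assumes "0 \<le> r" "a \<le> b"
  shows "measure lebesgue (cyl r a b :: ((real ^ 'n) \<times> real) set) = unit_ball_vol (real CARD('n)) * r ^ CARD('n) * (b - a)"
proof -
  have "emeasure lborel (cyl r a b :: ((real ^ 'n) \<times> real) set) = emeasure (lborel \<Otimes>\<^sub>M lborel) (cball (0 :: real ^ 'n) r \<times> {a..b})"
    by (simp add: lborel_prod cyl_def)
  also have "\<dots> = emeasure lborel (cball (0 :: real ^ 'n) r) * emeasure lborel {a..b}"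
    by (rule lborel.emeasure_pair_measure_Times) auto
  also have "\<dots> = ennreal (unit_ball_vol (real CARD('n)) * r ^ CARD('n) * (b - a))"
    using assms by (simp add: emeasure_cball ennreal_mult')
  finally show ?thesis
    using assms by (simp add: measure_def)
qed

lemma norm_integral_le_AE:
  fixes f :: "'a \<Rightarrow> real"
  assumes "integrable M f" "integrable M g" "AE z in M. norm (f z) \<le> g z"
  shows "norm (LINT z|M. f z) \<le> (LINT z|M. g z)"
proof -
  have "norm (LINT z|M. f z) \<le> (LINT z|M. norm (f z))" by (rule integral_norm_bound)
  also have "\<dots> \<le> (LINT z|M. g z)"
    using assms by (intro integral_mono_AE integrable_norm)
  finally show ?thesis .
qed

text \<open>Multiply the test function by a cutoff vanishing within distance e_n of the axis. The
  extra term carries a gradient of order 1/e_n on a set of volume of order e_n^N; as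
  \<open>w\<close> is locally bounded it is of order e_n^(N-1), which tends to 0 for N \<ge>
  2.\<close>

theorem weak_gradient_from_euler:
  fixes w :: "(real ^ 'n) \<times> real \<Rightarrow> real" and G :: "(real ^ 'n) \<times> real \<Rightarrow> real ^ 'n"
  assumes wl: "L1loc w" and Gl: "L1loc G" and rad: "radial w"
    and par: "AE z in lebesgue. z \<in> S_inf \<longrightarrow> (\<forall>i j. fst z $ i * G z $ j = fst z $ j * G z $ i)"
    and eul: "\<And>\<kappa> \<kappa>'. C1c \<kappa> \<kappa>' \<Longrightarrow> off_axis \<kappa> \<Longrightarrow>
      (LINT z|lebesgue. \<kappa> z * (fst z \<bullet> G z)) + (LINT z|lebesgue. (real CARD('n) * \<kappa> z + \<kappa>' z (fst z, 0)) * w z) = 0"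
    and bdd: "\<And>r a b. 0 < a \<Longrightarrow> \<exists>B. AE z in lebesgue. z \<in> cyl r a b \<longrightarrow> \<bar>w z\<bar> \<le> B"
    and N2: "2 \<le> CARD('n)"
  shows "radial_weak_gradient w G"
proof (unfold_locales, rule wl, rule Gl, rule rad)
  fix \<phi> :: "(real ^ 'n) \<times> real \<Rightarrow> real" and \<phi>' i
  assume \<phi>: "C1c \<phi> \<phi>'"
  note d = C1cD[OF \<phi>]
  obtain \<theta> \<theta>' :: "real \<Rightarrow> real" and C where
    \<theta>: "\<And>s. (\<theta> has_real_derivative \<theta>' s) (at s)" "continuous_on UNIV \<theta>'"
    "\<And>s. s \<le> 1 \<Longrightarrow> \<theta> s = 0" "\<And>s. 2 \<le> s \<Longrightarrow> \<theta> s = 1" "\<And>s. \<bar>\<theta> s\<bar> \<le> 1"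
    "\<And>s. \<bar>\<theta>' s\<bar> \<le> C" "\<And>s. 2 < s \<Longrightarrow> \<theta>' s = 0"
    by (rule cutoff) blast
  have C0: "0 \<le> C" using \<theta>(6)[of 0] by linarith
  obtain r a b0 where a: "0 < a" and s0: "\<And>z. z \<notin> cyl r a b0 \<Longrightarrow> \<phi> z = 0" using d(1) by (auto simp: C0c_def)
  \<comment> \<open>Raising the upper time to at least a keeps b - a nonnegative in the volume
    formula.\<close>
  define b where "b = max a b0"
  have s: "\<phi> z = 0" if "z \<notin> cyl r a b" for z 
  proof -
    have "cyl r a b0 \<subseteq> cyl r a b" by (auto simp: cyl_def b_def)
    then show ?thesis using that s0 by blast
  qed
  have s': "\<phi>' z v = 0" if "z \<notin> cyl r a b" for z v
    using derivative_zero_outside[OF d(2) s that] by blast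
  have ab: "a \<le> b" by (simp add: b_def)
  obtain B where B: "\<And>z. \<bar>\<phi> z\<bar> \<le> B" using C0c_bounded[OF d(1)] by metis
  obtain B' where B': "\<And>z. \<bar>\<phi>' z (axis i 1, 0)\<bar> \<le> B'" using C0c_bounded[OF d(4)] by metis
  have B0: "0 \<le> B" using B[of 0] by linarith
  obtain W0 where W0: "AE z in lebesgue. z \<in> cyl 2 a b \<longrightarrow> \<bar>w z\<bar> \<le> W0" using bdd[OF a] by blast
  define W where "W = max W0 0"
  have W: "AE z in lebesgue. z \<in> cyl 2 a b \<longrightarrow> \<bar>w z\<bar> \<le> W" "0 \<le> W" using W0 by (auto simp: W_def elim!: eventually_mono)
  define e where "e n = inverse (real (Suc n))" for n
  have e: "0 < e n" "e n \<le> 1" for n by (auto simp: e_def field_simps)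
  have el: "e \<longlonglongrightarrow> 0" unfolding e_def by (rule LIMSEQ_inverse_real_of_nat)
  \<comment> \<open>The cutoff is taken in |x|^2 rather than |x|, so that it is differentiable on
    the axis as well.\<close>
  define X where "X n z = \<theta> ((fst z \<bullet> fst z) / (e n)\<^sup>2)" for n and z :: "(real ^ 'n) \<times> real"
  define X' where "X' n z v = \<theta>' ((fst z \<bullet> fst z) / (e n)\<^sup>2) * (2 * (fst z \<bullet> fst v) / (e n)\<^sup>2)" for n and z v :: "(real ^ 'n) \<times> real"
  have Xd: "(X n has_derivative X' n z) (at z)" for n z
  proof -
    have "((\<lambda>z :: (real ^ 'n) \<times> real. (fst z \<bullet> fst z) / (e n)\<^sup>2) has_derivative (\<lambda>v. 2 * (fst z \<bullet> fst v) / (e n)\<^sup>2)) (at z)"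
      by (rule has_derivative_eq_rhs[OF bounded_linear.has_derivative[OF bounded_linear_divide
            has_derivative_inner[OF has_derivative_fst[OF has_derivative_ident] has_derivative_fst[OF has_derivative_ident]]]])
         (simp add: fun_eq_iff inner_commute)
    from DERIV_compose_FDERIV[OF \<theta>(1) this]
    show ?thesis unfolding X_def[abs_def] X'_def[abs_def] by (simp add: mult.commute)
  qed
  have X'c: "continuous_on UNIV (\<lambda>z. X' n z v)" for n v
    unfolding X'_def using e(1)[of n]
    by (intro continuous_intros continuous_on_compose2[OF \<theta>(2)]) auto
  have Xc: "continuous_on UNIV (X n)" for n
    using Xd by (meson continuous_at_imp_continuous_on has_derivative_continuous)
  have \<phi>n: "C1c (\<lambda>z. X n z * \<phi> z) (\<lambda>z v. X n z * \<phi>' z v + X' n z v * \<phi> z)" for n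
    by (rule C1c_mult[OF \<phi> Xd X'c])
  have offn: "off_axis (\<lambda>z. X n z * \<phi> z)" for n
    unfolding off_axis_def
  proof (intro exI conjI allI impI)
    show "0 < e n" by (rule e)
    fix z :: "(real ^ 'n) \<times> real" assume "norm (fst z) < e n"
    then have "(norm (fst z))\<^sup>2 \<le> (e n)\<^sup>2" by (intro power_mono) auto
    then have "(fst z \<bullet> fst z) / (e n)\<^sup>2 \<le> 1" using e(1)[of n] by (simp add: power2_norm_eq_inner)
    then show "X n z * \<phi> z = 0" using \<theta>(3) by (simp add: X_def)
  qed
  have Xb: "\<bar>X n z\<bar> \<le> 1" for n z by (simp add: X_def \<theta>(5))
  have Xl: "(\<lambda>n. X n z * t) \<longlonglongrightarrow> (if fst z = 0 then 0 else t)" for z t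
  proof (cases "fst z = 0")
    case True
    then show ?thesis using \<theta>(3)[of 0] by (simp add: X_def)
  next
    case False
    have "(\<lambda>n. (e n)\<^sup>2) \<longlonglongrightarrow> 0" using tendsto_power[OF el, of 2] by simp
    moreover have "0 < (fst z \<bullet> fst z) / 2" using False by simp
    ultimately have "\<forall>\<^sub>F n in sequentially. (e n)\<^sup>2 < (fst z \<bullet> fst z) / 2" by (rule order_tendstoD)
    then have "\<forall>\<^sub>F n in sequentially. X n z * t = t"
    proof eventually_elim
      case (elim n)
      then have "2 \<le> (fst z \<bullet> fst z) / (e n)\<^sup>2" using e(1)[of n] by (simp add: le_divide_eq)
      then show ?case using \<theta>(4) by (simp add: X_def)
    qed
    then show ?thesis using False by (simp add: tendsto_eventually)
  qed
  have XC: "C0c (\<lambda>z. X n z * \<phi>' z (axis i 1, 0))" "C0c (\<lambda>z. X' n z (axis i 1, 0) * \<phi> z)" for n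
    by (rule C0c_mult[OF d(4) Xc], rule C0c_mult[OF d(1) X'c])
  have wk: "(LINT z|lebesgue. X n z * \<phi> z * G z $ i) + (LINT z|lebesgue. X n z * \<phi>' z (axis i 1, 0) * w z)
      + (LINT z|lebesgue. X' n z (axis i 1, 0) * \<phi> z * w z) = 0" for n
  proof -
    have "(LINT z|lebesgue. (X n z * \<phi>' z (axis i 1, 0) + X' n z (axis i 1, 0) * \<phi> z) * w z) =
        (LINT z|lebesgue. X n z * \<phi>' z (axis i 1, 0) * w z + X' n z (axis i 1, 0) * \<phi> z * w z)"
      by (simp add: distrib_right)
    also have "\<dots> = (LINT z|lebesgue. X n z * \<phi>' z (axis i 1, 0) * w z) + (LINT z|lebesgue. X' n z (axis i 1, 0) * \<phi> z * w z)"
      by (rule Bochner_Integration.integral_add) (rule integrable_C0c_real[OF wl XC(1)], rule integrable_C0c_real[OF wl XC(2)])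
    moreover have "(LINT z|lebesgue. X n z * \<phi> z * G z $ i) +
        (LINT z|lebesgue. (X n z * \<phi>' z (axis i 1, 0) + X' n z (axis i 1, 0) * \<phi> z) * w z) = 0"
      by (rule weak_gradient_off_axis[where \<phi> = "\<lambda>z. X n z * \<phi> z", OF wl Gl rad par _ \<phi>n offn], rule eul)
    ultimately show ?thesis by linarith
  qed
  have L1: "(\<lambda>n. LINT z|lebesgue. X n z * \<phi> z * G z $ i) \<longlonglongrightarrow> (LINT z|lebesgue. (if fst z = 0 then 0 else \<phi> z) * G z $ i)"
  proof (rule tendsto_integral_C0c[OF L1loc_nth[OF Gl] a])
    show "X n z * \<phi> z = 0" if "z \<notin> cyl r a b" for n z using s[OF that] by simp
    show "\<bar>X n z * \<phi> z\<bar> \<le> B" for n z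
      using mult_mono[OF Xb[of n z] B[of z]] by (simp add: abs_mult)
    show "continuous_on UNIV (\<lambda>z. X n z * \<phi> z)" for n using C1cD(1)[OF \<phi>n] by (simp add: C0c_def)
  qed (rule Xl)
  have L2: "(\<lambda>n. LINT z|lebesgue. X n z * \<phi>' z (axis i 1, 0) * w z) \<longlonglongrightarrow> (LINT z|lebesgue. (if fst z = 0 then 0 else \<phi>' z (axis i 1, 0)) * w z)"
  proof (rule tendsto_integral_C0c[OF wl a])
    show "X n z * \<phi>' z (axis i 1, 0) = 0" if "z \<notin> cyl r a b" for n z using s'[OF that] by simp
    show "\<bar>X n z * \<phi>' z (axis i 1, 0)\<bar> \<le> B'" for n z
      using mult_mono[OF Xb[of n z] B'[of z]] by (simp add: abs_mult)
    show "continuous_on UNIV (\<lambda>z. X n z * \<phi>' z (axis i 1, 0))" for n using XC(1)[of n] by (simp add: C0c_def)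
  qed (rule Xl)
  have L3: "(\<lambda>n. LINT z|lebesgue. X' n z (axis i 1, 0) * \<phi> z * w z) \<longlonglongrightarrow> 0"
  proof (rule Lim_null_comparison)
    \<comment> \<open>On the cylinder of radius 2 e_n the cutoff derivative is at most 4 C / e_n;
      \<open>B\<close> and \<open>W\<close> bound the other factors, and the rest is the volume of
      that cylinder without the power of e_n.\<close>
    define K where "K = 4 * C * B * W * (unit_ball_vol (real CARD('n)) * 2 ^ CARD('n) * (b - a))"
    show "\<forall>\<^sub>F n in sequentially. norm (LINT z|lebesgue. X' n z (axis i 1, 0) * \<phi> z * w z) \<le> K * e n"
    proof (rule always_eventually, rule allI)
      fix n
      let ?Z = "cyl (2 * e n) a b :: ((real ^ 'n) \<times> real) set"
      have ii: "integrable lebesgue (\<lambda>z. indicator ?Z z * (4 * C * B * W / e n) :: real)"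
        using lmeasurable_compact[OF compact_cyl, of "2 * e n" a b]
        by (intro integrable_mult_left integrable_real_indicator) (auto simp: fmeasurable_def)
      have "norm (LINT z|lebesgue. X' n z (axis i 1, 0) * \<phi> z * w z) \<le> (LINT z|lebesgue. indicator ?Z z * (4 * C * B * W / e n))"
      proof (rule norm_integral_le_AE)
        show "integrable lebesgue (\<lambda>z. X' n z (axis i 1, 0) * \<phi> z * w z)" by (rule integrable_C0c_real[OF wl XC(2)])
        show "integrable lebesgue (\<lambda>z. indicator ?Z z * (4 * C * B * W / e n) :: real)" by (rule ii)
        show "AE z in lebesgue. norm (X' n z (axis i 1, 0) * \<phi> z * w z) \<le> indicator ?Z z * (4 * C * B * W / e n)"
          using W(1)
        proof eventually_elim
          case (elim z)
          show ?case
          proof (cases "z \<in> ?Z")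
            case False
            have "X' n z (axis i 1, 0) * \<phi> z = 0"
            proof (cases "z \<in> cyl r a b")
              case True
              with False have "2 * e n < norm (fst z)" by (auto simp: cyl_def)
              then have "(2 * e n)\<^sup>2 < (norm (fst z))\<^sup>2" using e(1)[of n] by (intro power_strict_mono) auto
              then have "4 < (fst z \<bullet> fst z) / (e n)\<^sup>2"
                using e(1)[of n] by (simp add: less_divide_eq power2_norm_eq_inner power_mult_distrib)
              then show ?thesis using \<theta>(7) by (simp add: X'_def)
            qed (simp add: s)
            then show ?thesis using False by simp
          next
            case True
            then have n2: "norm (fst z) \<le> 2 * e n" by (auto simp: cyl_def)
            have "z \<in> cyl 2 a b" using True e(2)[of n] by (auto simp: cyl_def)
            then have wz: "\<bar>w z\<bar> \<le> W" using elim by simp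
            have "\<bar>fst z $ i\<bar> \<le> 2 * e n" using component_le_norm_cart[of "fst z" i] n2 by linarith
            then have "\<bar>2 * (fst z $ i) / (e n)\<^sup>2\<bar> \<le> 4 / e n"
              using e(1)[of n] by (simp add: abs_divide divide_le_eq power2_eq_square abs_mult)
            then have "\<bar>X' n z (axis i 1, 0)\<bar> \<le> C * (4 / e n)"
              unfolding X'_def abs_mult fst_conv inner_axis1
              using \<theta>(6)[of "(fst z \<bullet> fst z) / (e n)\<^sup>2"] C0 by (intro mult_mono) auto
            then have "\<bar>X' n z (axis i 1, 0)\<bar> * \<bar>\<phi> z\<bar> * \<bar>w z\<bar> \<le> C * (4 / e n) * B * W"
              using B[of z] wz C0 B0 e(1)[of n] by (intro mult_mono) auto
            then show ?thesis using True by (simp add: abs_mult mult_ac)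
          qed
        qed
      qed
      also have "\<dots> = 4 * C * B * W / e n * measure lebesgue ?Z" by simp
      also have "measure lebesgue ?Z = unit_ball_vol (real CARD('n)) * (2 * e n) ^ CARD('n) * (b - a)"
        using e(1)[of n] ab by (intro measure_cyl) auto
      also have "4 * C * B * W / e n * (unit_ball_vol (real CARD('n)) * (2 * e n) ^ CARD('n) * (b - a))
          = 4 * C * B * W * (unit_ball_vol (real CARD('n)) * 2 ^ CARD('n) * (b - a)) * (e n ^ CARD('n) / e n)"
        by (simp add: power_mult_distrib)
      also have "\<dots> \<le> K * e n"
        unfolding K_def
      proof (rule mult_left_mono)
        have "e n ^ CARD('n) \<le> e n ^ 2" using e[of n] N2 by (intro power_decreasing) auto
        then show "e n ^ CARD('n) / e n \<le> e n" using e(1)[of n] by (simp add: divide_le_eq power2_eq_square)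
        show "0 \<le> 4 * C * B * W * (unit_ball_vol (real CARD('n)) * 2 ^ CARD('n) * (b - a))"
          using C0 B0 W(2) ab by simp
      qed
      finally show "norm (LINT z|lebesgue. X' n z (axis i 1, 0) * \<phi> z * w z) \<le> K * e n" .
    qed
    show "(\<lambda>n. K * e n) \<longlonglongrightarrow> 0" using tendsto_mult_left[OF el, of K] by simp
  qed
  have "(\<lambda>n. 0) \<longlonglongrightarrow> (LINT z|lebesgue. (if fst z = 0 then 0 else \<phi> z) * G z $ i) + (LINT z|lebesgue. (if fst z = 0 then 0 else \<phi>' z (axis i 1, 0)) * w z) + 0"
    using tendsto_add[OF tendsto_add[OF L1 L2] L3] unfolding wk .
  then have z: "(LINT z|lebesgue. (if fst z = 0 then 0 else \<phi> z) * G z $ i) + (LINT z|lebesgue. (if fst z = 0 then 0 else \<phi>' z (axis i 1, 0)) * w z) = 0"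
    by (simp add: LIMSEQ_const_iff)
  \<comment> \<open>The cutoffs converge to 0 on the axis, a null set, so the limits are the uncut
    integrals.\<close>
  have c: "(LINT z|lebesgue. (if fst z = 0 then 0 else f z) * h z) = (LINT z|lebesgue. f z * h z)"
    if m: "(\<lambda>z. f z * h z) \<in> borel_measurable lebesgue" for f h :: "(real ^ 'n) \<times> real \<Rightarrow> real"
  proof (rule integral_cong_AE)
    show ae: "AE z in lebesgue. (if fst z = 0 then 0 else f z) * h z = f z * h z"
      using AE_off_axis by eventually_elim simp
    have "(\<lambda>z. if z \<in> {z. fst z \<noteq> 0} then f z * h z else 0) \<in> borel_measurable lebesgue"
    proof (rule measurable_If_set[OF m])
      have "open {z :: (real ^ 'n) \<times> real. fst z \<noteq> 0}" by (intro open_Collect_neq continuous_intros)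
      from borel_open[OF this] show "{z :: (real ^ 'n) \<times> real. fst z \<noteq> 0} \<inter> space lebesgue \<in> sets lebesgue"
        by (intro sets_completionI_sets) simp
    qed simp
    then show "(\<lambda>z. (if fst z = 0 then 0 else f z) * h z) \<in> borel_measurable lebesgue"
      by (rule back_subst[of "\<lambda>f. f \<in> borel_measurable lebesgue"]) auto
  qed (rule m)
  from z show "(LINT z|lebesgue. \<phi> z * G z $ i) + (LINT z|lebesgue. \<phi>' z (axis i 1, 0) * w z) = 0"
    using c[OF borel_measurable_integrable[OF integrable_C0c_real[OF L1loc_nth[OF Gl] d(1)]]]
      c[OF borel_measurable_integrable[OF integrable_C0c_real[OF wl d(4)]]] by simp
qed

section \<open>Transport of weak solutions under a radial change of variables\<close>

lemma AE_lebesgue_on_iff: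
  "S \<in> sets lebesgue \<Longrightarrow> (AE z in lebesgue_on S. P z) \<longleftrightarrow> (AE z in lebesgue. z \<in> S \<longrightarrow> P z)"
  by (simp add: AE_restrict_space_iff)

lemma measurable_S_inf_cyl:
  fixes w :: "(real ^ 'n) \<times> real \<Rightarrow> 'b::real_normed_vector"
  assumes w: "w \<in> borel_measurable (lebesgue_on S_inf)" and a: "0 < a"
  shows "(\<lambda>z. indicator (cyl r a b) z *\<^sub>R w z) \<in> borel_measurable lebesgue"
proof -
  have "w \<in> borel_measurable (lebesgue_on (cyl r a b))"
    using w cyl_subset_S_inf[OF a] by (rule measurable_restrict_mono)
  then show ?thesis by (simp add: borel_measurable_restrict_space_iff)
qed

lemma measurable_S_inf_iff:
  fixes w :: "(real ^ 'n) \<times> real \<Rightarrow> 'b::real_normed_vector"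
  shows "w \<in> borel_measurable (lebesgue_on S_inf) \<longleftrightarrow> (\<lambda>z. indicator S_inf z *\<^sub>R w z) \<in> borel_measurable lebesgue"
  by (simp add: borel_measurable_restrict_space_iff)

lemma L1loc_bound:
  assumes F: "F \<in> borel_measurable (lebesgue_on S_inf)" and h: "L1loc h"
    and b: "\<And>r a b. 0 < a \<Longrightarrow> \<exists>B. AE z in lebesgue. z \<in> cyl r a b \<longrightarrow> norm (F z) \<le> B * norm (h z)"
  shows "L1loc F"
  unfolding L1loc_def set_integrable_def
proof (intro allI impI)
  fix r a b :: real assume a: "0 < a"
  obtain B where B: "AE z in lebesgue. z \<in> cyl r a b \<longrightarrow> norm (F z) \<le> B * norm (h z)" using b[OF a] by blast
  show "integrable lebesgue (\<lambda>z. indicator (cyl r a b) z *\<^sub>R F z)"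
  proof (rule Bochner_Integration.integrable_bound)
    show "integrable lebesgue (\<lambda>z. B * norm (indicator (cyl r a b) z *\<^sub>R h z))"
      using h a by (intro integrable_mult_right integrable_norm) (auto simp: L1loc_def set_integrable_def)
    show "(\<lambda>z. indicator (cyl r a b) z *\<^sub>R F z) \<in> borel_measurable lebesgue"
      by (rule measurable_S_inf_cyl[OF F a])
    show "AE z in lebesgue. norm (indicator (cyl r a b) z *\<^sub>R F z) \<le> norm (B * norm (indicator (cyl r a b) z *\<^sub>R h z))"
      using B by eventually_elim (auto simp: indicator_def split: if_splits)
  qed
qed

lemma L1loc_const: "L1loc (\<lambda>_. 1 :: real)"
  unfolding L1loc_def set_integrable_def
proof (intro allI impI)
  fix r a b :: real
  show "integrable lebesgue (\<lambda>z :: (real ^ 'n) \<times> real. indicator (cyl r a b) z *\<^sub>R (1 :: real))"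
    using lmeasurable_compact[OF compact_cyl, of r a b]
    by simp (intro integrable_real_indicator, auto simp: fmeasurable_def)
qed

text \<open>The function times the indicator of \<open>S_inf\<close> is the pointwise limit of its
  restrictions to an exhausting sequence of cylinders.\<close>

lemma L1loc_measurable:
  fixes F :: "(real ^ 'n) \<times> real \<Rightarrow> 'b::{banach, second_countable_topology}"
  assumes "L1loc F" shows "F \<in> borel_measurable (lebesgue_on S_inf)"
  unfolding measurable_S_inf_iff
proof (rule borel_measurable_LIMSEQ_metric)
  show "(\<lambda>z. indicator (cyl (real n) (inverse (real (Suc n))) (real n)) z *\<^sub>R F z) \<in> borel_measurable lebesgue" for n
  proof -
    have "integrable lebesgue (\<lambda>z. indicator (cyl (real n) (inverse (real (Suc n))) (real n)) z *\<^sub>R F z)"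
      using assms by (simp add: L1loc_def set_integrable_def)
    then show ?thesis by (rule borel_measurable_integrable)
  qed
  fix z :: "(real ^ 'n) \<times> real"
  have "\<forall>\<^sub>F n in sequentially. indicator (cyl (real n) (inverse (real (Suc n))) (real n)) z = (indicator S_inf z :: real)"
  proof (cases "z \<in> S_inf")
    case True
    then have s: "0 < snd z" by (auto simp: S_inf_def)
    obtain n0 where n0: "inverse (real (Suc n0)) < snd z" using reals_Archimedean[OF s] by auto
    show ?thesis
    proof (rule eventually_sequentiallyI)
      fix n assume n: "max n0 (nat \<lceil>max (norm (fst z)) (snd z)\<rceil>) \<le> n"
      then have "norm (fst z) \<le> real n" "snd z \<le> real n" by linarith+
      moreover have "inverse (real (Suc n)) \<le> inverse (real (Suc n0))" using n by (simp add: field_simps)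
      moreover from this have "inverse (real (Suc n)) \<le> snd z" using n0 by linarith
      ultimately have "z \<in> cyl (real n) (inverse (real (Suc n))) (real n)"
        by (cases z) (auto simp: cyl_def)
      then show "indicator (cyl (real n) (inverse (real (Suc n))) (real n)) z = (indicator S_inf z :: real)"
        using True by simp
    qed
  next
    case False
    have "z \<notin> cyl (real n) (inverse (real (Suc n))) (real n)" for n
      using False cyl_subset_S_inf[of "inverse (real (Suc n))" "real n" "real n"] by auto
    then show ?thesis using False by simp
  qed
  then have "\<forall>\<^sub>F n in sequentially. indicator (cyl (real n) (inverse (real (Suc n))) (real n)) z *\<^sub>R F z = indicator S_inf z *\<^sub>R F z"
    by eventually_elim simp
  then show "(\<lambda>n. indicator (cyl (real n) (inverse (real (Suc n))) (real n)) z *\<^sub>R F z) \<longlonglongrightarrow> indicator S_inf z *\<^sub>R F z"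
    by (rule tendsto_eventually)
qed

lemma integrable_lebesgue_on_iff:
  fixes f :: "'a::euclidean_space \<Rightarrow> 'b::{banach, second_countable_topology}"
  shows "K \<in> sets lebesgue \<Longrightarrow> integrable (lebesgue_on K) f \<longleftrightarrow> set_integrable lebesgue K f"
  by (simp add: set_integrable_def integrable_restrict_space)

lemma Lp_loc_iff:
  fixes w :: "(real ^ 'n) \<times> real \<Rightarrow> 'b::{real_normed_vector, second_countable_topology}"
  shows "Lp_loc q w \<longleftrightarrow> w \<in> borel_measurable (lebesgue_on S_inf) \<and> L1loc (\<lambda>z. norm (w z) powr q)"
proof -
  have "(\<forall>K. compact K \<and> K \<subseteq> S_inf \<longrightarrow> integrable (lebesgue_on K) (\<lambda>z. norm (w z) powr q)) \<longleftrightarrow> L1loc (\<lambda>z. norm (w z) powr q)"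
    (is "?L \<longleftrightarrow> ?R")
  proof
    assume L: ?L
    show ?R
      unfolding L1loc_def
    proof (intro allI impI)
      fix r a b :: real assume "0 < a"
      then have "integrable (lebesgue_on (cyl r a b)) (\<lambda>z. norm (w z) powr q)"
        by (intro L[rule_format] conjI compact_cyl cyl_subset_S_inf)
      then show "set_integrable lebesgue (cyl r a b) (\<lambda>z. norm (w z) powr q)"
        by (simp add: integrable_lebesgue_on_iff cyl_lebesgue)
    qed
  next
    assume R: ?R
    show ?L
    proof (intro allI impI, elim conjE)
      fix K :: "((real ^ 'n) \<times> real) set" assume K: "compact K" "K \<subseteq> S_inf"
      obtain r a b where c: "0 < a" "K \<subseteq> cyl r a b" by (rule compact_subset_cyl[OF K])
      have Km: "K \<in> sets lebesgue" using borel_compact[OF K(1)] by (intro sets_completionI_sets) simp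
      have "set_integrable lebesgue (cyl r a b) (\<lambda>z. norm (w z) powr q)" using R c(1) by (simp add: L1loc_def)
      then have "set_integrable lebesgue K (\<lambda>z. norm (w z) powr q)"
        using Km c(2) by (rule set_integrable_subset)
      then show "integrable (lebesgue_on K) (\<lambda>z. norm (w z) powr q)"
        by (simp add: integrable_lebesgue_on_iff Km)
    qed
  qed
  then show ?thesis by (simp add: Lp_loc_def)
qed

lemma Lp_loc_1_iff:
  fixes w :: "(real ^ 'n) \<times> real \<Rightarrow> 'b::{banach, second_countable_topology}"
  shows "Lp_loc 1 w \<longleftrightarrow> L1loc w"
proof
  assume L: "Lp_loc 1 w"
  show "L1loc w"
  proof (rule L1loc_bound)
    show "w \<in> borel_measurable (lebesgue_on S_inf)" "L1loc (\<lambda>z. norm (w z) powr 1)" using L by (auto simp: Lp_loc_iff)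
    show "\<exists>B. AE z in lebesgue. z \<in> cyl r a b \<longrightarrow> norm (w z) \<le> B * norm (norm (w z) powr 1)" for r a b
      by (rule exI[of _ 1]) simp
  qed
next
  assume L: "L1loc w"
  have "L1loc (\<lambda>z. norm (w z) powr 1)"
  proof (rule L1loc_bound[OF _ L])
    show "(\<lambda>z. norm (w z) powr 1) \<in> borel_measurable (lebesgue_on S_inf)"
      using L1loc_measurable[OF L] by (simp add: borel_measurable_norm)
    show "\<exists>B. AE z in lebesgue. z \<in> cyl r a b \<longrightarrow> norm (norm (w z) powr 1) \<le> B * norm (w z)" for r a b
      by (rule exI[of _ 1]) simp
  qed
  then show "Lp_loc 1 w" using L1loc_measurable[OF L] by (simp add: Lp_loc_iff)
qed

lemma integral_S_inf:
  fixes F :: "(real ^ 'n) \<times> real \<Rightarrow> 'b::euclidean_space"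
  assumes "\<And>z. z \<notin> S_inf \<Longrightarrow> F z = 0"
  shows "(LINT z|lebesgue_on S_inf. F z) = (LINT z|lebesgue. F z)"
proof -
  have "(LINT z|lebesgue_on S_inf. F z) = (LINT z|lebesgue. indicator S_inf z *\<^sub>R F z)"
    by (rule integral_restrict_space) (simp add: S_inf_lebesgue)
  also have "(\<lambda>z. indicator S_inf z *\<^sub>R F z) = F" using assms by (auto simp: indicator_def fun_eq_iff)
  finally show ?thesis .
qed

lemma C1c_zero_outside:
  assumes "C1c \<phi> \<phi>'" "z \<notin> S_inf"
  shows "\<phi> z = 0" "\<phi>' z v = 0"
proof -
  obtain r a b where a: "0 < a" and s: "\<And>z. z \<notin> cyl r a b \<Longrightarrow> \<phi> z = 0"
    using C1cD(1)[OF assms(1)] by (auto simp: C0c_def)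
  have z: "z \<notin> cyl r a b" using assms(2) cyl_subset_S_inf[OF a] by blast
  show "\<phi> z = 0" using s z by blast
  show "\<phi>' z v = 0" by (rule derivative_zero_outside[OF C1cD(2)[OF assms(1)] s z])
qed

lemma linear_C1c_scale: "C1c \<phi> \<phi>' \<Longrightarrow> \<phi>' z (c *\<^sub>R v, 0) = c * \<phi>' z (v, 0)"
  using linear_cmul[OF C1cD(5), of \<phi> \<phi>' z c "(v, 0)"] by simp

text \<open>With \<open>V\<close> equal to \<open>w\<close> times the i-th direction and zero-order
  coefficient G_i, each component of the defining identity is an instance of \<open>wint\<close>. It
  thereby passes from smooth to C^1 test functions.\<close>

lemma weak_space_grad_iff:
  fixes w :: "(real ^ 'n) \<times> real \<Rightarrow> real" and G :: "(real ^ 'n) \<times> real \<Rightarrow> real ^ 'n"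
  shows "weak_space_grad w G \<longleftrightarrow> L1loc w \<and> L1loc G \<and>
    (\<forall>\<phi> \<phi>' i. C1c \<phi> \<phi>' \<longrightarrow> (LINT z|lebesgue. \<phi> z * G z $ i) + (LINT z|lebesgue. \<phi>' z (axis i 1, 0) * w z) = 0)"
proof -
  have comp: "(LINT z|lebesgue_on S_inf. w z *\<^sub>R space_grad \<phi> z) $ i = (LINT z|lebesgue. frechet_derivative \<phi> (at z) (axis i 1, 0) * w z)"
    "(LINT z|lebesgue_on S_inf. \<phi> z *\<^sub>R G z) $ i = (LINT z|lebesgue. \<phi> z * G z $ i)"
    if w: "L1loc w" and G: "L1loc G" and t: "test_fun \<phi>" for \<phi> i
  proof -
    note \<phi> = test_fun_C1c[OF t]
    note d = C1cD[OF \<phi>]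
    have "w z *\<^sub>R space_grad \<phi> z = (\<Sum>k\<in>UNIV. (frechet_derivative \<phi> (at z) (axis k 1, 0) * w z) *\<^sub>R axis k 1)" for z
    proof -
      have "space_grad \<phi> z = (\<Sum>k\<in>UNIV. (space_grad \<phi> z $ k) *\<^sub>R axis k 1)"
        using basis_expansion[of "space_grad \<phi> z"] by (simp add: scalar_mult_eq_scaleR)
      then have "w z *\<^sub>R space_grad \<phi> z = w z *\<^sub>R (\<Sum>k\<in>UNIV. (space_grad \<phi> z $ k) *\<^sub>R axis k 1)" by simp
      then show ?thesis by (simp add: space_grad_def scaleR_sum_right mult.commute)
    qed
    then have i: "integrable lebesgue (\<lambda>z. w z *\<^sub>R space_grad \<phi> z)"
      using integrable_C0c_real[OF w d(4)] by (simp only:) (intro Bochner_Integration.integrable_sum integrable_scaleR_left)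
    have z: "w z *\<^sub>R space_grad \<phi> z = 0" "\<phi> z *\<^sub>R G z = 0" if "z \<notin> S_inf" for z
      using C1c_zero_outside[OF \<phi> that] by (auto simp: space_grad_def vec_eq_iff)
    have e1: "(LINT z|lebesgue_on S_inf. w z *\<^sub>R space_grad \<phi> z) = (LINT z|lebesgue. w z *\<^sub>R space_grad \<phi> z)"
      by (rule integral_S_inf) (rule z(1))
    have e2: "(LINT z|lebesgue_on S_inf. \<phi> z *\<^sub>R G z) = (LINT z|lebesgue. \<phi> z *\<^sub>R G z)"
      by (rule integral_S_inf) (rule z(2))
    show "(LINT z|lebesgue_on S_inf. w z *\<^sub>R space_grad \<phi> z) $ i = (LINT z|lebesgue. frechet_derivative \<phi> (at z) (axis i 1, 0) * w z)"
      unfolding e1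
      using integral_bounded_linear[OF bounded_linear_vec_nth i, of i] by (simp add: space_grad_def mult.commute)
    show "(LINT z|lebesgue_on S_inf. \<phi> z *\<^sub>R G z) $ i = (LINT z|lebesgue. \<phi> z * G z $ i)"
      unfolding e2
      using integral_bounded_linear[OF bounded_linear_vec_nth integrable_C0c[OF G d(1)], of i] by simp
  qed
  show ?thesis (is "?L \<longleftrightarrow> ?R")
  proof
    assume L: ?L
    then have w: "L1loc w" and G: "L1loc G" by (auto simp: weak_space_grad_def Lp_loc_1_iff)
    have "(LINT z|lebesgue. \<phi> z * G z $ i) + (LINT z|lebesgue. \<phi>' z (axis i 1, 0) * w z) = 0"
      if \<phi>: "C1c \<phi> \<phi>'" for \<phi> \<phi>' i
    proof -
      have V: "L1loc (\<lambda>z. (w z *\<^sub>R axis i (1::real), 0::real))"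
        by (rule L1loc_bounded_linear[OF w]) (intro bounded_linear_Pair bounded_linear_scaleR_left bounded_linear_zero)
      have split: "wint (\<lambda>z. G z $ i) (\<lambda>z. (w z *\<^sub>R axis i 1, 0)) \<psi> \<psi>' = (LINT z|lebesgue. \<psi> z * G z $ i) + (LINT z|lebesgue. \<psi>' z (axis i 1, 0) * w z)"
        if \<psi>: "C1c \<psi> \<psi>'" for \<psi> \<psi>'
      proof -
        have "wint (\<lambda>z. G z $ i) (\<lambda>z. (w z *\<^sub>R axis i 1, 0)) \<psi> \<psi>' = (LINT z|lebesgue. \<psi> z * G z $ i + \<psi>' z (axis i 1, 0) * w z)"
          unfolding wint_def by (simp add: linear_C1c_scale[OF \<psi>] mult.commute)
        also have "\<dots> = (LINT z|lebesgue. \<psi> z * G z $ i) + (LINT z|lebesgue. \<psi>' z (axis i 1, 0) * w z)"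
          by (rule Bochner_Integration.integral_add)
             (rule integrable_C0c_real[OF L1loc_nth[OF G] C1cD(1)[OF \<psi>]], rule integrable_C0c_real[OF w C1cD(4)[OF \<psi>]])
        finally show ?thesis .
      qed
      have "wint (\<lambda>z. G z $ i) (\<lambda>z. (w z *\<^sub>R axis i 1, 0)) \<phi> \<phi>' = 0"
      proof (rule wint_C1c_eq_0[OF \<phi> L1loc_nth[OF G] V])
        fix \<eta> :: "(real ^ 'n) \<times> real \<Rightarrow> real" assume t: "test_fun \<eta>"
        have "(LINT z|lebesgue_on S_inf. w z *\<^sub>R space_grad \<eta> z) $ i = - ((LINT z|lebesgue_on S_inf. \<eta> z *\<^sub>R G z) $ i)"
          using L t by (simp add: weak_space_grad_def)
        then show "wint (\<lambda>z. G z $ i) (\<lambda>z. (w z *\<^sub>R axis i 1, 0)) \<eta> (\<lambda>z. frechet_derivative \<eta> (at z)) = 0"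
          unfolding split[OF test_fun_C1c[OF t]] comp[OF w G t] by simp
      qed
      then show ?thesis unfolding split[OF \<phi>] .
    qed
    then show ?R using w G by blast
  next
    assume R: ?R
    then have w: "L1loc w" and G: "L1loc G" by auto
    have "(LINT z|lebesgue_on S_inf. w z *\<^sub>R space_grad \<phi> z) = - (LINT z|lebesgue_on S_inf. \<phi> z *\<^sub>R G z)"
      if t: "test_fun \<phi>" for \<phi>
    proof -
      have "(LINT z|lebesgue. \<phi> z * G z $ i) + (LINT z|lebesgue. frechet_derivative \<phi> (at z) (axis i 1, 0) * w z) = 0" for i
        using R test_fun_C1c[OF t] by blast
      then show ?thesis
        unfolding vec_eq_iff vector_uminus_component comp[OF w G t] by (simp add: add_eq_0_iff2)
    qed
    then show ?L using w G by (simp add: weak_space_grad_def Lp_loc_1_iff)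
  qed
qed

lemma weak_form_eq_wint:
  fixes u :: "real ^ 'n \<Rightarrow> real \<Rightarrow> real"
  assumes t: "test_fun \<eta>"
  shows "weak_form p m a b u G \<eta> = wint (\<lambda>_. 0)
    (\<lambda>z. (b (fst z) *\<^sub>R flux p m (u (fst z) (snd z)) (G z), - (a (fst z) * u (fst z) (snd z)))) \<eta> (\<lambda>z. frechet_derivative \<eta> (at z))"
proof -
  note \<eta> = test_fun_C1c[OF t]
  note l = C1cD(5)[OF \<eta>]
  have g: "F \<bullet> space_grad \<eta> z = frechet_derivative \<eta> (at z) (F, 0)" for F z
    unfolding C1c_space_expand[OF \<eta>, of z F] by (simp add: inner_vec_def space_grad_def)
  have eq: "frechet_derivative \<eta> (at z) (b (fst z) *\<^sub>R F, - (a (fst z) * y)) =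
      - (a (fst z) * y * time_deriv \<eta> z) + b (fst z) * (F \<bullet> space_grad \<eta> z)" for z F y
  proof -
    have "(b (fst z) *\<^sub>R F, - (a (fst z) * y)) = b (fst z) *\<^sub>R (F, 0) + (- (a (fst z) * y)) *\<^sub>R (0, 1)" by simp
    then show ?thesis
      by (simp only: linear_add[OF l] linear_cmul[OF l] g time_deriv_def real_scaleR_def) simp
  qed
  have "weak_form p m a b u G \<eta> = (LINT z|lebesgue_on S_inf.
      frechet_derivative \<eta> (at z) (b (fst z) *\<^sub>R flux p m (u (fst z) (snd z)) (G z), - (a (fst z) * u (fst z) (snd z))))"
    unfolding weak_form_def by (intro Bochner_Integration.integral_cong refl) (simp add: eq split_beta)
  also have "\<dots> = (LINT z|lebesgue. frechet_derivative \<eta> (at z) (b (fst z) *\<^sub>R flux p m (u (fst z) (snd z)) (G z), - (a (fst z) * u (fst z) (snd z))))"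
    by (rule integral_S_inf) (rule C1c_zero_outside[OF \<eta>])
  finally show ?thesis by (simp add: wint_def)
qed

section \<open>The flux in terms of the weak gradient of u^sigma\<close>

lemma flux_eq:
  assumes p: "1 < p" and \<sigma>: "0 < sig p m"
  shows "flux p m y G = (if y = 0 then 0 else (sig p m powr (1 - p) * norm G powr (p - 2)) *\<^sub>R G)"
proof (cases "y = 0")
  case False
  define \<sigma> where "\<sigma> = sig p m"
  have s: "0 < \<sigma>" using assms by (simp add: \<sigma>_def)
  have "\<sigma> * (p - 1) = p + m - 2" using p by (simp add: \<sigma>_def sig_def)
  \<comment> \<open>By the choice of sigma the powers of \<open>y\<close> in the coefficient, in
    |Du|^(p-2) and in Du add up to zero.\<close>
  then have ex: "(m - 1) + (1 - \<sigma>) * (p - 2) + (1 - \<sigma>) = 0" by (simp add: algebra_simps)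
  define c where "c = y powr (1 - \<sigma>)"
  have c: "0 < c" using False by (simp add: c_def)
  have "norm (Du p m y G) = (c / \<sigma>) * norm G"
    using s c by (simp add: Du_def c_def \<sigma>_def)
  then have "flux p m y G = (y powr (m - 1) * ((c / \<sigma>) * norm G) powr (p - 2) * (c / \<sigma>)) *\<^sub>R G"
    by (simp add: flux_def) (simp add: Du_def c_def \<sigma>_def)
  also have "y powr (m - 1) * ((c / \<sigma>) * norm G) powr (p - 2) * (c / \<sigma>)
      = (y powr (m - 1) * c powr (p - 2) * c) * (\<sigma> powr (- (p - 2)) / \<sigma>) * norm G powr (p - 2)"
    unfolding powr_minus_divide[of \<sigma> "p - 2"] using s c by (simp add: powr_mult powr_divide)
  also have "y powr (m - 1) * c powr (p - 2) * c = y powr ((m - 1) + (1 - \<sigma>) * (p - 2) + (1 - \<sigma>))"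
    unfolding c_def powr_add powr_powr ..
  also have "\<dots> = 1" using False by (simp add: ex)
  also have "\<sigma> powr (- (p - 2)) / \<sigma> = \<sigma> powr (1 - p)"
    using s powr_diff[of \<sigma> "- (p - 2)" 1] by simp
  finally show ?thesis using False by (simp only: \<sigma>_def if_False mult_1)
qed (simp add: flux_def Du_def)

lemma flux_scale:
  assumes "1 < p" "0 < sig p m" "0 < c"
  shows "flux p m y (c *\<^sub>R G) = c powr (p - 1) *\<^sub>R flux p m y G"
proof -
  have e: "c powr (p - 1) = c powr (p - 2) * c"
    using assms(3) powr_add[of c "p - 2" 1] by simp
  have "sig p m powr (1 - p) * (c * norm G) powr (p - 2) * c = c powr (p - 1) * (sig p m powr (1 - p) * norm G powr (p - 2))"
    unfolding e using assms(3) by (simp add: powr_mult)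
  then show ?thesis using assms(3) by (simp add: flux_eq[OF assms(1,2)])
qed

text \<open>Since |G|^(p-1) \<le> 1 + |G|^p, local integrability of |G|^p passes to the flux,
  whatever the values of u.\<close>

lemma norm_flux_le:
  assumes "1 < p" "0 < sig p m"
  shows "norm (flux p m y G) \<le> sig p m powr (1 - p) * (1 + norm G powr p)"
proof -
  have "norm G powr (p - 2) * norm G \<le> 1 + norm G powr p"
  proof (cases "G = 0")
    case False
    then have "norm G powr (p - 2) * norm G = norm G powr (p - 1)"
      using powr_add[of "norm G" "p - 2" 1] by simp
    also have "\<dots> \<le> 1 + norm G powr p"
    proof (cases "norm G \<le> 1")
      case True
      then have "norm G powr (p - 1) \<le> 1 powr (p - 1)" using assms(1) by (intro powr_mono2) auto
      then show ?thesis by (simp add: add_increasing2)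
    next
      case False
      then have "norm G powr (p - 1) \<le> norm G powr p" by (intro powr_mono) auto
      then show ?thesis by simp
    qed
    finally show ?thesis .
  qed simp
  then have "sig p m powr (1 - p) * (norm G powr (p - 2) * norm G) \<le> sig p m powr (1 - p) * (1 + norm G powr p)"
    by (intro mult_left_mono) auto
  moreover have "norm (flux p m y G) \<le> sig p m powr (1 - p) * (norm G powr (p - 2) * norm G)"
    by (simp add: flux_eq[OF assms] mult.assoc)
  ultimately show ?thesis by linarith
qed

section \<open>Transport of functions, gradients and test functions\<close>

definition radmapT :: "(real \<Rightarrow> real) \<Rightarrow> (real \<Rightarrow> real) \<Rightarrow> (real ^ 'n) \<times> real \<Rightarrow> (real ^ 'n) \<times> real" where
  "radmapT S S' z = (radmap S S' (fst z), snd z)"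

lemma radD_linear: "linear (radD S S' x)"
  unfolding radD_def by (rule linearI) (simp_all add: algebra_simps inner_add_left scaleR_add_left)

text \<open>Radial vectors are eigenvectors with eigenvalue S', so fields parallel to x never see
  the tangential factor.\<close>

lemma radD_self: "radD S S' x (k *\<^sub>R x) = (k * S' (norm x)) *\<^sub>R x"
proof -
  have "(x \<bullet> sgn x) *\<^sub>R sgn x = x"
  proof (cases "x = 0")
    case False
    have "x \<bullet> sgn x = norm x" using False by (simp add: sgn_div_norm dot_square_norm power2_eq_square)
    then show ?thesis using False by (simp add: sgn_div_norm)
  qed simp
  then have "((S' (norm x) - radq S S' (norm x)) * (x \<bullet> sgn x)) *\<^sub>R sgn x = (S' (norm x) - radq S S' (norm x)) *\<^sub>R x"
    by (metis scaleR_scaleR)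
  then have "radD S S' x x = S' (norm x) *\<^sub>R x"
    by (simp add: radD_def scaleR_left_diff_distrib)
  then show ?thesis using linear_cmul[OF radD_linear, of S S' x k x] by simp
qed

lemma parallel_eq_scaleR:
  fixes x G :: "real ^ 'n"
  assumes "\<And>i j. x $ i * G $ j = x $ j * G $ i" "x \<noteq> 0"
  shows "G = ((x \<bullet> G) / (x \<bullet> x)) *\<^sub>R x"
proof -
  have "(x \<bullet> x) * G $ j = (x \<bullet> G) * x $ j" for j
  proof -
    have "(x \<bullet> x) * G $ j = (\<Sum>i\<in>UNIV. x $ i * (x $ i * G $ j))" by (simp add: inner_vec_def sum_distrib_right mult.assoc)
    also have "\<dots> = (\<Sum>i\<in>UNIV. x $ i * (x $ j * G $ i))" using assms(1) by simp
    also have "\<dots> = (x \<bullet> G) * x $ j" by (simp add: inner_vec_def sum_distrib_left sum_distrib_right mult_ac)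
    finally show ?thesis .
  qed
  then show ?thesis using assms(2) by (simp add: vec_eq_iff nonzero_eq_divide_eq mult.commute)
qed

context radial_diffeo
begin

interpretation inv: radial_diffeo R R' by (rule inverse)

lemma radq_inverse: "0 \<le> s \<Longrightarrow> radq R R' s * radq S S' (R s) = 1"
proof (cases "s = 0")
  case True
  have "S' 0 \<noteq> 0" using pos'[of 0] by simp
  then show ?thesis using True inv.zero by (simp add: radq_def R'_def)
next
  case False
  assume "0 \<le> s"
  with False have "0 < R s" using inv.pos by simp
  then show ?thesis using False \<open>0 \<le> s\<close> SR[of s] by (simp add: radq_def)
qed

lemma R'_S': "0 \<le> s \<Longrightarrow> R' s * S' (R s) = 1"
  using pos'[OF R_nonneg, of s] by (simp add: R'_def)

lemma radjac_inverse: "radjac R R' y * radjac S S' (radmap R R' y) = 1"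
proof -
  have "radjac R R' y * radjac S S' (radmap R R' y) =
      (radq R R' (norm y) * radq S S' (R (norm y))) ^ (DIM('a) - 1) * (R' (norm y) * S' (R (norm y)))"
    by (simp add: radjac_def inv.norm_radmap power_mult_distrib)
  then show ?thesis by (simp add: radq_inverse R'_S')
qed

lemma jacT: "jacobian (radmapT S S' :: (real ^ 'n) \<times> real \<Rightarrow> _) (\<lambda>z. radjac S S' (fst z))"
  using jacobian_Times[OF jacobian_radmap] by (simp add: radmapT_def[abs_def])

lemma radmapT_inverse: "radmapT R R' (radmapT S S' z) = z" "radmapT S S' (radmapT R R' z) = z"
  by (simp_all add: radmapT_def radmap_R)

lemma radmapT_S_inf: "radmapT S S' z \<in> S_inf \<longleftrightarrow> z \<in> S_inf"
  by (cases z) (simp add: radmapT_def S_inf_def)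

text \<open>The radius \<open>max r 0\<close> accounts for empty cylinders of negative radius, where
  nothing is known about \<open>R\<close>.\<close>

lemma radmapT_cyl: "radmapT S S' z \<in> cyl r a b \<Longrightarrow> z \<in> cyl (R (max r 0)) a b"
proof -
  assume "radmapT S S' z \<in> cyl r a b"
  then have "S (norm (fst z)) \<le> max r 0" and t: "a \<le> snd z" "snd z \<le> b"
    by (auto simp: radmapT_def cyl_def norm_radmap)
  then have "norm (fst z) \<le> R (max r 0)"
    using le_iff[of "norm (fst z)" "R (max r 0)"] R_nonneg[of "max r 0"] SR[of "max r 0"] by simp
  then show ?thesis using t by (cases z) (simp add: cyl_def)
qed

lemma C1c_comp:
  fixes \<phi> :: "(real ^ 'n) \<times> real \<Rightarrow> real"
  assumes \<phi>: "C1c \<phi> \<phi>'"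
  shows "C1c (\<lambda>z. \<phi> (radmapT S S' z)) (\<lambda>z v. \<phi>' (radmapT S S' z) (radD S S' (fst z) (fst v), snd v))"
proof -
  note d = C1cD[OF \<phi>]
  have Tc: "continuous_on UNIV (radmapT S S' :: (real ^ 'n) \<times> real \<Rightarrow> _)"
    unfolding radmapT_def
    by (intro continuous_on_Pair continuous_on_compose2[OF continuous_on_radmap] continuous_intros) simp
  have pc: "continuous_on UNIV \<phi>" using d(1) by (simp add: C0c_def)
  have der: "((\<lambda>z. \<phi> (radmapT S S' z)) has_derivative (\<lambda>v. \<phi>' (radmapT S S' z) (radD S S' (fst z) (fst v), snd v))) (at z)" for z
  proof -
    have "(radmapT S S' has_derivative (\<lambda>v. (radD S S' (fst z) (fst v), snd v))) (at z)"
      unfolding radmapT_def[abs_def]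
      by (intro has_derivative_Pair has_derivative_compose[OF has_derivative_fst[OF has_derivative_ident] radmap_has_derivative]
          has_derivative_snd has_derivative_ident)
    from has_derivative_compose[OF this d(2)] show ?thesis .
  qed
  have dc: "continuous_on UNIV (\<lambda>z. \<phi>' (radmapT S S' z) (radD S S' (fst z) (fst v), snd v))" for v
  proof -
    have ex: "\<phi>' (radmapT S S' z) (radD S S' (fst z) (fst v), snd v) =
        (\<Sum>b\<in>Basis. \<phi>' (radmapT S S' z) b * ((radD S S' (fst z) (fst v), snd v) \<bullet> b))" for z
      using C1c_expand[OF \<phi>, of "radmapT S S' z" "\<lambda>_. (radD S S' (fst z) (fst v), snd v)"] .
    have Dc: "continuous_on UNIV (\<lambda>z :: (real ^ 'n) \<times> real. radD S S' (fst z) (fst v))"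
      by (rule continuous_on_compose2[OF continuous_on_radD]) (auto intro: continuous_intros)
    show ?thesis
      unfolding ex
      by (intro continuous_intros continuous_on_compose2[OF d(3) Tc] Dc) auto
  qed
  have "C0c (\<lambda>z. \<phi> (radmapT S S' z))"
  proof -
    obtain r a b where a: "0 < a" and s: "\<And>z. z \<notin> cyl r a b \<Longrightarrow> \<phi> z = 0" using d(1) by (auto simp: C0c_def)
    have "\<forall>z. z \<notin> cyl (R (max r 0)) a b \<longrightarrow> \<phi> (radmapT S S' z) = 0" using s radmapT_cyl by blast
    moreover have "continuous_on UNIV (\<lambda>z. \<phi> (radmapT S S' z))"
      by (rule continuous_on_compose2[OF pc Tc]) simp
    ultimately show ?thesis using a unfolding C0c_def by blast
  qed
  then show ?thesis using der dc unfolding C1c_def by blast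
qed

lemma AE_radmapT: "AE z in lebesgue. P z \<Longrightarrow> AE z :: (real ^ 'n) \<times> real in lebesgue. P (radmapT R R' z)"
  by (rule jacobian.AE_comp[OF radial_diffeo.jacT[OF inverse]])

lemma measurable_S_inf_comp:
  fixes F :: "(real ^ 'n) \<times> real \<Rightarrow> 'b::{banach, second_countable_topology}"
  assumes "F \<in> borel_measurable (lebesgue_on S_inf)"
  shows "(\<lambda>z. F (radmapT R R' z)) \<in> borel_measurable (lebesgue_on S_inf)"
  using jacobian.measurable_comp[OF radial_diffeo.jacT[OF inverse] assms[unfolded measurable_S_inf_iff]]
  unfolding measurable_S_inf_iff by (simp add: indicator_def radial_diffeo.radmapT_S_inf[OF inverse])

text \<open>Changing variables back, the integrand becomes \<open>F\<close> times the Jacobian on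
  the preimage of a cylinder. This preimage lies in a cylinder, on which the continuous Jacobian is
  bounded.\<close>

lemma L1loc_comp:
  fixes F :: "(real ^ 'n) \<times> real \<Rightarrow> 'b::{banach, second_countable_topology}"
  assumes F: "L1loc F"
  shows "L1loc (\<lambda>z. F (radmapT R R' z))"
  unfolding L1loc_def set_integrable_def
proof (intro allI impI)
  fix r a b :: real assume a: "0 < a"
  interpret J: jacobian "radmapT S S' :: (real ^ 'n) \<times> real \<Rightarrow> _" "\<lambda>z. radjac S S' (fst z)" by (rule jacT)
  interpret JR: jacobian "radmapT R R' :: (real ^ 'n) \<times> real \<Rightarrow> _" "\<lambda>z. radjac R R' (fst z)" by (rule radial_diffeo.jacT[OF inverse])
  define A :: "((real ^ 'n) \<times> real) set" where "A = radmapT S S' -` cyl r a b"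
  have Am: "A \<in> sets lebesgue"
    using measurable_sets[OF J.\<Psi>_lebesgue cyl_lebesgue[of r a b]] by (simp add: A_def)
  have Ai: "integrable lebesgue (\<lambda>z. indicator A z *\<^sub>R H z)" if H: "L1loc H" for H :: "(real ^ 'n) \<times> real \<Rightarrow> 'b"
  proof -
    have "set_integrable lebesgue (cyl (R (max r 0)) a b) H" using H a by (simp add: L1loc_def)
    then have "set_integrable lebesgue A H"
      by (rule set_integrable_subset[OF _ Am]) (unfold A_def, use radmapT_cyl in blast)
    then show ?thesis by (simp add: set_integrable_def)
  qed
  define H where "H y = indicator (cyl r a b) y *\<^sub>R F (radmapT R R' y)" for y
  have "(\<lambda>y. indicator A (radmapT R R' y) *\<^sub>R F (radmapT R R' y)) \<in> borel_measurable lebesgue"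
    using JR.measurable_comp[OF borel_measurable_integrable[OF Ai[OF F]]] .
  then have Hm: "H \<in> borel_measurable lebesgue"
    by (simp add: H_def[abs_def] A_def indicator_def radmapT_inverse)
  have "L1loc (\<lambda>z. radjac S S' (fst z) *\<^sub>R F z)"
    by (rule L1loc_scale_continuous[OF F], rule continuous_on_compose2[OF continuous_on_radjac])
       (auto intro: continuous_intros)
  from Ai[OF this] have "integrable lebesgue (\<lambda>z. radjac S S' (fst z) *\<^sub>R H (radmapT S S' z))"
    by (simp add: H_def A_def indicator_def radmapT_inverse mult.commute)
  then have "integrable lebesgue H" using J.integrable_comp_iff[OF Hm] by simp
  then show "integrable lebesgue (\<lambda>z. indicator (cyl r a b) z *\<^sub>R F (radmapT R R' z))"
    by (simp add: H_def[abs_def])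
qed

text \<open>The chain rule for radial functions: on a gradient parallel to x the transposed
  derivative of the radial map is multiplication by R'.\<close>

definition gradmap :: "((real ^ 'n) \<times> real \<Rightarrow> real ^ 'n) \<Rightarrow> (real ^ 'n) \<times> real \<Rightarrow> real ^ 'n" where
  "gradmap G z = R' (norm (fst z)) *\<^sub>R G (radmapT R R' z)"

lemma continuous_on_R'_norm: "continuous_on UNIV (\<lambda>z :: (real ^ 'n) \<times> real. R' (norm (fst z)))"
  by (rule continuous_on_compose2[OF inv.continuous_on_deriv_norm]) (auto intro: continuous_intros)

lemma L1loc_gradmap: "L1loc G \<Longrightarrow> L1loc (gradmap G)"
  unfolding gradmap_def[abs_def] by (intro L1loc_scale_continuous L1loc_comp continuous_on_R'_norm)

lemma radq_power_derivative:
  fixes z :: "(real ^ 'n) \<times> real"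
  assumes "fst z \<noteq> 0"
  shows "((\<lambda>z. radq S S' (norm (fst z)) ^ k) has_derivative
    (\<lambda>v. (fst v \<bullet> sgn (fst z)) * (real k * radq S S' (norm (fst z)) ^ (k - 1) * ((S' (norm (fst z)) - radq S S' (norm (fst z))) / norm (fst z))))) (at z)"
proof -
  define r where "r = norm (fst z)"
  have r: "0 < r" using assms by (simp add: r_def)
  have "((\<lambda>s. S s / s) has_real_derivative (S' r * r - S r) / (r * r)) (at r)"
    using r deriv_at[OF r] by (auto intro!: derivative_eq_intros)
  moreover have "(S' r * r - S r) / (r * r) = (S' r - radq S S' r) / r"
    using r by (simp add: radq_def field_simps)
  ultimately have "((\<lambda>s. S s / s) has_real_derivative (S' r - radq S S' r) / r) (at r)" by simp
  then have "(radq S S' has_real_derivative (S' r - radq S S' r) / r) (at r)"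
    by (rule has_field_derivative_transform_within_open[where S = "{0<..}"]) (use r in \<open>auto simp: radq_def\<close>)
  then have "((\<lambda>s. radq S S' s ^ k) has_real_derivative real k * radq S S' r ^ (k - 1) * ((S' r - radq S S' r) / r)) (at r)"
    by (auto intro!: derivative_eq_intros)
  moreover have "((\<lambda>z. norm (fst z)) has_derivative (\<lambda>v. fst v \<bullet> sgn (fst z))) (at z)"
    by (rule has_derivative_compose[OF has_derivative_fst[OF has_derivative_ident] has_derivative_norm[OF assms]])
  ultimately show ?thesis unfolding r_def by (rule DERIV_compose_FDERIV)
qed

text \<open>Only the Euler identity off the axis has to be transported. For a test function \<kappa>
  it follows from the old identity tested with \<open>radq\<close>^N times the pullback of \<kappa>:
  both integrands then equal the new ones, pulled back and multiplied by the Jacobian.\<close>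

theorem gradmap_weak_gradient:
  fixes w :: "(real ^ 'n) \<times> real \<Rightarrow> real"
  assumes wG: "radial_weak_gradient w G"
    and bdd: "\<And>r a b. 0 < a \<Longrightarrow> \<exists>B. AE z in lebesgue. z \<in> cyl r a b \<longrightarrow> \<bar>w z\<bar> \<le> B"
    and N2: "2 \<le> CARD('n)"
  shows "radial_weak_gradient (\<lambda>z. w (radmapT R R' z)) (gradmap G)"
proof (rule weak_gradient_from_euler)
  interpret radial_weak_gradient w G by (rule wG)
  interpret J: jacobian "radmapT S S' :: (real ^ 'n) \<times> real \<Rightarrow> _" "\<lambda>z. radjac S S' (fst z)" by (rule jacT)
  show wl': "L1loc (\<lambda>z. w (radmapT R R' z))" by (rule L1loc_comp[OF wl])
  show Gl': "L1loc (gradmap G)" by (rule L1loc_gradmap[OF Gl])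
  show "radial (\<lambda>z. w (radmapT R R' z))"
    unfolding radial_def
  proof (intro allI impI)
    fix x y :: "real ^ 'n" and t assume "norm x = norm y"
    then have "norm (radmap R R' x) = norm (radmap R R' y)" by (simp add: inv.norm_radmap)
    then show "w (radmapT R R' (x, t)) = w (radmapT R R' (y, t))"
      using rad unfolding radial_def radmapT_def fst_conv snd_conv by blast
  qed
  show "AE z in lebesgue. z \<in> S_inf \<longrightarrow> (\<forall>i j. fst z $ i * gradmap G z $ j = fst z $ j * gradmap G z $ i)"
    using AE_radmapT[OF parallel]
  proof eventually_elim
    case (elim z)
    show ?case
    proof (intro impI allI)
      fix i j assume "z \<in> S_inf"
      then have "radq R R' (norm (fst z)) * fst z $ i * G (radmapT R R' z) $ j = radq R R' (norm (fst z)) * fst z $ j * G (radmapT R R' z) $ i"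
      proof -
        have e: "fst (radmapT R R' z) $ i = radq R R' (norm (fst z)) * fst z $ i" for i
          by (simp add: radmapT_def radmap_def)
        have "fst (radmapT R R' z) $ i * G (radmapT R R' z) $ j = fst (radmapT R R' z) $ j * G (radmapT R R' z) $ i"
          using elim \<open>z \<in> S_inf\<close> radial_diffeo.radmapT_S_inf[OF inverse] by blast
        then show ?thesis unfolding e .
      qed
      then have "radq R R' (norm (fst z)) * (fst z $ i * G (radmapT R R' z) $ j) = radq R R' (norm (fst z)) * (fst z $ j * G (radmapT R R' z) $ i)"
        by (simp only: mult.assoc)
      then have "fst z $ i * G (radmapT R R' z) $ j = fst z $ j * G (radmapT R R' z) $ i"
        using inv.radq_pos[of "norm (fst z)"] by (simp only: mult_left_cancel[OF less_imp_neq[symmetric]] norm_ge_zero)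
      then show "fst z $ i * gradmap G z $ j = fst z $ j * gradmap G z $ i"
        by (simp add: gradmap_def mult.left_commute)
    qed
  qed
  show "\<exists>B. AE z in lebesgue. z \<in> cyl r a b \<longrightarrow> \<bar>w (radmapT R R' z)\<bar> \<le> B" if a: "0 < a" for r a b
  proof -
    obtain B where B: "AE z in lebesgue. z \<in> cyl (R (max r 0)) a b \<longrightarrow> \<bar>w z\<bar> \<le> B" using bdd[OF a] by blast
    have "AE z in lebesgue. z \<in> cyl r a b \<longrightarrow> \<bar>w (radmapT R R' z)\<bar> \<le> B"
      using AE_radmapT[OF B]
    proof eventually_elim
      case (elim z)
      show ?case
      proof
        assume "z \<in> cyl r a b"
        then have "radmapT R R' z \<in> cyl (R (max r 0)) a b"
          using radmapT_cyl[of "radmapT R R' z" r a b] by (simp add: radmapT_inverse)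
        then show "\<bar>w (radmapT R R' z)\<bar> \<le> B" using elim by blast
      qed
    qed
    then show ?thesis by blast
  qed
  show "2 \<le> CARD('n)" by (rule N2)
  fix \<kappa> :: "(real ^ 'n) \<times> real \<Rightarrow> real" and \<kappa>'
  assume \<kappa>: "C1c \<kappa> \<kappa>'" and off: "off_axis \<kappa>"
  obtain e where e: "0 < e" "\<And>z. norm (fst z) < e \<Longrightarrow> \<kappa> z = 0" using off by (auto simp: off_axis_def)
  define n where "n = CARD('n)"
  define \<psi>0 where "\<psi>0 z = \<kappa> (radmapT S S' z)" for z
  define \<psi>0' where "\<psi>0' z v = \<kappa>' (radmapT S S' z) (radD S S' (fst z) (fst v), snd v)" for z v
  have \<psi>0: "C1c \<psi>0 \<psi>0'" unfolding \<psi>0_def[abs_def] \<psi>0'_def[abs_def] by (rule C1c_comp[OF \<kappa>])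
  have off0: "\<psi>0 z = 0" if "norm (fst z) < R e" for z
  proof -
    have "S (norm (fst z)) < e" using that less_iff[of "norm (fst z)" "R e"] R_nonneg[of e] SR[of e] e(1) by simp
    then show ?thesis using e(2) by (simp add: \<psi>0_def radmapT_def norm_radmap)
  qed
  have Re: "0 < R e" using inv.pos e(1) by blast
  have off0': "off_axis \<psi>0" unfolding off_axis_def using off0 Re by blast
  \<comment> \<open>The factor matches J times R' times the stretch of x. It is only continuous on
    the axis, since \<open>S\<close> has just one derivative at 0, which is why \<kappa> must vanish
    near the axis. Differentiating it along x produces N q^(n-1) (s - q), which turns N q^n into N
    times the Jacobian.\<close>
  define h where "h z = radq S S' (norm (fst z)) ^ n" for z :: "(real ^ 'n) \<times> real"
  define h' where "h' z v = (fst v \<bullet> sgn (fst z)) * (real n * radq S S' (norm (fst z)) ^ (n - 1) * ((S' (norm (fst z)) - radq S S' (norm (fst z))) / norm (fst z)))"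
    for z v :: "(real ^ 'n) \<times> real"
  have hd: "(h has_derivative h' z) (at z)" if "fst z \<noteq> 0" for z
    unfolding h_def[abs_def] h'_def[abs_def] by (rule radq_power_derivative[OF that])
  have hc: "continuous_on {z. fst z \<noteq> 0} (\<lambda>z. h' z v)" for v
  proof -
    have "continuous_on UNIV (\<lambda>z :: (real ^ 'n) \<times> real. S' (norm (fst z)))"
      by (rule continuous_on_compose2[OF continuous_on_deriv_norm]) (auto intro: continuous_intros)
    then have 1: "continuous_on {z :: (real ^ 'n) \<times> real. fst z \<noteq> 0} (\<lambda>z. S' (norm (fst z)))" by (rule continuous_on_subset) simp
    have "continuous_on UNIV (\<lambda>z :: (real ^ 'n) \<times> real. radq S S' (norm (fst z)))"
      by (rule continuous_on_compose2[OF continuous_on_radq_norm]) (auto intro: continuous_intros)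
    then have 2: "continuous_on {z :: (real ^ 'n) \<times> real. fst z \<noteq> 0} (\<lambda>z. radq S S' (norm (fst z)))" by (rule continuous_on_subset) simp
    have 3: "continuous_on {z :: (real ^ 'n) \<times> real. fst z \<noteq> 0} (\<lambda>z. sgn (fst z))"
      unfolding sgn_div_norm by (intro continuous_intros) auto
    show ?thesis unfolding h'_def by (intro continuous_intros 1 2 3) auto
  qed
  note \<psi> = C1c_mult_off_axis[OF \<psi>0 off0' hd hc]
  define \<psi>' where "\<psi>' z v = h z * \<psi>0' z v + h' z v * \<psi>0 z" for z v
  have \<psi>C: "C1c (\<lambda>z. h z * \<psi>0 z) \<psi>'" using \<psi>(1) by (simp add: \<psi>'_def[abs_def])
  have E: "(LINT z|lebesgue. h z * \<psi>0 z * (fst z \<bullet> G z)) + (LINT z|lebesgue. (real n * (h z * \<psi>0 z) + \<psi>' z (fst z, 0)) * w z) = 0"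
    using euler[OF \<psi>C] by (simp add: n_def)
  have Jn: "radjac S S' (fst z) = radq S S' (norm (fst z)) ^ (n - 1) * S' (norm (fst z))" for z :: "(real ^ 'n) \<times> real"
    by (simp add: radjac_def n_def)
  have n0: "0 < n" by (simp add: n_def)
  have hJ: "h z = radq S S' (norm (fst z)) ^ (n - 1) * radq S S' (norm (fst z))" for z
    using n0 by (simp add: h_def flip: power_Suc2)
  have 1: "h z * \<psi>0 z * (fst z \<bullet> G z) = radjac S S' (fst z) *\<^sub>R (\<kappa> (radmapT S S' z) * (fst (radmapT S S' z) \<bullet> gradmap G (radmapT S S' z)))" for z
  proof -
    have "R' (S (norm (fst z))) * S' (norm (fst z)) = 1"
      using R'_S'[of "S (norm (fst z))"] nonneg[of "norm (fst z)"] by (simp add: RS)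
    then have hz: "h z = radjac S S' (fst z) * (radq S S' (norm (fst z)) * R' (S (norm (fst z))))"
      unfolding Jn hJ by (simp add: mult_ac)
    have e3: "fst (radmapT S S' z) \<bullet> gradmap G (radmapT S S' z) = radq S S' (norm (fst z)) * (R' (S (norm (fst z))) * (fst z \<bullet> G z))"
    proof -
      have e1: "fst (radmapT S S' z) = radq S S' (norm (fst z)) *\<^sub>R fst z" by (simp add: radmapT_def radmap_def)
      have e2: "norm (fst (radmapT S S' z)) = S (norm (fst z))" by (simp add: radmapT_def norm_radmap)
      show ?thesis unfolding gradmap_def radmapT_inverse e2 unfolding e1 by simp
    qed
    show ?thesis unfolding \<psi>0_def hz e3 by simp
  qed
  have 2: "(real n * (h z * \<psi>0 z) + \<psi>' z (fst z, 0)) * w z =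
      radjac S S' (fst z) *\<^sub>R ((real n * \<kappa> (radmapT S S' z) + \<kappa>' (radmapT S S' z) (fst (radmapT S S' z), 0)) * w (radmapT R R' (radmapT S S' z)))" for z
  proof (cases "norm (fst z) < R e")
    case True
    then have "S (norm (fst z)) < e" using less_iff[of "norm (fst z)" "R e"] R_nonneg[of e] SR[of e] e(1) by simp
    then have "norm (fst (radmapT S S' z)) < e" by (simp add: radmapT_def norm_radmap)
    then have k0: "\<kappa> (radmapT S S' z) = 0" "\<kappa>' (radmapT S S' z) v = 0" for v
      using e(2) off_axis_derivative[OF \<kappa> e] by blast+
    then show ?thesis by (simp add: \<psi>'_def \<psi>0_def \<psi>0'_def)
  next
    case False
    then have r: "0 < norm (fst z)" using Re by linarith
    define q where "q = radq S S' (norm (fst z))"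
    define s where "s = S' (norm (fst z))"
    have "radD S S' (fst z) (fst z) = s *\<^sub>R fst z" using radD_self[of S S' "fst z" 1] by (simp add: s_def)
    moreover have "fst (radmapT S S' z) = q *\<^sub>R fst z" by (simp add: radmapT_def radmap_def q_def)
    ultimately have a: "\<psi>0' z (fst z, 0) = s * \<kappa>' (radmapT S S' z) (fst z, 0)"
      "\<kappa>' (radmapT S S' z) (fst (radmapT S S' z), 0) = q * \<kappa>' (radmapT S S' z) (fst z, 0)"
      unfolding \<psi>0'_def by (simp_all add: linear_C1c_scale[OF \<kappa>])
    have "fst z \<bullet> sgn (fst z) = norm (fst z)"
      using r by (simp add: sgn_div_norm dot_square_norm power2_eq_square)
    then have b: "h' z (fst z, 0) = real n * q ^ (n - 1) * (s - q)"
      using r by (simp add: h'_def q_def s_def)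
    show ?thesis
      unfolding \<psi>'_def a b hJ Jn \<psi>0_def radmapT_inverse q_def[symmetric] s_def[symmetric] real_scaleR_def
      by (simp add: algebra_simps)
  qed
  have F1: "(\<lambda>z. \<kappa> z * (fst z \<bullet> gradmap G z)) \<in> borel_measurable lebesgue"
  proof -
    have "(\<lambda>z. \<Sum>j\<in>UNIV. fst z $ j * \<kappa> z * gradmap G z $ j) \<in> borel_measurable lebesgue"
      by (rule borel_measurable_sum, rule borel_measurable_integrable,
          rule integrable_C0c_real[OF L1loc_nth[OF Gl'] C0c_coord[OF C1cD(1)[OF \<kappa>]]])
    then show ?thesis by (simp add: inner_vec_def sum_distrib_left mult_ac)
  qed
  have F2: "(\<lambda>z. (real n * \<kappa> z + \<kappa>' z (fst z, 0)) * w (radmapT R R' z)) \<in> borel_measurable lebesgue"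
    by (rule borel_measurable_integrable, rule integrable_C0c_real[OF wl' C0c_euler[OF \<kappa>]])
  show "(LINT z|lebesgue. \<kappa> z * (fst z \<bullet> gradmap G z)) +
      (LINT z|lebesgue. (real CARD('n) * \<kappa> z + \<kappa>' z (fst z, 0)) * w (radmapT R R' z)) = 0"
    using E unfolding 1 2 J.integral_comp[OF F1] J.integral_comp[OF F2] by (simp add: n_def)
qed

end

section \<open>Transport of the solution class and of the weak formulation\<close>

lemma weighted_integral:
  fixes a h :: "real ^ 'n \<Rightarrow> real"
  assumes a: "continuous_on UNIV a" "\<And>x. 0 \<le> a x" and h: "h \<in> borel_measurable lebesgue"
  shows "integrable (weighted a) h \<longleftrightarrow> integrable lebesgue (\<lambda>x. a x * h x)"
    "(LINT x|weighted a. h x) = (LINT x|lebesgue. a x * h x)"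
proof -
  have "a \<in> borel_measurable lebesgue"
    using borel_measurable_continuous_onI[OF a(1)] by (simp add: measurable_completion)
  then show "integrable (weighted a) h \<longleftrightarrow> integrable lebesgue (\<lambda>x. a x * h x)"
    "(LINT x|weighted a. h x) = (LINT x|lebesgue. a x * h x)"
    unfolding weighted_def using integrable_density[OF h, of a] integral_density[OF h, of a] a(2) by simp_all
qed

lemma weighted_measurable: "integrable (weighted a) h \<Longrightarrow> h \<in> borel_measurable lebesgue"
  using borel_measurable_integrable[of "weighted a" h] by (simp add: weighted_def)

lemma AE_cyl_bound:
  fixes u :: "real ^ 'n \<Rightarrow> real \<Rightarrow> real"
  assumes "Linf_away u" "0 < a"
  shows "\<exists>B. AE z in lebesgue. z \<in> cyl r a b \<longrightarrow> \<bar>u (fst z) (snd z)\<bar> \<le> B"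
proof -
  have o: "UNIV \<times> {a / 2<..} \<in> sets (lebesgue :: ((real ^ 'n) \<times> real) measure)"
    by (intro sets_completionI_sets) (simp add: borel_open open_Times)
  obtain C where "AE z in lebesgue_on (UNIV \<times> {a / 2<..}). \<bar>(\<lambda>(x, t). u x t) z\<bar> \<le> C"
    using assms half_gt_zero unfolding Linf_away_def by blast
  then have "AE z in lebesgue. z \<in> UNIV \<times> {a / 2<..} \<longrightarrow> \<bar>(\<lambda>(x, t). u x t) z\<bar> \<le> C"
    by (simp add: AE_lebesgue_on_iff[OF o])
  then have "AE z in lebesgue. z \<in> cyl r a b \<longrightarrow> \<bar>u (fst z) (snd z)\<bar> \<le> C"
    by eventually_elim (use assms(2) in \<open>auto simp: cyl_def case_prod_beta'\<close>)
  then show ?thesis by blast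
qed

text \<open>\<open>powr\<close> depends on its base only through the absolute value, so a bound on
  |u| carries over to \<open>u powr sig p m\<close>.\<close>

lemma powr_bound_abs:
  fixes y :: real
  assumes "\<bar>y\<bar> \<le> B" "0 < s" shows "\<bar>y powr s\<bar> \<le> B powr s"
proof -
  have "y powr s = \<bar>y\<bar> powr s" using uminus_powr_eq[of y s] by (cases "0 \<le> y") auto
  then show ?thesis using powr_mono2[of s "\<bar>y\<bar>" B] assms by simp
qed

text \<open>This is the field of the weak formulation; its local integrability is what permits C^1
  test functions there.\<close>

lemma in_class_L1loc:
  fixes u :: "real ^ 'n \<Rightarrow> real \<Rightarrow> real"
  assumes p: "1 < p" "0 < sig p m" and c: "in_class p m a0 u G"
    and a: "continuous_on UNIV a" and b: "continuous_on UNIV b"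
  shows "L1loc (\<lambda>z. (b (fst z) *\<^sub>R flux p m (u (fst z) (snd z)) (G z), - (a (fst z) * u (fst z) (snd z))))"
proof -
  have L: "Linf_away u" and G: "Lp_loc p G" and G1: "L1loc G"
    using c by (auto simp: in_class_def weak_space_grad_iff)
  have um: "(\<lambda>z. u (fst z) (snd z)) \<in> borel_measurable (lebesgue_on S_inf)"
    using L by (simp add: Linf_away_def case_prod_beta')
  have Gm: "G \<in> borel_measurable (lebesgue_on S_inf)" using G by (simp add: Lp_loc_iff)
  have ul: "L1loc (\<lambda>z. u (fst z) (snd z))"
  proof (rule L1loc_bound[OF um L1loc_const])
    fix r t s :: real assume "0 < t"
    then show "\<exists>B. AE z in lebesgue. z \<in> cyl r t s \<longrightarrow> norm (u (fst z) (snd z)) \<le> B * norm (1 :: real)"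
      using AE_cyl_bound[OF L] by simp
  qed
  have fl: "L1loc (\<lambda>z. flux p m (u (fst z) (snd z)) (G z))"
  proof (rule L1loc_bound)
    show "(\<lambda>z. flux p m (u (fst z) (snd z)) (G z)) \<in> borel_measurable (lebesgue_on S_inf)"
    proof -
      note [measurable] = um Gm
      show ?thesis unfolding flux_def Du_def by measurable
    qed
    show "L1loc (\<lambda>z. 1 + norm (G z) powr p)"
      using G by (intro L1loc_add L1loc_const) (simp add: Lp_loc_iff)
    show "\<exists>B. AE z in lebesgue. z \<in> cyl r t s \<longrightarrow> norm (flux p m (u (fst z) (snd z)) (G z)) \<le> B * norm (1 + norm (G z) powr p)" for r t s
    proof (rule exI[of _ "sig p m powr (1 - p)"], rule AE_I2, rule impI)
      fix z
      have "norm (1 + norm (G z) powr p) = 1 + norm (G z) powr p" by (simp add: add_nonneg_nonneg)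
      then show "norm (flux p m (u (fst z) (snd z)) (G z)) \<le> sig p m powr (1 - p) * norm (1 + norm (G z) powr p)"
        using norm_flux_le[OF p] by metis
    qed
  qed
  have c1: "continuous_on UNIV (\<lambda>z :: (real ^ 'n) \<times> real. b (fst z))" "continuous_on UNIV (\<lambda>z :: (real ^ 'n) \<times> real. - a (fst z))"
    by (intro continuous_intros continuous_on_compose2[OF b] continuous_on_compose2[OF a]; simp)+
  have "L1loc (\<lambda>z. (- a (fst z)) *\<^sub>R u (fst z) (snd z))" by (rule L1loc_scale_continuous[OF ul c1(2)])
  then have "L1loc (\<lambda>z. - (a (fst z) * u (fst z) (snd z)))" by simp
  then show ?thesis by (intro L1loc_Pair L1loc_scale_continuous[OF fl c1(1)])
qed

lemma wint_neg: "wint (\<lambda>_. 0) (\<lambda>z. - V z) \<eta> \<eta>' = - wint (\<lambda>_. 0) V \<eta> \<eta>'" if "C1c \<eta> \<eta>'"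
  unfolding wint_def using linear_neg[OF C1cD(5)[OF that]] by simp

context radial_diffeo
begin

interpretation inv: radial_diffeo R R' by (rule inverse)

text \<open>\<open>A\<close> matches the time terms. In \<open>B\<close> the power p collects p - 1
  factors S' from the homogeneous flux and one from the derivative of the test function. The
  coefficients are left general so that the results apply to \<open>S\<close> and, with the
  equations exchanged, to its inverse.\<close>

context
  fixes p m :: real and a1 b1 a2 b2 :: "real ^ 'n \<Rightarrow> real" and U :: "real \<Rightarrow> real \<Rightarrow> real"
  assumes p: "1 < p" "0 < sig p m" and N2: "2 \<le> CARD('n)"
    and c1: "continuous_on UNIV a1" "continuous_on UNIV b1" and c2: "continuous_on UNIV a2" "continuous_on UNIV b2"
    and a1: "\<And>x. 0 \<le> a1 x" and a2: "\<And>x. 0 \<le> a2 x"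
    and A: "\<And>x. a1 x = radjac S S' x * a2 (radmap S S' x)"
    and B: "\<And>x. S' (norm x) powr p * b1 x = radjac S S' x * b2 (radmap S S' x)"
begin

abbreviation (input) "u1 \<equiv> (\<lambda>(x :: real ^ 'n) t. U (norm x) t)"
abbreviation (input) "u2 \<equiv> (\<lambda>(x :: real ^ 'n) t. U (R (norm x)) t)"

text \<open>\<open>A\<close> says precisely that the radial map carries the measure with density
  \<open>a1\<close> to the one with density \<open>a2\<close>.\<close>

lemma weighted_comp:
  fixes h :: "real ^ 'n \<Rightarrow> real"
  assumes h: "h \<in> borel_measurable lebesgue"
  shows "integrable (weighted a1) h \<longleftrightarrow> integrable (weighted a2) (\<lambda>y. h (radmap R R' y))"
    "(LINT x|weighted a1. h x) = (LINT y|weighted a2. h (radmap R R' y))"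
proof -
  interpret J: jacobian "radmap S S' :: real ^ 'n \<Rightarrow> _" "radjac S S'" by (rule jacobian_radmap)
  interpret JR: jacobian "radmap R R' :: real ^ 'n \<Rightarrow> _" "radjac R R'" by (rule inv.jacobian_radmap)
  have hm: "(\<lambda>y. h (radmap R R' y)) \<in> borel_measurable lebesgue" by (rule JR.measurable_comp[OF h])
  have Fm: "(\<lambda>y. a2 y * h (radmap R R' y)) \<in> borel_measurable lebesgue"
    using borel_measurable_continuous_onI[OF c2(1)] hm by (intro borel_measurable_times) (simp_all add: measurable_completion)
  have e: "a1 x * h x = radjac S S' x *\<^sub>R (a2 (radmap S S' x) * h (radmap R R' (radmap S S' x)))" for x
    by (simp add: A[of x] radmap_R)
  show "integrable (weighted a1) h \<longleftrightarrow> integrable (weighted a2) (\<lambda>y. h (radmap R R' y))"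
    unfolding weighted_integral(1)[OF c1(1) a1 h] weighted_integral(1)[OF c2(1) a2 hm] e by (rule J.integrable_comp_iff[OF Fm])
  show "(LINT x|weighted a1. h x) = (LINT y|weighted a2. h (radmap R R' y))"
    unfolding weighted_integral(2)[OF c1(1) a1 h] weighted_integral(2)[OF c2(1) a2 hm] e by (rule J.integral_comp[OF Fm])
qed

lemma C_L1_comp: "C_L1 a1 u1 \<Longrightarrow> C_L1 a2 u2"
proof -
  assume C: "C_L1 a1 u1"
  have i: "integrable (weighted a1) (\<lambda>x. u1 x t)" if "0 \<le> t" for t using C that by (simp add: C_L1_def)
  note m = weighted_measurable[OF i]
  have "integrable (weighted a2) (\<lambda>x. u2 x t)" if "0 \<le> t" for t
    using weighted_comp(1)[OF m[OF that]] i[OF that] by (simp add: inv.norm_radmap)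
  moreover have "((\<lambda>t. LINT x|weighted a2. \<bar>u2 x t - u2 x t0\<bar>) \<longlongrightarrow> 0) (at t0 within {0..})" if t0: "0 \<le> t0" for t0
  proof (rule Lim_transform_eventually)
    show "((\<lambda>t. LINT x|weighted a1. \<bar>u1 x t - u1 x t0\<bar>) \<longlongrightarrow> 0) (at t0 within {0..})"
      using C t0 by (simp add: C_L1_def)
    show "\<forall>\<^sub>F t in at t0 within {0..}. (LINT x|weighted a1. \<bar>u1 x t - u1 x t0\<bar>) = (LINT x|weighted a2. \<bar>u2 x t - u2 x t0\<bar>)"
      unfolding eventually_at_filter
    proof (rule always_eventually, intro allI impI)
      fix t :: real assume "t \<in> {0..}"
      then have "(\<lambda>x. \<bar>u1 x t - u1 x t0\<bar>) \<in> borel_measurable lebesgue"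
        using m[of t] m[OF t0] by (intro borel_measurable_abs borel_measurable_diff) simp_all
      from weighted_comp(2)[OF this] show "(LINT x|weighted a1. \<bar>u1 x t - u1 x t0\<bar>) = (LINT x|weighted a2. \<bar>u2 x t - u2 x t0\<bar>)"
        by (simp add: inv.norm_radmap)
    qed
  qed
  ultimately show "C_L1 a2 u2" by (simp add: C_L1_def)
qed

lemma u2T: "u2 (fst z) (snd z) = u1 (fst (radmapT R R' z)) (snd (radmapT R R' z))"
  by (simp add: radmapT_def inv.norm_radmap)

lemma Linf_away_comp: "Linf_away u1 \<Longrightarrow> Linf_away u2"
proof -
  assume L: "Linf_away u1"
  have um: "(\<lambda>z. u1 (fst z) (snd z)) \<in> borel_measurable (lebesgue_on S_inf)"
    using L by (simp add: Linf_away_def case_prod_beta')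
  have "(\<lambda>z. u2 (fst z) (snd z)) \<in> borel_measurable (lebesgue_on S_inf)"
    unfolding u2T by (rule measurable_S_inf_comp[OF um])
  moreover have "\<exists>C. AE z in lebesgue_on (UNIV \<times> {t<..}). \<bar>(\<lambda>(x, t). u2 x t) z\<bar> \<le> C" if t: "0 < t" for t
  proof -
    have o: "UNIV \<times> {t<..} \<in> sets (lebesgue :: ((real ^ 'n) \<times> real) measure)"
      by (intro sets_completionI_sets) (simp add: borel_open open_Times)
    obtain C where "AE z in lebesgue_on (UNIV \<times> {t<..}). \<bar>(\<lambda>(x, t). u1 x t) z\<bar> \<le> C"
      using L t unfolding Linf_away_def by blast
    then have "AE z in lebesgue. z \<in> UNIV \<times> {t<..} \<longrightarrow> \<bar>u1 (fst z) (snd z)\<bar> \<le> C"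
      by (simp add: AE_lebesgue_on_iff[OF o] case_prod_beta')
    then have "AE z in lebesgue. radmapT R R' z \<in> UNIV \<times> {t<..} \<longrightarrow> \<bar>u1 (fst (radmapT R R' z)) (snd (radmapT R R' z))\<bar> \<le> C"
      by (rule AE_radmapT)
    then have "AE z in lebesgue. z \<in> UNIV \<times> {t<..} \<longrightarrow> \<bar>u2 (fst z) (snd z)\<bar> \<le> C"
      by eventually_elim (auto simp: u2T[symmetric] radmapT_def inv.norm_radmap)
    then have "AE z in lebesgue_on (UNIV \<times> {t<..}). \<bar>(\<lambda>(x, t). u2 x t) z\<bar> \<le> C"
      by (simp add: AE_lebesgue_on_iff[OF o] case_prod_beta')
    then show ?thesis by blast
  qed
  ultimately show "Linf_away u2" by (simp add: Linf_away_def case_prod_beta')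
qed

lemma in_class_radial_weak_gradient:
  assumes "in_class p m a1 u1 G"
  shows "radial_weak_gradient (\<lambda>z. u1 (fst z) (snd z) powr sig p m) G"
proof
  have "weak_space_grad (\<lambda>z. u1 (fst z) (snd z) powr sig p m) G"
    using assms by (simp add: in_class_def case_prod_beta')
  then show "L1loc (\<lambda>z. u1 (fst z) (snd z) powr sig p m)" "L1loc G"
    "\<And>\<phi> \<phi>' i. C1c \<phi> \<phi>' \<Longrightarrow> (LINT z|lebesgue. \<phi> z * G z $ i) + (LINT z|lebesgue. \<phi>' z (axis i 1, 0) * u1 (fst z) (snd z) powr sig p m) = 0"
    unfolding weak_space_grad_iff by blast+
  show "radial (\<lambda>z. u1 (fst z) (snd z) powr sig p m)" by (simp add: radial_def)
qed

lemma in_class_comp: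
  assumes c: "in_class p m a1 u1 G"
  shows "in_class p m a2 u2 (gradmap G)"
proof -
  note rw = in_class_radial_weak_gradient[OF c]
  have L: "Linf_away u1" and Gp: "Lp_loc p G" and C: "C_L1 a1 u1" and nn: "\<And>t. 0 \<le> t \<Longrightarrow> AE x in lebesgue. 0 \<le> u1 x t"
    using c by (auto simp: in_class_def)
  have "AE x in lebesgue. 0 \<le> u2 x t" if "0 \<le> t" for t
    using jacobian.AE_comp[OF inv.jacobian_radmap nn[OF that]] by (simp add: inv.norm_radmap)
  moreover have "Lp_loc p (gradmap G)"
  proof -
    have "L1loc (\<lambda>z. norm (G z) powr p)" using Gp by (simp add: Lp_loc_iff)
    from L1loc_comp[OF this] have "L1loc (\<lambda>z. R' (norm (fst z)) powr p *\<^sub>R (norm (G (radmapT R R' z)) powr p))"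
    proof (rule L1loc_scale_continuous)
      show "continuous_on UNIV (\<lambda>z :: (real ^ 'n) \<times> real. R' (norm (fst z)) powr p)"
        using inv.pos' by (intro continuous_intros continuous_on_R'_norm) (simp add: less_imp_neq[symmetric])
    qed
    then have "L1loc (\<lambda>z. norm (gradmap G z) powr p)"
      using inv.pos' by (simp add: gradmap_def powr_mult less_imp_le)
    moreover have "gradmap G \<in> borel_measurable (lebesgue_on S_inf)"
      using L1loc_measurable[OF L1loc_gradmap[OF radial_weak_gradient.Gl[OF rw]]] .
    ultimately show ?thesis by (simp add: Lp_loc_iff)
  qed
  moreover have "weak_space_grad (\<lambda>(x, t). u2 x t powr sig p m) (gradmap G)"
  proof -
    have "radial_weak_gradient (\<lambda>z. u1 (fst (radmapT R R' z)) (snd (radmapT R R' z)) powr sig p m) (gradmap G)"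
    proof (rule gradmap_weak_gradient[OF rw _ N2])
      fix r a b :: real assume "0 < a"
      then obtain B where "AE z in lebesgue. z \<in> cyl r a b \<longrightarrow> \<bar>u1 (fst z) (snd z)\<bar> \<le> B" using AE_cyl_bound[OF L] by blast
      then have "AE z in lebesgue. z \<in> cyl r a b \<longrightarrow> \<bar>u1 (fst z) (snd z) powr sig p m\<bar> \<le> B powr sig p m"
        by eventually_elim (use powr_bound_abs[OF _ p(2)] in blast)
      then show "\<exists>B. AE z in lebesgue. z \<in> cyl r a b \<longrightarrow> \<bar>u1 (fst z) (snd z) powr sig p m\<bar> \<le> B" by blast
    qed
    then have "radial_weak_gradient (\<lambda>z. u2 (fst z) (snd z) powr sig p m) (gradmap G)"
      by (simp only: u2T)
    then interpret rg: radial_weak_gradient "\<lambda>z. u2 (fst z) (snd z) powr sig p m" "gradmap G" .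
    show ?thesis
      unfolding weak_space_grad_iff case_prod_beta' using rg.wl rg.Gl rg.weak by blast
  qed
  ultimately show ?thesis
    unfolding in_class_def using C_L1_comp[OF C] Linf_away_comp[OF L] by blast
qed

abbreviation (input) "V1 G \<equiv> (\<lambda>z. (b1 (fst z) *\<^sub>R flux p m (u1 (fst z) (snd z)) (G z), - (a1 (fst z) * u1 (fst z) (snd z))))"

text \<open>After the change of variables the integrands agree almost everywhere: the flux is
  parallel to x, hence an eigenvector of \<open>radD\<close> with eigenvalue S', and
  \<open>B\<close> accounts for the remaining powers. The pulled-back test function is only
  C^1.\<close>

lemma weak_form_comp:
  assumes c: "in_class p m a1 u1 G" and t: "test_fun \<eta>"
  shows "weak_form p m a2 b2 u2 (gradmap G) \<eta> = wint (\<lambda>_. 0) (V1 G) (\<lambda>z. \<eta> (radmapT S S' z))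
    (\<lambda>z v. frechet_derivative \<eta> (at (radmapT S S' z)) (radD S S' (fst z) (fst v), snd v))"
proof -
  interpret J: jacobian "radmapT S S' :: (real ^ 'n) \<times> real \<Rightarrow> _" "\<lambda>z. radjac S S' (fst z)" by (rule jacT)
  note \<eta> = test_fun_C1c[OF t]
  define \<eta>' where "\<eta>' z = frechet_derivative \<eta> (at z)" for z
  have \<eta>c: "C1c \<eta> \<eta>'" using \<eta> by (simp add: \<eta>'_def[abs_def])
  note l = C1cD(5)[OF \<eta>c]
  define V2 where "V2 z = (b2 (fst z) *\<^sub>R flux p m (u2 (fst z) (snd z)) (gradmap G z), - (a2 (fst z) * u2 (fst z) (snd z)))" for z
  have V2: "L1loc V2"
    unfolding V2_def by (rule in_class_L1loc[OF p in_class_comp[OF c] c2])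
  have V1: "L1loc (V1 G)" by (rule in_class_L1loc[OF p c c1])
  have i2: "integrable lebesgue (\<lambda>z. \<eta>' z (V2 z))" by (rule integrable_C1c[OF \<eta>c V2])
  note \<eta>\<Psi> = C1c_comp[OF \<eta>c]
  have i1: "integrable lebesgue (\<lambda>z. \<eta>' (radmapT S S' z) (radD S S' (fst z) (fst (V1 G z)), snd (V1 G z)))"
    by (rule integrable_C1c[OF \<eta>\<Psi> V1])
  have "weak_form p m a2 b2 u2 (gradmap G) \<eta> = (LINT z|lebesgue. \<eta>' z (V2 z))"
    unfolding weak_form_eq_wint[OF t] wint_def V2_def \<eta>'_def by simp
  also have "\<dots> = (LINT z|lebesgue. radjac S S' (fst z) *\<^sub>R \<eta>' (radmapT S S' z) (V2 (radmapT S S' z)))"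
    by (rule J.integral_comp[OF borel_measurable_integrable[OF i2], symmetric])
  also have "\<dots> = (LINT z|lebesgue. \<eta>' (radmapT S S' z) (radD S S' (fst z) (fst (V1 G z)), snd (V1 G z)))"
  proof (rule integral_cong_AE)
    show "(\<lambda>z. radjac S S' (fst z) *\<^sub>R \<eta>' (radmapT S S' z) (V2 (radmapT S S' z))) \<in> borel_measurable lebesgue"
      using J.integrable_comp_iff[OF borel_measurable_integrable[OF i2]] i2 by (intro borel_measurable_integrable) simp
    show "(\<lambda>z. \<eta>' (radmapT S S' z) (radD S S' (fst z) (fst (V1 G z)), snd (V1 G z))) \<in> borel_measurable lebesgue"
      using i1 by (rule borel_measurable_integrable)
    show "AE z in lebesgue. radjac S S' (fst z) *\<^sub>R \<eta>' (radmapT S S' z) (V2 (radmapT S S' z)) =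
        \<eta>' (radmapT S S' z) (radD S S' (fst z) (fst (V1 G z)), snd (V1 G z))"
      using radial_weak_gradient.parallel[OF in_class_radial_weak_gradient[OF c]] AE_off_axis
    proof eventually_elim
      case (elim z)
      show ?case
      proof (cases "z \<in> S_inf")
        case False
        then have "\<eta>' (radmapT S S' z) v = 0" for v
          using C1c_zero_outside(2)[OF \<eta>c] radmapT_S_inf by blast
        then show ?thesis by simp
      next
        case True
        define x where "x = fst z"
        define y where "y = u1 (fst z) (snd z)"
        define r where "r = norm x"
        define k where "k = S' r"
        have k: "0 < k" by (simp add: k_def r_def pos')
        define F where "F = flux p m y (G z)"
        have "G z = ((x \<bullet> G z) / (x \<bullet> x)) *\<^sub>R x"
          using elim True unfolding x_def by (intro parallel_eq_scaleR) auto
        moreover obtain d where "F = d *\<^sub>R G z" unfolding F_def flux_eq[OF p] by (metis scaleR_zero_left)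
        ultimately obtain d' where d': "F = d' *\<^sub>R x" by (metis scaleR_scaleR)
        have D: "radD S S' x (b1 x *\<^sub>R F) = (k * b1 x) *\<^sub>R F"
          unfolding d' using radD_self[of S S' x "b1 x * d'"] by (simp add: k_def r_def mult_ac)
        have kR: "R' (S r) = inverse k"
          unfolding R'_def k_def by (simp add: RS r_def)
        have nr: "norm (radmap S S' x) = S r" by (simp add: norm_radmap r_def)
        have "flux p m (u2 (fst (radmapT S S' z)) (snd (radmapT S S' z))) (gradmap G (radmapT S S' z)) = inverse k powr (p - 1) *\<^sub>R F"
        proof -
          have "gradmap G (radmapT S S' z) = inverse k *\<^sub>R G z"
            by (simp add: gradmap_def radmapT_inverse) (simp add: radmapT_def nr kR flip: x_def)
          moreover have "u2 (fst (radmapT S S' z)) (snd (radmapT S S' z)) = y"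
            by (simp add: radmapT_def norm_radmap RS y_def)
          ultimately show ?thesis using flux_scale[OF p, of "inverse k" y "G z"] k by (simp add: F_def)
        qed
        moreover have "u2 (fst (radmapT S S' z)) (snd (radmapT S S' z)) = y"
          by (simp add: radmapT_def norm_radmap RS y_def)
        ultimately have V2z: "V2 (radmapT S S' z) = (b2 (radmap S S' x) *\<^sub>R (inverse k powr (p - 1) *\<^sub>R F), - (a2 (radmap S S' x) * y))"
          by (simp add: V2_def) (simp add: radmapT_def x_def)
        have kk: "k powr p * inverse k powr (p - 1) = k"
        proof -
          have "inverse k powr (p - 1) = k powr (- (p - 1))"
            unfolding powr_minus using k by (simp add: inverse_powr)
          then have "k powr p * inverse k powr (p - 1) = k powr (p + - (p - 1))"
            by (simp only: powr_add)
          then show ?thesis using k by simp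
        qed
        have "radjac S S' x * b2 (radmap S S' x) * inverse k powr (p - 1) = (k powr p * inverse k powr (p - 1)) * b1 x"
          unfolding B[of x, folded r_def, folded k_def, symmetric] by simp
        then have "radjac S S' x * b2 (radmap S S' x) * inverse k powr (p - 1) = k * b1 x"
          by (simp only: kk)
        then have "radjac S S' x *\<^sub>R V2 (radmapT S S' z) = ((k * b1 x) *\<^sub>R F, - (a1 x * y))"
          by (simp add: V2z A[of x] mult.assoc)
        then have "radjac S S' x *\<^sub>R \<eta>' (radmapT S S' z) (V2 (radmapT S S' z)) = \<eta>' (radmapT S S' z) ((k * b1 x) *\<^sub>R F, - (a1 x * y))"
        proof -
          have "radjac S S' x *\<^sub>R \<eta>' (radmapT S S' z) (V2 (radmapT S S' z)) = \<eta>' (radmapT S S' z) (radjac S S' x *\<^sub>R V2 (radmapT S S' z))"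
            by (simp only: linear_cmul[OF l])
          also have "radjac S S' x *\<^sub>R V2 (radmapT S S' z) = ((k * b1 x) *\<^sub>R F, - (a1 x * y))" by fact
          finally show ?thesis .
        qed
        also have "((k * b1 x) *\<^sub>R F, - (a1 x * y)) = (radD S S' (fst z) (fst (V1 G z)), snd (V1 G z))"
          using D by (simp add: F_def y_def x_def)
        finally show ?thesis by (simp add: x_def)
      qed
    qed
  qed
  finally show ?thesis by (simp add: wint_def \<eta>'_def)
qed

text \<open>The first weak formulation holds for smooth test functions; extended to C^1 ones it
  applies to the pullback of \<eta>, which is nonnegative whenever \<eta> is.\<close>

theorem weak_solution_comp:
  "weak_solution p m a1 b1 u1 \<Longrightarrow> weak_solution p m a2 b2 u2"
  "weak_supersolution p m a1 b1 u1 \<Longrightarrow> weak_supersolution p m a2 b2 u2"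
  "weak_subsolution p m a1 b1 u1 \<Longrightarrow> weak_subsolution p m a2 b2 u2"
proof -
  assume "weak_solution p m a1 b1 u1"
  then obtain G where c: "in_class p m a1 u1 G" and w: "\<And>\<eta>. test_fun \<eta> \<Longrightarrow> weak_form p m a1 b1 u1 G \<eta> = 0"
    unfolding weak_solution_def by blast
  have "weak_form p m a2 b2 u2 (gradmap G) \<eta> = 0" if t: "test_fun \<eta>" for \<eta>
    unfolding weak_form_comp[OF c t]
  proof (rule wint_C1c_eq_0[OF C1c_comp[OF test_fun_C1c[OF t]] L1loc_zero in_class_L1loc[OF p c c1]])
    fix \<zeta> :: "(real ^ 'n) \<times> real \<Rightarrow> real" assume \<zeta>: "test_fun \<zeta>"
    show "wint (\<lambda>_. 0) (V1 G) \<zeta> (\<lambda>z. frechet_derivative \<zeta> (at z)) = 0"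
      using w[OF \<zeta>] unfolding weak_form_eq_wint[OF \<zeta>] .
  qed
  then show "weak_solution p m a2 b2 u2"
    unfolding weak_solution_def by (intro exI[of _ "gradmap G"] conjI in_class_comp[OF c]) blast
next
  assume "weak_supersolution p m a1 b1 u1"
  then obtain G where c: "in_class p m a1 u1 G" and w: "\<And>\<eta>. test_fun \<eta> \<Longrightarrow> (\<And>z. 0 \<le> \<eta> z) \<Longrightarrow> 0 \<le> weak_form p m a1 b1 u1 G \<eta>"
    unfolding weak_supersolution_def by blast
  have "0 \<le> weak_form p m a2 b2 u2 (gradmap G) \<eta>" if t: "test_fun \<eta>" and n: "\<And>z. 0 \<le> \<eta> z" for \<eta>
    unfolding weak_form_comp[OF c t]
  proof (rule wint_C1c_nonneg[OF C1c_comp[OF test_fun_C1c[OF t]] L1loc_zero in_class_L1loc[OF p c c1]])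
    show "0 \<le> \<eta> (radmapT S S' z)" for z by (rule n)
    fix \<zeta> :: "(real ^ 'n) \<times> real \<Rightarrow> real" assume \<zeta>: "test_fun \<zeta>" "\<And>z. 0 \<le> \<zeta> z"
    show "0 \<le> wint (\<lambda>_. 0) (V1 G) \<zeta> (\<lambda>z. frechet_derivative \<zeta> (at z))"
      using w[OF \<zeta>] unfolding weak_form_eq_wint[OF \<zeta>(1)] .
  qed
  then show "weak_supersolution p m a2 b2 u2"
    unfolding weak_supersolution_def by (intro exI[of _ "gradmap G"] conjI in_class_comp[OF c]) blast
next
  assume "weak_subsolution p m a1 b1 u1"
  then obtain G where c: "in_class p m a1 u1 G" and w: "\<And>\<eta>. test_fun \<eta> \<Longrightarrow> (\<And>z. 0 \<le> \<eta> z) \<Longrightarrow> weak_form p m a1 b1 u1 G \<eta> \<le> 0"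
    unfolding weak_subsolution_def by blast
  \<comment> \<open>The extension to C^1 tests is available for the sign \<ge> only, so subsolutions
    are treated through the negated field.\<close>
  have V: "L1loc (\<lambda>z. - V1 G z)"
    by (rule L1loc_bounded_linear[OF in_class_L1loc[OF p c c1]]) (rule bounded_linear_minus[OF bounded_linear_ident])
  have "weak_form p m a2 b2 u2 (gradmap G) \<eta> \<le> 0" if t: "test_fun \<eta>" and n: "\<And>z. 0 \<le> \<eta> z" for \<eta>
  proof -
    note \<eta> = C1c_comp[OF test_fun_C1c[OF t]]
    have "0 \<le> wint (\<lambda>_. 0) (\<lambda>z. - V1 G z) (\<lambda>z. \<eta> (radmapT S S' z))
      (\<lambda>z v. frechet_derivative \<eta> (at (radmapT S S' z)) (radD S S' (fst z) (fst v), snd v))"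
    proof (rule wint_C1c_nonneg[OF \<eta> L1loc_zero V])
      show "0 \<le> \<eta> (radmapT S S' z)" for z by (rule n)
      fix \<zeta> :: "(real ^ 'n) \<times> real \<Rightarrow> real" assume \<zeta>: "test_fun \<zeta>" "\<And>z. 0 \<le> \<zeta> z"
      show "0 \<le> wint (\<lambda>_. 0) (\<lambda>z. - V1 G z) \<zeta> (\<lambda>z. frechet_derivative \<zeta> (at z))"
        using w[OF \<zeta>] unfolding weak_form_eq_wint[OF \<zeta>(1)] wint_neg[OF test_fun_C1c[OF \<zeta>(1)]] by simp
    qed
    then show ?thesis unfolding weak_form_comp[OF c t] wint_neg[OF \<eta>] by simp
  qed
  then show "weak_subsolution p m a2 b2 u2"
    unfolding weak_subsolution_def by (intro exI[of _ "gradmap G"] conjI in_class_comp[OF c]) blast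
qed

end

end

section \<open>The radial change of variables for the weight \<open>e\<^bsup>g\<^esup>\<close>\<close>

text \<open>Comparison from infinity: two functions tending to 0 are ordered oppositely to their
  derivatives. It is applied to combinations of \<open>I\<close> and \<open>Y\<close>.\<close>

lemma antimono_tendsto_0_nonneg:
  fixes F :: "real \<Rightarrow> real"
  assumes d: "\<And>x. r \<le> x \<Longrightarrow> (F has_real_derivative F' x) (at x)" and n: "\<And>x. r \<le> x \<Longrightarrow> F' x \<le> 0"
    and l: "(F \<longlongrightarrow> 0) at_top"
  shows "0 \<le> F r"
proof (rule tendsto_upperbound[OF l])
  show "\<forall>\<^sub>F x in at_top. F x \<le> F r"
    using eventually_ge_at_top[of r]
  proof eventually_elim
    case (elim x)
    show ?case
      by (rule DERIV_nonpos_imp_nonincreasing[OF elim]) (use d n in blast)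
  qed
qed simp

section \<open>The weight, the tail integral I and its comparison function Y\<close>

locale growth =
  fixes p n \<alpha>1 \<alpha>2 :: real and g g' :: "real \<Rightarrow> real"
  assumes p: "1 < p" "p < n" and \<alpha>: "0 < \<alpha>1" "\<alpha>1 \<le> \<alpha>2"
    and g_cont: "continuous_on {0..} g"
    and g_deriv: "\<And>s. 0 < s \<Longrightarrow> (g has_real_derivative g' s) (at s)"
    and g_0: "g 0 = 0" and g_pos: "\<And>s. 0 < s \<Longrightarrow> 0 < g s"
    and g_lo: "\<And>s. 0 < s \<Longrightarrow> \<alpha>1 * (g s / s) \<le> g' s"
    and g_hi: "\<And>s. 0 < s \<Longrightarrow> g' s \<le> \<alpha>2 * (g s / s)"
begin

definition q where "q = (n - p) / (p - 1)"

definition E where "E r = exp (- (g r / (p - 1)))"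

definition w where "w r = q * r powr (- (q + 1)) * E r"

definition I where "I r = integral {r..} w"

definition Y where "Y r = r powr (- q) * E r"

lemma q: "0 < q" "q * (p - 1) = n - p" "(q + 1) * (p - 1) = n - 1"
  using p by (auto simp: q_def field_simps)

lemma g_nonneg: "0 \<le> s \<Longrightarrow> 0 \<le> g s"
  using g_pos[of s] g_0 by (cases "s = 0") auto

lemma g'_pos: "0 < s \<Longrightarrow> 0 < g' s"
  using g_lo[of s] g_pos[of s] \<alpha> by (smt (verit) divide_pos_pos mult_pos_pos)

lemma g_less: "0 \<le> r \<Longrightarrow> r < s \<Longrightarrow> g r < g s"
proof -
  assume r: "0 \<le> r" "r < s"
  show "g r < g s"
  proof (rule DERIV_pos_imp_increasing_open[OF r(2)])
    show "\<exists>y. (g has_real_derivative y) (at x) \<and> 0 < y" if "r < x" "x < s" for x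
      using that r g_deriv[of x] g'_pos[of x] by auto
    show "continuous_on {r..s} g" by (rule continuous_on_subset[OF g_cont]) (use r in auto)
  qed
qed

lemma g_le: "0 \<le> r \<Longrightarrow> r \<le> s \<Longrightarrow> g r \<le> g s"
  using g_less[of r s] by (cases "r = s") auto

text \<open>The lower bound on g' says that g(s)/s^\<alpha>1 is nondecreasing.\<close>

lemma g_scale: "0 < r \<Longrightarrow> r \<le> s \<Longrightarrow> (s / r) powr \<alpha>1 * g r \<le> g s"
proof -
  assume r: "0 < r" "r \<le> s"
  have "g r / r powr \<alpha>1 \<le> g s / s powr \<alpha>1"
  proof (rule DERIV_nonneg_imp_nondecreasing[OF r(2)])
    fix x assume x: "r \<le> x" "x \<le> s"
    then have x0: "0 < x" using r by linarith
    have "((\<lambda>x. g x / x powr \<alpha>1) has_real_derivative (g' x * x powr \<alpha>1 - g x * (\<alpha>1 * x powr (\<alpha>1 - 1))) / (x powr \<alpha>1 * x powr \<alpha>1)) (at x)"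
      using x0 g_deriv[OF x0] by (auto intro!: derivative_eq_intros)
    moreover have "0 \<le> (g' x * x powr \<alpha>1 - g x * (\<alpha>1 * x powr (\<alpha>1 - 1))) / (x powr \<alpha>1 * x powr \<alpha>1)"
    proof (rule divide_nonneg_nonneg)
      have "x powr (\<alpha>1 - 1) = x powr \<alpha>1 / x" using x0 by (simp add: powr_diff)
      then have "g' x * x powr \<alpha>1 - g x * (\<alpha>1 * x powr (\<alpha>1 - 1)) = (g' x - \<alpha>1 * (g x / x)) * x powr \<alpha>1"
        by (simp add: algebra_simps)
      then show "0 \<le> g' x * x powr \<alpha>1 - g x * (\<alpha>1 * x powr (\<alpha>1 - 1))" using g_lo[OF x0] by simp
    qed simp
    ultimately show "\<exists>y. ((\<lambda>x. g x / x powr \<alpha>1) has_real_derivative y) (at x) \<and> 0 \<le> y" by blast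
  qed
  moreover have "0 < r powr \<alpha>1" "0 < s powr \<alpha>1" using r by auto
  ultimately have "g r * s powr \<alpha>1 \<le> g s * r powr \<alpha>1" by (simp add: field_simps)
  then show ?thesis using r by (simp add: powr_divide field_simps)
qed

lemma E_pos: "0 < E r" by (simp add: E_def)

lemma E_le: "0 \<le> r \<Longrightarrow> r \<le> s \<Longrightarrow> E s \<le> E r"
  using g_le[of r s] p by (simp add: E_def divide_right_mono)

lemma E_le_1: "0 \<le> r \<Longrightarrow> E r \<le> 1"
  using g_nonneg[of r] p by (simp add: E_def)

lemma E_cont: "continuous_on {0..} E"
  unfolding E_def[abs_def] using p by (intro continuous_intros g_cont) auto

lemma w_cont: "continuous_on {0<..} w"
  unfolding w_def[abs_def] by (intro continuous_intros continuous_on_subset[OF E_cont]) auto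

lemma w_pos: "0 < r \<Longrightarrow> 0 < w r"
  using q(1) E_pos by (simp add: w_def)

lemma powr_tail: "0 < r \<Longrightarrow> ((\<lambda>t. q * t powr (- (q + 1))) has_integral r powr (- q)) {r..}"
proof -
  assume r: "0 < r"
  have "((\<lambda>t. q * t powr (- (q + 1))) has_integral q * (- (r powr (- (q + 1) + 1)) / (- (q + 1) + 1))) {r..}"
    by (rule has_integral_mult_right, rule has_integral_powr_to_inf) (use r q(1) in auto)
  then show ?thesis using q(1) by simp
qed

lemma w_integrable: "0 < r \<Longrightarrow> w integrable_on {r..}"
proof (rule measurable_bounded_by_integrable_imp_integrable)
  assume r: "0 < r"
  show "w \<in> borel_measurable (lebesgue_on {r..})"
    by (rule continuous_imp_measurable_on_sets_lebesgue[OF continuous_on_subset[OF w_cont]]) (use r in auto)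
  show "(\<lambda>t. q * t powr (- (q + 1))) integrable_on {r..}" using powr_tail[OF r] by blast
  show "norm (w t) \<le> q * t powr (- (q + 1))" if "t \<in> {r..}" for t
    using that r q(1) E_le_1[of t] E_pos[of t] by (simp add: w_def abs_mult mult_left_le)
qed simp

lemma I_split: "0 < r \<Longrightarrow> r \<le> s \<Longrightarrow> I r = integral {r..s} w + I s"
proof -
  assume r: "0 < r" "r \<le> s"
  have "integral ({r..s} \<union> {s..}) w = integral {r..s} w + integral {s..} w"
  proof (rule Henstock_Kurzweil_Integration.integral_Un)
    show "w integrable_on {r..s}"
      by (rule integrable_continuous_interval[OF continuous_on_subset[OF w_cont]]) (use r in auto)
    show "w integrable_on {s..}" using r by (intro w_integrable) simp
    have "{r..s} \<inter> {s..} = {s}" using r by auto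
    then show "negligible ({r..s} \<inter> {s..})" by simp
  qed
  moreover have "{r..s} \<union> {s..} = {r..}" using r by auto
  ultimately show ?thesis by (simp add: I_def)
qed

lemma I_deriv: "0 < r \<Longrightarrow> (I has_real_derivative - w r) (at r)"
proof -
  assume r: "0 < r"
  define a where "a = r / 2"
  define b where "b = r + 1"
  have ab: "0 < a" "a < r" "r < b" using r by (auto simp: a_def b_def)
  have "((\<lambda>u. integral {a..u} w) has_vector_derivative w r) (at r within {a..b})"
    by (rule integral_has_vector_derivative[OF continuous_on_subset[OF w_cont]]) (use ab in auto)
  then have "((\<lambda>u. integral {a..u} w) has_real_derivative w r) (at r)"
    using ab by (simp add: has_real_derivative_iff_has_vector_derivative at_within_Icc_at)
  then have "((\<lambda>u. I a - integral {a..u} w) has_real_derivative 0 - w r) (at r)"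
    by (intro DERIV_diff DERIV_const)
  then show ?thesis
    using has_field_derivative_transform_within_open[of "\<lambda>u. I a - integral {a..u} w" "0 - w r" r "{a<..}" I]
      I_split[OF ab(1)] ab by (simp add: algebra_simps)
qed

lemma I_le: "0 < r \<Longrightarrow> I r \<le> Y r"
proof -
  assume r: "0 < r"
  have "I r \<le> integral {r..} (\<lambda>t. (q * t powr (- (q + 1))) * E r)"
    unfolding I_def
  proof (rule integral_le[OF w_integrable[OF r]])
    show "(\<lambda>t. (q * t powr (- (q + 1))) * E r) integrable_on {r..}"
      using has_integral_mult_left[OF powr_tail[OF r]] by blast
    show "w t \<le> (q * t powr (- (q + 1))) * E r" if "t \<in> {r..}" for t
      unfolding w_def using that r q(1) E_le[of r t] by (intro mult_left_mono) auto
  qed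
  also have "\<dots> = Y r"
    unfolding Y_def by (rule integral_unique[OF has_integral_mult_left[OF powr_tail[OF r]]])
  finally show ?thesis .
qed

lemma I_pos: "0 < r \<Longrightarrow> 0 < I r"
proof -
  assume r: "0 < r"
  have "I (r + 1) < I r"
  proof (rule DERIV_neg_imp_decreasing[of r "r + 1" I])
    show "\<exists>y. (I has_real_derivative y) (at x) \<and> y < 0" if "r \<le> x" "x \<le> r + 1" for x
    proof -
      have x: "0 < x" using r that by linarith
      then have "- w x < 0" using w_pos[of x] by linarith
      with I_deriv[OF x] show ?thesis by blast
    qed
  qed (use r in linarith)
  moreover have "0 \<le> I (r + 1)"
    unfolding I_def
  proof (rule Henstock_Kurzweil_Integration.integral_nonneg)
    show "w integrable_on {r + 1..}" using r by (intro w_integrable) linarith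
    show "0 \<le> w t" if "t \<in> {r + 1..}" for t
      using that r by (intro less_imp_le w_pos) simp
  qed
  ultimately show ?thesis by linarith
qed

lemma Y_pos: "0 < r \<Longrightarrow> 0 < Y r" by (simp add: Y_def E_pos)

lemma Y_tendsto: "(Y \<longlongrightarrow> 0) at_top"
proof (rule Lim_null_comparison)
  show "\<forall>\<^sub>F r in at_top. norm (Y r) \<le> r powr (- q)"
    using eventually_gt_at_top[of 0]
    by eventually_elim (use E_le_1 E_pos in \<open>auto simp: Y_def abs_mult mult_left_le less_imp_le\<close>)
  show "((\<lambda>r. r powr (- q)) \<longlongrightarrow> 0) at_top"
    using q(1) by (intro tendsto_neg_powr filterlim_ident) auto
qed

lemma I_tendsto: "(I \<longlongrightarrow> 0) at_top"
proof (rule Lim_null_comparison[OF _ Y_tendsto])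
  show "\<forall>\<^sub>F r in at_top. norm (I r) \<le> Y r"
    using eventually_gt_at_top[of 0] by eventually_elim (use I_le I_pos in \<open>auto simp: less_imp_le\<close>)
qed

lemma Y_deriv: "0 < r \<Longrightarrow> (Y has_real_derivative - (w r * (1 + r * g' r / (n - p)))) (at r)"
proof -
  assume r: "0 < r"
  have "(Y has_real_derivative ((- q) * r powr (- q - 1)) * E r + r powr (- q) * (E r * (- (g' r / (p - 1))))) (at r)"
    unfolding Y_def[abs_def] E_def[abs_def]
    using r p g_deriv[OF r] by (auto intro!: derivative_eq_intros)
  moreover have "((- q) * r powr (- q - 1)) * E r + r powr (- q) * (E r * (- (g' r / (p - 1)))) = - (w r * (1 + r * g' r / (n - p)))"
  proof -
    have "r powr (- q) = r * r powr (- q - 1)" using r powr_add[of r 1 "- q - 1"] by simp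
    then have "r powr (- q) * (E r * (- (g' r / (p - 1)))) = - (r powr (- q - 1) * E r * (r * g' r / (p - 1)))" by simp
    also have "r * g' r / (p - 1) = q * (r * g' r / (n - p))" using p by (simp add: q_def)
    finally have e: "r powr (- q) * (E r * (- (g' r / (p - 1)))) = - (r powr (- q - 1) * E r * (q * (r * g' r / (n - p))))" .
    have "w r = q * r powr (- q - 1) * E r" by (simp add: w_def)
    then show ?thesis unfolding e by (simp add: distrib_left)
  qed
  ultimately show ?thesis by simp
qed

definition c1 where "c1 = \<alpha>1 / (n - p)"
definition c2 where "c2 = \<alpha>2 / (n - p)"
definition C where "C = 1 + \<alpha>2 / q"

lemma c: "0 < c1" "0 < c2" "1 \<le> C"
  using \<alpha> p q(1) by (auto simp: c1_def c2_def C_def)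

lemma g'_bounds: "0 < r \<Longrightarrow> \<alpha>1 * g r \<le> r * g' r" "0 < r \<Longrightarrow> r * g' r \<le> \<alpha>2 * g r"
  using g_lo[of r] g_hi[of r] by (simp_all add: field_simps)

lemma g'_bounds_c: "0 < r \<Longrightarrow> c1 * g r \<le> r * g' r / (n - p)" "0 < r \<Longrightarrow> r * g' r / (n - p) \<le> c2 * g r"
  using g'_bounds[of r] p by (simp_all add: c1_def c2_def divide_right_mono)

text \<open>The ratio Y'/I' at x is 1 + x g'(x)/(n - p), which is at least 1 + c1 g(x) and so at
  least 1 + c1 g(r) for x \<ge> r. With r frozen, the comparison from infinity applies.\<close>

lemma I_upper: "0 < r \<Longrightarrow> (1 + c1 * g r) * I r \<le> Y r"
proof -
  assume r: "0 < r"
  have "0 \<le> Y r - (1 + c1 * g r) * I r"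
  proof (rule antimono_tendsto_0_nonneg[where F = "\<lambda>x. Y x - (1 + c1 * g r) * I x"])
    show "((\<lambda>x. Y x - (1 + c1 * g r) * I x) has_real_derivative - (w x * (1 + x * g' x / (n - p))) - (1 + c1 * g r) * (- w x)) (at x)"
      if "r \<le> x" for x using that r by (intro DERIV_diff Y_deriv DERIV_cmult I_deriv) auto
    show "- (w x * (1 + x * g' x / (n - p))) - (1 + c1 * g r) * (- w x) \<le> 0" if x: "r \<le> x" for x
    proof -
      have "c1 * g r \<le> c1 * g x" using g_le[of r x] r x c(1) by simp
      also have "\<dots> \<le> x * g' x / (n - p)" using g'_bounds_c(1)[of x] r x by simp
      finally have "(1 + c1 * g r) * w x \<le> (1 + x * g' x / (n - p)) * w x"
        using w_pos[of x] r x by (intro mult_right_mono) auto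
      then show ?thesis by (simp add: algebra_simps)
    qed
    show "((\<lambda>x. Y x - (1 + c1 * g r) * I x) \<longlongrightarrow> 0) at_top"
      using tendsto_diff[OF Y_tendsto tendsto_mult_left[OF I_tendsto, of "1 + c1 * g r"]] by simp
  qed
  then show ?thesis by simp
qed

text \<open>Here g cannot be frozen at r, because it grows; Y is divided by D = 1 + c2 g instead.
  The derivative of Y costs at most w after the division, and that of D at most w \<alpha>2/q, which
  explains \<open>C\<close>.\<close>

lemma I_lower: "0 < r \<Longrightarrow> Y r \<le> C * (1 + c2 * g r) * I r"
proof -
  assume r: "0 < r"
  define D where "D x = 1 + c2 * g x" for x
  have D: "1 \<le> D x" if "0 < x" for x using g_nonneg[of x] c(2) that by (simp add: D_def)
  have "0 \<le> C * I r - Y r / D r"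
  proof (rule antimono_tendsto_0_nonneg[where F = "\<lambda>x. C * I x - Y x / D x"])
    show "((\<lambda>x. C * I x - Y x / D x) has_real_derivative C * (- w x) - ((- (w x * (1 + x * g' x / (n - p)))) * D x - Y x * (c2 * g' x)) / (D x * D x)) (at x)"
      if "r \<le> x" for x
    proof -
      have x: "0 < x" using that r by linarith
      have "(D has_real_derivative c2 * g' x) (at x)"
        unfolding D_def[abs_def] using g_deriv[OF x] by (auto intro!: derivative_eq_intros)
      then show ?thesis using D[OF x] by (intro DERIV_diff DERIV_cmult I_deriv DERIV_divide Y_deriv x) auto
    qed
    show "C * (- w x) - ((- (w x * (1 + x * g' x / (n - p)))) * D x - Y x * (c2 * g' x)) / (D x * D x) \<le> 0" if "r \<le> x" for x
    proof -
      have x: "0 < x" using that r by linarith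
      have D1: "1 \<le> D x" by (rule D[OF x])
      have w: "0 < w x" by (rule w_pos[OF x])
      have "Y x = x * w x / q"
        using x q(1) powr_add[of x 1 "- (q + 1)"] by (simp add: Y_def w_def)
      then have "Y x * (c2 * g' x) = w x * (c2 * (x * g' x)) / q" by simp
      also have "\<dots> \<le> w x * (c2 * (\<alpha>2 * g x)) / q"
        using g'_bounds(2)[OF x] w c(2) q(1) by (intro divide_right_mono mult_left_mono) auto
      also have "\<dots> = w x * (\<alpha>2 / q) * (c2 * g x)" by simp
      also have "\<dots> \<le> w x * (\<alpha>2 / q) * (D x * D x)"
      proof (rule mult_left_mono)
        have "D x * 1 \<le> D x * D x" using D1 by (intro mult_left_mono) auto
        then show "c2 * g x \<le> D x * D x" by (simp add: D_def)
        show "0 \<le> w x * (\<alpha>2 / q)" using w \<alpha> q(1) by simp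
      qed
      finally have 1: "Y x * (c2 * g' x) / (D x * D x) \<le> w x * (\<alpha>2 / q)"
        using D1 by (simp add: divide_le_eq)
      have "w x * (1 + x * g' x / (n - p)) \<le> w x * D x"
        using g'_bounds_c(2)[OF x] w by (intro mult_left_mono) (auto simp: D_def)
      then have 2: "w x * (1 + x * g' x / (n - p)) / D x \<le> w x" using D1 by (simp add: divide_le_eq)
      have "((- (w x * (1 + x * g' x / (n - p)))) * D x - Y x * (c2 * g' x)) / (D x * D x)
          = - (w x * (1 + x * g' x / (n - p)) / D x) - Y x * (c2 * g' x) / (D x * D x)"
        using D1 by (simp add: diff_divide_distrib)
      moreover have "C * (- w x) = - w x - w x * (\<alpha>2 / q)" by (simp add: C_def algebra_simps)
      ultimately show ?thesis using 1 2 by linarith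
    qed
    have "((\<lambda>x. Y x / D x) \<longlongrightarrow> 0) at_top"
    proof (rule Lim_null_comparison[OF _ Y_tendsto])
      show "\<forall>\<^sub>F x in at_top. norm (Y x / D x) \<le> Y x"
        using eventually_gt_at_top[of 0]
      proof eventually_elim
        case (elim x)
        have "Y x * 1 \<le> Y x * D x" using D[OF elim] Y_pos[OF elim] by (intro mult_left_mono) auto
        then have "Y x / D x \<le> Y x" using D[OF elim] by (simp add: divide_le_eq)
        then show ?case using D[OF elim] Y_pos[OF elim] by simp
      qed
    qed
    then show "((\<lambda>x. C * I x - Y x / D x) \<longlongrightarrow> 0) at_top"
      using tendsto_diff[OF tendsto_mult_left[OF I_tendsto, of C]] by fastforce
  qed
  then have "Y r / D r \<le> C * I r" by simp
  then show ?thesis using D[OF r] by (simp add: divide_le_eq D_def mult_ac)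
qed

section \<open>The change of variables S\<close>

definition S where "S r = (if r = 0 then 0 else I r powr (- 1 / q))"

text \<open>For r > 0 this is the right-hand side of the separable equation; the value 1 at 0 is its
  limit.\<close>

definition S' where "S' r = (if r = 0 then 1 else (S r / r) powr (q + 1) * E r)"

lemma S_pos: "0 < r \<Longrightarrow> 0 < S r" using I_pos[of r] by (simp add: S_def)

lemma S'_pos: "0 \<le> r \<Longrightarrow> 0 < S' r" using S_pos[of r] E_pos[of r] by (auto simp: S'_def)

lemma S_deriv: "0 < r \<Longrightarrow> (S has_real_derivative S' r) (at r)"
proof -
  assume r: "0 < r"
  have "((\<lambda>r. I r powr (- 1 / q)) has_real_derivative (- 1 / q) * I r powr (- 1 / q - 1) * (- w r)) (at r)"
    using DERIV_fun_powr[OF I_deriv[OF r] I_pos[OF r], of "- 1 / q"] by simp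
  moreover have "(- 1 / q) * I r powr (- 1 / q - 1) * (- w r) = S' r"
  proof -
    have Sr: "S r = I r powr (- 1 / q)" using r by (auto simp: S_def)
    have "(S r / r) powr (q + 1) = S r powr (q + 1) * (1 / r powr (q + 1))"
      using r S_pos[OF r] by (simp add: powr_divide less_imp_le)
    also have "1 / r powr (q + 1) = r powr (- (q + 1))" by (rule powr_minus_divide[symmetric])
    also have "S r powr (q + 1) = I r powr ((- 1 / q) * (q + 1))" unfolding Sr by (rule powr_powr)
    also have "(- 1 / q) * (q + 1) = - 1 / q - 1" using q(1) by (simp add: field_simps)
    finally have e: "(S r / r) powr (q + 1) = I r powr (- 1 / q - 1) * r powr (- (q + 1))" .
    have S'r: "S' r = (S r / r) powr (q + 1) * E r" using r by (auto simp: S'_def)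
    show ?thesis unfolding S'r e w_def using q(1) by simp
  qed
  ultimately have "((\<lambda>r. I r powr (- 1 / q)) has_real_derivative S' r) (at r)" by simp
  then show ?thesis
    by (rule has_field_derivative_transform_within_open[where S = "{0<..}"]) (use r in \<open>auto simp: S_def\<close>)
qed

text \<open>From I \<le> Y \<le> r^(-q). It makes \<open>S\<close> unbounded and hence onto.\<close>

lemma S_ge: "0 < r \<Longrightarrow> r \<le> S r"
proof -
  assume r: "0 < r"
  have "Y r \<le> r powr (- q)" using E_le_1[of r] r by (simp add: Y_def mult_left_le)
  with I_le[OF r] have "I r \<le> r powr (- q)" by linarith
  then have "(r powr (- q)) powr (- 1 / q) \<le> I r powr (- 1 / q)"
    using I_pos[OF r] q(1) by (intro powr_mono2') auto
  then show ?thesis using r q(1) by (simp add: S_def powr_powr)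
qed

text \<open>It suffices that r^q I(r) tends to 1. The upper bound is I \<le> Y. For the lower one
  only the interval from r to sqrt r is kept: there E is at least E(sqrt r), which tends to 1, and
  the omitted tail accounts for a relative error (sqrt r)^q.\<close>

lemma S_ratio: "((\<lambda>r. S r / r) \<longlongrightarrow> 1) (at_right 0)"
proof -
  have E0: "(E \<longlongrightarrow> 1) (at_right 0)"
  proof -
    have "(E \<longlongrightarrow> E 0) (at 0 within {0..})" using E_cont by (simp add: continuous_on_def)
    then have "(E \<longlongrightarrow> E 0) (at_right 0)" by (rule tendsto_within_subset) auto
    then show ?thesis by (simp add: E_def g_0)
  qed
  have sq: "filterlim sqrt (at_right 0) (at_right (0::real))"
    unfolding filterlim_at
  proof
    show "(sqrt \<longlongrightarrow> 0) (at_right 0)" using tendsto_real_sqrt[of "\<lambda>x. x" 0 "at_right 0"] by (simp add: tendsto_ident_at)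
    show "\<forall>\<^sub>F x in at_right 0. sqrt x \<in> {0<..} \<and> sqrt x \<noteq> (0::real)"
      by (auto simp: eventually_at_filter)
  qed
  have "((\<lambda>r. r powr q * I r) \<longlongrightarrow> 1) (at_right 0)"
  proof (rule tendsto_sandwich)
    show "\<forall>\<^sub>F r in at_right 0. E (sqrt r) * (1 - sqrt r powr q) \<le> r powr q * I r"
      unfolding eventually_at_right_field
    proof (intro exI[of _ 1] conjI allI impI)
      fix r :: real assume r: "0 < r" "r < 1"
      define b where "b = sqrt r"
      have b: "r \<le> b" "0 < b" "b * b = r" using r by (auto simp: b_def real_le_rsqrt power2_eq_square mult_le_one)
      have "((\<lambda>t. q * t powr (- (q + 1))) has_integral (- (b powr (- q))) - (- (r powr (- q)))) {r..b}"
      proof (rule fundamental_theorem_of_calculus[OF b(1)])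
        fix t assume t: "t \<in> {r..b}"
        then have "((\<lambda>t. - (t powr (- q))) has_real_derivative q * t powr (- (q + 1))) (at t)"
          using r by (auto intro!: derivative_eq_intros)
        then show "((\<lambda>t. - (t powr (- q))) has_vector_derivative q * t powr (- (q + 1))) (at t within {r..b})"
          by (simp add: has_real_derivative_iff_has_vector_derivative has_vector_derivative_at_within)
      qed
      from has_integral_mult_left[OF this, of "E b"]
      have hi: "((\<lambda>t. q * t powr (- (q + 1)) * E b) has_integral (r powr (- q) - b powr (- q)) * E b) {r..b}" by simp
      have "(r powr (- q) - b powr (- q)) * E b \<le> integral {r..b} w"
      proof (rule has_integral_le[OF hi])
        show "(w has_integral integral {r..b} w) {r..b}"
          by (intro integrable_integral integrable_continuous_interval continuous_on_subset[OF w_cont]) (use r in auto)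
        show "q * t powr (- (q + 1)) * E b \<le> w t" if "t \<in> {r..b}" for t
          unfolding w_def using that r q(1) E_le[of t b] by (intro mult_left_mono) auto
      qed
      also have "\<dots> \<le> I r" using I_split[OF r(1) b(1)] I_pos[OF b(2)] by simp
      finally have "r powr q * ((r powr (- q) - b powr (- q)) * E b) \<le> r powr q * I r"
        by (intro mult_left_mono) auto
      moreover have "r powr q * (r powr (- q) - b powr (- q)) = 1 - b powr q"
      proof -
        have "r powr q = b powr q * b powr q" unfolding b(3)[symmetric] using b(2) by (simp add: powr_mult)
        moreover have "b powr q * b powr (- q) = 1" "r powr q * r powr (- q) = 1"
          using b(2) r(1) by (simp_all add: powr_minus field_simps)
        ultimately show ?thesis by (simp add: right_diff_distrib mult.assoc)
      qed
      ultimately show "E (sqrt r) * (1 - sqrt r powr q) \<le> r powr q * I r"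
        by (simp add: b_def mult_ac)
    qed simp
    show "\<forall>\<^sub>F r in at_right 0. r powr q * I r \<le> 1"
      unfolding eventually_at_right_field
    proof (intro exI[of _ 1] conjI allI impI)
      fix r :: real assume r: "0 < r" "r < 1"
      have "I r \<le> r powr (- q)" using I_le[OF r(1)] E_le_1[of r] r by (simp add: Y_def) (smt (verit) mult_left_le powr_ge_zero)
      then have "r powr q * I r \<le> r powr q * r powr (- q)" by (intro mult_left_mono) auto
      then show "r powr q * I r \<le> 1" using r by (simp add: powr_minus field_simps)
    qed simp
    have "((\<lambda>b. E b * (1 - b powr q)) \<longlongrightarrow> 1 * (1 - 0)) (at_right 0)"
    proof (intro tendsto_mult E0 tendsto_diff tendsto_const)
      show "((\<lambda>b. b powr q) \<longlongrightarrow> 0) (at_right 0)"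
        using tendsto_powr'[OF tendsto_ident_at tendsto_const[of q], of 0 "{0<..}"] q(1)
        by (auto simp: eventually_at_filter)
    qed
    then show "((\<lambda>r. E (sqrt r) * (1 - sqrt r powr q)) \<longlongrightarrow> 1) (at_right 0)"
      using filterlim_compose[OF _ sq] by fastforce
  qed simp
  then have "((\<lambda>r. (r powr q * I r) powr (- 1 / q)) \<longlongrightarrow> 1 powr (- 1 / q)) (at_right 0)"
    by (intro tendsto_powr tendsto_const) auto
  then have "((\<lambda>r. (r powr q * I r) powr (- 1 / q)) \<longlongrightarrow> 1) (at_right 0)" by simp
  then show ?thesis
  proof (rule Lim_transform_eventually)
    show "\<forall>\<^sub>F r in at_right 0. (r powr q * I r) powr (- 1 / q) = S r / r"
      unfolding eventually_at_right_field
    proof (intro exI[of _ 1] conjI allI impI)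
      fix r :: real assume r: "0 < r" "r < 1"
      have "(r powr q) powr (- 1 / q) = 1 / r" using r q(1) by (simp add: powr_powr powr_minus_divide)
      then show "(r powr q * I r) powr (- 1 / q) = S r / r"
        using r I_pos[OF r(1)] by (simp add: powr_mult S_def less_imp_le)
    qed simp
  qed
qed

lemma at_0_within: "at 0 within {0..} = at_right (0::real)"
proof -
  have "{0..} - {0} = {0<..} - {0::real}" by auto
  then show ?thesis by (metis at_within_def)
qed

sublocale radial_diffeo S S'
proof
  have d0: "(S has_real_derivative S' 0) (at 0 within {0..})"
    using S_ratio by (simp add: has_field_derivative_iff at_0_within S'_def S_def[of 0])
  show d: "(S has_real_derivative S' r) (at r within {0..})" if "0 \<le> r" for r
    using that d0 S_deriv[of r] by (cases "r = 0") (auto intro: has_field_derivative_at_within)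
  have c: "continuous_on {0..} S" by (rule DERIV_continuous_on) (use d in auto)
  show m: "strict_mono_on {0..} S"
  proof (rule strict_mono_onI)
    fix r s :: real assume "r \<in> {0..}" "s \<in> {0..}" "r < s"
    show "S r < S s"
    proof (rule DERIV_pos_imp_increasing_open[of r s S])
      show "\<exists>y. (S has_real_derivative y) (at x) \<and> 0 < y" if "r < x" "x < s" for x
      proof -
        have x: "0 < x" using that \<open>r \<in> {0..}\<close> by simp
        have "0 < S' x" using x by (intro S'_pos) simp
        with S_deriv[OF x] show ?thesis by blast
      qed
      have "{r..s} \<subseteq> {0..}" using \<open>r \<in> {0..}\<close> by (auto intro: order_trans)
      then show "continuous_on {r..s} S" by (rule continuous_on_subset[OF c])
    qed (rule \<open>r < s\<close>)
  qed
  show "bij_betw S {0..} {0..}"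
    unfolding bij_betw_def
  proof
    show "inj_on S {0..}" using m by (rule strict_mono_on_imp_inj_on)
    show "S ` {0..} = {0..}"
    proof (intro equalityI subsetI)
      fix y assume "y \<in> S ` {0..}"
      then show "y \<in> {0..}" using S_pos by (auto simp: S_def less_imp_le)
    next
      fix y :: real assume y: "y \<in> {0..}"
      have "S 0 \<le> y" "y \<le> S (y + 1)" using y S_ge[of "y + 1"] by (auto simp: S_def[of 0])
      then obtain x where "0 \<le> x" "x \<le> y + 1" "S x = y"
        using IVT'[of S 0 y "y + 1"] y continuous_on_subset[OF c, of "{0..y + 1}"] by auto
      then show "y \<in> S ` {0..}" by auto
    qed
  qed
  show "continuous_on {0..} S'"
    unfolding continuous_on_eq_continuous_within
  proof
    fix r :: real assume r: "r \<in> {0..}"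
    show "continuous (at r within {0..}) S'"
    proof (cases "r = 0")
      case True
      have "(E \<longlongrightarrow> E 0) (at 0 within {0..})" using E_cont by (simp add: continuous_on_def)
      then have "((\<lambda>r. (S r / r) powr (q + 1) * E r) \<longlongrightarrow> 1 powr (q + 1) * E 0) (at 0 within {0..})"
        unfolding at_0_within by (intro tendsto_mult tendsto_powr S_ratio tendsto_const) auto
      then have "((\<lambda>r. (S r / r) powr (q + 1) * E r) \<longlongrightarrow> 1) (at 0 within {0..})" by (simp add: E_def g_0)
      then have "(S' \<longlongrightarrow> 1) (at 0 within {0..})"
        by (rule Lim_transform_eventually) (auto simp: eventually_at_filter S'_def)
      then show ?thesis using True by (simp add: continuous_within S'_def)
    next
      case False
      then have r0: "0 < r" using r by simp
      have "continuous_on {0<..} (\<lambda>r. (S r / r) powr (q + 1) * E r)"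
        by (intro continuous_intros continuous_on_subset[OF c] continuous_on_subset[OF E_cont]) (use S_pos in \<open>auto simp: less_imp_neq[symmetric]\<close>)
      then have "isCont (\<lambda>r. (S r / r) powr (q + 1) * E r) r" using r0 by (simp add: continuous_on_eq_continuous_at)
      then have "isCont S' r"
      proof (rule continuous_transform_within[where \<delta> = r])
        show "(S x / x) powr (q + 1) * E x = S' x" if "x \<in> UNIV" "dist x r < r" for x
          using that r0 by (auto simp: S'_def dist_real_def)
      qed (use r0 in auto)
      then show ?thesis by (rule continuous_at_imp_continuous_within)
    qed
  qed
  show "0 < S' r" if "0 \<le> r" for r by (rule S'_pos[OF that])
qed

end

context growth
begin

section \<open>Asymptotics of the change of variables\<close>

definition A1 where "A1 = min 1 (1 / (n - p))"
definition A2 where "A2 = max 1 (1 / (\<alpha>1 * g 1) + 1 / (n - p) + (ln C / g 1 + c2) / q)"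

lemma A: "0 < A1" "A1 \<le> 1" "1 \<le> A2"
  using p by (auto simp: A1_def A2_def)

lemma g1: "0 < g 1" by (simp add: g_pos)

text \<open>Here q ln S = - ln I, while - (ln Y)/q = ln r + g/(n - p). The three summands of
  \<open>A2\<close> bound ln r, g/(n - p) and the logarithmic loss in \<open>I_lower\<close>, each
  by a multiple of g, using g(r) \<ge> r^\<alpha>1 g(1). Truncation at 1 gives A1 \<le> 1 \<le> A2,
  needed for rescaling the argument of g.\<close>

lemma ln_S_bounds:
  assumes r: "1 \<le> r"
  shows "A1 * g r \<le> ln (S r)" "ln (S r) \<le> A2 * g r"
proof -
  have r0: "0 < r" using r by simp
  have gr: "0 < g r" by (rule g_pos[OF r0])
  have lS: "ln (S r) = - (ln (I r) / q)"
    using r0 I_pos[OF r0] by (simp add: S_def ln_powr)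
  have lY: "ln (Y r) = - (q * ln r) - g r / (p - 1)"
    using r0 by (simp add: Y_def E_def ln_mult ln_powr)
  have gq: "g r / (p - 1) / q = g r / (n - p)" using q(2) by (simp add: mult.commute)
  have LY: "ln (Y r) / q = - ln r - g r / (n - p)"
    unfolding lY diff_divide_distrib gq using q(1) by simp
  have gs: "r powr \<alpha>1 * g 1 \<le> g r" using g_scale[of 1 r] r by simp
  have lr0: "0 \<le> ln r" using r by simp
  have "ln (I r) / q \<le> ln (Y r) / q"
    using I_le[OF r0] I_pos[OF r0] q(1) by (intro divide_right_mono) auto
  then have "g r / (n - p) \<le> ln (S r)" unfolding lS LY using lr0 by linarith
  moreover have "A1 * g r \<le> (1 / (n - p)) * g r" using gr by (intro mult_right_mono) (auto simp: A1_def)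
  ultimately show "A1 * g r \<le> ln (S r)" by simp
  define D where "D = 1 + c2 * g r"
  have D: "1 \<le> D" using c gr by (simp add: D_def)
  have "ln (Y r) \<le> ln (C * D * I r)"
    using I_lower[OF r0] Y_pos[OF r0] I_pos[OF r0] c(3) D by (subst ln_le_cancel_iff) (auto simp: D_def)
  also have "\<dots> = ln C + ln D + ln (I r)"
    using c(3) D I_pos[OF r0] by (simp add: ln_mult)
  finally have "ln (Y r) / q \<le> (ln C + ln D + ln (I r)) / q" using q(1) by (intro divide_right_mono) auto
  then have 1: "ln (S r) \<le> ln r + g r / (n - p) + (ln C + ln D) / q"
    unfolding lS LY add_divide_distrib by linarith
  have "ln D \<le> c2 * g r" unfolding D_def using c(2) gr by (intro ln_add_one_self_le_self) simp
  moreover have "ln C \<le> ln C / g 1 * g r"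
  proof -
    have "1 \<le> r powr \<alpha>1" using r \<alpha>(1) by (simp add: ge_one_powr_ge_zero)
    then have "1 * g 1 \<le> r powr \<alpha>1 * g 1" using g1 by (intro mult_right_mono) auto
    then have "g 1 \<le> g r" using gs by linarith
    then have "1 \<le> g r / g 1" using g1 by (simp add: le_divide_eq)
    then have "ln C * 1 \<le> ln C * (g r / g 1)" using c(3) by (intro mult_left_mono) auto
    then show ?thesis by simp
  qed
  ultimately have "ln C + ln D \<le> (ln C / g 1 + c2) * g r" by (simp add: distrib_right)
  then have "(ln C + ln D) / q \<le> (ln C / g 1 + c2) * g r / q" using q(1) by (intro divide_right_mono) auto
  then have 2: "(ln C + ln D) / q \<le> (ln C / g 1 + c2) / q * g r" by simp
  have "\<alpha>1 * ln r \<le> r powr \<alpha>1"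
    using ln_le_minus_one[of "r powr \<alpha>1"] r0 by (simp add: ln_powr)
  also have "\<dots> \<le> g r / g 1" using gs g1 by (simp add: le_divide_eq)
  finally have "ln r \<le> g r / g 1 / \<alpha>1" using \<alpha>(1) g1 by (simp add: pos_le_divide_eq mult_ac)
  also have "\<dots> = 1 / (\<alpha>1 * g 1) * g r" by (simp add: mult.commute)
  finally have 3: "ln r \<le> 1 / (\<alpha>1 * g 1) * g r" .
  have "ln (S r) \<le> (1 / (\<alpha>1 * g 1) + 1 / (n - p) + (ln C / g 1 + c2) / q) * g r"
    using 1 2 3 by (simp add: distrib_right)
  also have "\<dots> \<le> A2 * g r" using gr by (intro mult_right_mono) (auto simp: A2_def)
  finally show "ln (S r) \<le> A2 * g r" .
qed

definition G where "G = inv_into {0..} g"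

lemma G: "0 \<le> y \<Longrightarrow> 0 \<le> G y" "0 \<le> y \<Longrightarrow> g (G y) = y"
proof -
  assume y: "0 \<le> y"
  \<comment> \<open>Chosen so that t^\<alpha>1 g(1) = y + g(1); then g(t) \<ge> y, and the
    intermediate value theorem applies.\<close>
  define t where "t = (y / g 1 + 1) powr (1 / \<alpha>1)"
  have y1: "1 \<le> y / g 1 + 1" using y g1 by simp
  then have t1: "1 \<le> t" unfolding t_def using \<alpha>(1) by (intro ge_one_powr_ge_zero) auto
  have "t powr \<alpha>1 = y / g 1 + 1" using y1 \<alpha>(1) by (simp add: t_def powr_powr)
  then have "y \<le> g t" using g_scale[of 1 t] t1 g1 by (simp add: distrib_right)
  then obtain x where "0 \<le> x" "g x = y"
    using IVT'[of g 0 y t] y t1 g_0 continuous_on_subset[OF g_cont, of "{0..t}"] by auto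
  then have "y \<in> g ` {0..}" by auto
  then show "0 \<le> G y" "g (G y) = y"
    unfolding G_def using inv_into_into[of y g "{0..}"] f_inv_into_f[of y g "{0..}"] by auto
qed

text \<open>\<open>g_scale\<close> turns constant factors of g into constant factors of its
  argument: g(a r) \<le> A1 g(r) with a^\<alpha>1 = A1, and g(b r) \<ge> A2 g(r) with b^\<alpha>1 =
  A2. Strict monotonicity of g then locates its inverse at ln S(r).\<close>

lemma G_bounds:
  assumes r: "1 \<le> r"
  shows "A1 powr (1 / \<alpha>1) * r \<le> G (ln (S r))" "G (ln (S r)) \<le> A2 powr (1 / \<alpha>1) * r"
proof -
  have r0: "0 < r" using r by simp
  have y0: "0 \<le> ln (S r)" using S_ge[OF r0] r by simp
  note y = ln_S_bounds[OF r]
  define a where "a = A1 powr (1 / \<alpha>1)"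
  define b where "b = A2 powr (1 / \<alpha>1)"
  have a: "0 < a" "a \<le> 1" "a powr \<alpha>1 = A1"
    using A \<alpha>(1) by (auto simp: a_def powr_powr powr_le1)
  have b: "1 \<le> b" "b powr \<alpha>1 = A2"
    using A \<alpha>(1) by (auto simp: b_def powr_powr ge_one_powr_ge_zero)
  have "(r / (a * r)) powr \<alpha>1 * g (a * r) \<le> g r"
    using a r0 by (intro g_scale) auto
  moreover have "(r / (a * r)) powr \<alpha>1 = 1 / A1"
  proof -
    have "r / (a * r) = 1 / a" using r0 by simp
    then show ?thesis using a by (simp add: powr_divide)
  qed
  ultimately have "g (a * r) \<le> A1 * g r" using A(1) by (simp add: divide_le_eq mult.commute)
  then have ga: "g (a * r) \<le> g (G (ln (S r)))" using y(1) G(2)[OF y0] by simp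
  show "A1 powr (1 / \<alpha>1) * r \<le> G (ln (S r))"
  proof (rule ccontr)
    assume "\<not> ?thesis"
    then have "g (G (ln (S r))) < g (a * r)" by (intro g_less G y0) (simp add: a_def)
    with ga show False by simp
  qed
  have "(b * r / r) powr \<alpha>1 * g r \<le> g (b * r)" using b r0 by (intro g_scale) auto
  then have gb: "g (G (ln (S r))) \<le> g (b * r)" using y(2) G(2)[OF y0] b r0 by simp
  show "G (ln (S r)) \<le> A2 powr (1 / \<alpha>1) * r"
  proof (rule ccontr)
    assume "\<not> ?thesis"
    then have "g (b * r) < g (G (ln (S r)))" using b r0 by (intro g_less) (auto simp: b_def)
    with gb show False by simp
  qed
qed

lemma R_ge_1: "S 1 \<le> s \<Longrightarrow> 1 \<le> R s \<and> S (R s) = s \<and> 0 < s"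
proof -
  assume s: "S 1 \<le> s"
  then have "0 < s" using S_pos[of 1] by simp
  moreover from this have "S (R s) = s" using SR by simp
  moreover have "1 \<le> R s"
    using le_iff[of 1 "R s"] R_nonneg[of s] \<open>0 < s\<close> \<open>S (R s) = s\<close> s by simp
  ultimately show ?thesis by simp
qed

lemma R_comparable: "comparable R (\<lambda>s. G (ln s))"
  unfolding comparable_def
proof (intro exI conjI allI impI)
  show "0 < A1 powr (1 / \<alpha>1)" "0 < A2 powr (1 / \<alpha>1)" using A by auto
  show "0 < S 1" by (rule S_pos) simp
  fix s assume "S 1 \<le> s"
  then have r: "1 \<le> R s" "S (R s) = s" using R_ge_1 by auto
  show "A1 powr (1 / \<alpha>1) \<le> G (ln s) / R s" "G (ln s) / R s \<le> A2 powr (1 / \<alpha>1)"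
    using G_bounds[OF r(1)] r by (simp_all add: le_divide_eq divide_le_eq)
qed

text \<open>At r = R s one has I(r) = s^(-q), so the formula for S' can be rewritten through I/Y.
  This reduces the asymptotics of R' to those of R and of I/Y.\<close>

lemma R'_eq: "0 < s \<Longrightarrow> R' s = (R s / s) * (I (R s) / Y (R s))"
proof -
  assume s: "0 < s"
  define r where "r = R s"
  have Sr: "S r = s" using SR s by (simp add: r_def)
  have "r \<noteq> 0" using Sr s by (auto simp: S_def)
  then have r: "0 < r" using R_nonneg[of s] s by (simp add: r_def)
  have "s = I r powr (- 1 / q)" using Sr r by (simp add: S_def)
  then have "s powr (- q) = I r powr ((- 1 / q) * (- q))" by (simp only: powr_powr)
  then have Ir: "I r = s powr (- q)" using q(1) I_pos[OF r] by simp
  have "R' s = inverse ((s / r) powr (q + 1) * E r)"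
    using r Sr by (simp add: R'_def S'_def flip: r_def)
  also have "(s / r) powr (q + 1) = (s / r) powr q * (s / r)"
    using s r powr_add[of "s / r" q 1] by simp
  also have "(s / r) powr q = s powr q / r powr q" using s r by (simp add: powr_divide)
  also have "inverse (s powr q / r powr q * (s / r) * E r) = (r / s) * (s powr (- q) / (r powr (- q) * E r))"
    using s r E_pos[of r] by (simp add: powr_minus field_simps)
  finally show ?thesis by (simp add: Ir Y_def flip: r_def)
qed

text \<open>By \<open>R'_eq\<close> the quotient is the p-th power of G(ln s)/R s divided by ln s
  times I/Y. The first factor is bounded on both sides by \<open>G_bounds\<close>, the second
  because ln s is comparable to g and I/Y to 1/g for radii at least 1.\<close>

lemma R'_comparable:
  "comparable (\<lambda>s. R' s powr p) (\<lambda>s. G (ln s) powr p / ln s powr p * (1 / s powr p))"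
  unfolding comparable_def
proof (intro exI conjI allI impI)
  define a where "a = A1 powr (1 / \<alpha>1)"
  define b where "b = A2 powr (1 / \<alpha>1)"
  \<comment> \<open>\<open>M\<close> and \<open>m\<close> bound ln s times I/Y: they combine
    \<open>ln_S_bounds\<close> with \<open>I_upper\<close> and \<open>I_lower\<close>, where 1 is
    absorbed into g/g(1).\<close>
  define M where "M = A2 / c1"
  define m where "m = A1 / (C * (1 / g 1 + c2))"
  have pos: "0 < a" "0 < b" "0 < M" "0 < m"
    using A c g1 by (auto simp: a_def b_def M_def m_def intro!: divide_pos_pos mult_pos_pos add_pos_pos)
  show "0 < (a / M) powr p" "0 < (b / m) powr p" using pos by auto
  show "0 < S 1" by (rule S_pos) simp
  fix s assume "S 1 \<le> s"
  then have r1: "1 \<le> R s" and Sr: "S (R s) = s" and s: "0 < s" using R_ge_1 by auto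
  define r where "r = R s"
  define y where "y = ln s"
  define k where "k = I r / Y r"
  have r: "0 < r" "1 \<le> r" using r1 by (auto simp: r_def)
  have gr: "0 < g r" "g 1 \<le> g r" using g_pos[OF r(1)] g_le[of 1 r] r by auto
  have y: "A1 * g r \<le> y" "y \<le> A2 * g r" using ln_S_bounds[OF r(2)] Sr by (auto simp: y_def r_def)
  have y0: "0 < y" using y(1) A(1) gr(1) by (meson less_le_trans mult_pos_pos)
  have ab: "a * r \<le> G y" "G y \<le> b * r" using G_bounds[OF r(2)] Sr by (auto simp: a_def b_def y_def r_def)
  have k0: "0 < k" using I_pos[OF r(1)] Y_pos[OF r(1)] by (simp add: k_def)
  have "(1 + c1 * g r) * k \<le> 1" using I_upper[OF r(1)] Y_pos[OF r(1)] by (simp add: k_def divide_le_eq)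
  then have "c1 * g r * k \<le> 1" using k0 by (simp add: distrib_right)
  then have "g r * k \<le> 1 / c1" using c(1) by (simp add: le_divide_eq mult_ac)
  then have "A2 * (g r * k) \<le> A2 * (1 / c1)" using A by (intro mult_left_mono) auto
  moreover have "y * k \<le> A2 * g r * k" using y(2) k0 by (intro mult_right_mono) auto
  ultimately have yM: "y * k \<le> M" by (simp add: M_def mult.assoc)
  have "1 \<le> C * (1 + c2 * g r) * k"
    using I_lower[OF r(1)] Y_pos[OF r(1)] by (simp add: k_def le_divide_eq)
  also have "\<dots> \<le> C * ((1 / g 1 + c2) * g r) * k"
  proof (intro mult_right_mono mult_left_mono)
    have "1 \<le> 1 / g 1 * g r" using gr g1 by (simp add: le_divide_eq)
    then show "1 + c2 * g r \<le> (1 / g 1 + c2) * g r" by (simp add: distrib_right)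
  qed (use k0 c in auto)
  finally have "1 \<le> C * ((1 / g 1 + c2) * g r) * k" .
  moreover have K: "0 < C * (1 / g 1 + c2)" using c g1 by (intro mult_pos_pos add_pos_pos) auto
  ultimately have "1 / (C * (1 / g 1 + c2)) \<le> g r * k"
    using K by (simp add: pos_divide_le_eq mult_ac)
  then have "A1 * (1 / (C * (1 / g 1 + c2))) \<le> A1 * (g r * k)" using A by (intro mult_left_mono) auto
  moreover have "A1 * g r * k \<le> y * k" using y(1) k0 by (intro mult_right_mono) auto
  ultimately have ym: "m \<le> y * k" by (simp add: m_def mult.assoc)
  have R's: "R' s = r / s * k" using R'_eq[OF s] by (simp add: r_def k_def)
  have G0: "0 < G y" using ab(1) pos(1) r(1) by (meson less_le_trans mult_pos_pos)
  have Q: "G y / y * (1 / s) / R' s = (G y / r) / (y * k)"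
    using R's s y0 k0 r(1) by (simp add: field_simps)
  have "G (ln s) powr p / ln s powr p * (1 / s powr p) / R' s powr p = (G y / y * (1 / s) / R' s) powr p"
    using G0 y0 s R's r(1) k0 by (simp add: powr_divide powr_mult less_imp_le flip: y_def)
  then have eq: "G (ln s) powr p / ln s powr p * (1 / s powr p) / R' s powr p = ((G y / r) / (y * k)) powr p"
    unfolding Q .
  have Gr: "a \<le> G y / r" "G y / r \<le> b" using ab r(1) by (simp_all add: le_divide_eq divide_le_eq)
  have "a / M \<le> (G y / r) / (y * k)" using Gr(1) yM pos y0 k0 by (intro frac_le) auto
  then show "(a / M) powr p \<le> G (ln s) powr p / ln s powr p * (1 / s powr p) / R' s powr p"
    unfolding eq using pos p by (intro powr_mono2) auto
  have "(G y / r) / (y * k) \<le> b / m" using Gr(2) ym pos by (intro frac_le) auto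
  then show "G (ln s) powr p / ln s powr p * (1 / s powr p) / R' s powr p \<le> (b / m) powr p"
    unfolding eq using G0 r(1) y0 k0 p by (intro powr_mono2) auto
qed

end

theorem theorem1p5:
  fixes p m \<alpha>1 \<alpha>2 :: real and g g' :: "real \<Rightarrow> real" and f :: "real ^ 'n \<Rightarrow> real"
  assumes "1 < p" and "p < real CARD('n)" and "p + m - 3 > 0"
    and "0 < \<alpha>1" and "\<alpha>1 \<le> \<alpha>2" and "\<alpha>2 < p"
    and "continuous_on {0..} g"
    and "\<And>s. s > 0 \<Longrightarrow> (g has_real_derivative g' s) (at s)" and "continuous_on {0<..} g'"
    and "g 0 = 0" and "\<And>s. s > 0 \<Longrightarrow> g s > 0"
    and "\<And>s. s > 0 \<Longrightarrow> \<alpha>1 * (g s / s) \<le> g' s"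
    and "\<And>s. s > 0 \<Longrightarrow> g' s \<le> \<alpha>2 * (g s / s)"
    and f: "\<And>x. f x = exp (g (norm x))"
  shows "\<exists>\<rho> rhat :: real \<Rightarrow> real.
    continuous_on {0..} \<rho> \<and> (\<forall>s\<ge>0. \<rho> s > 0) \<and>
    bij_betw rhat {0..} {0..} \<and> strict_mono_on {0..} rhat \<and>
    (\<forall>U :: real \<Rightarrow> real \<Rightarrow> real.
      let u = (\<lambda>(x :: real ^ 'n) t. U (norm x) t);
          v = (\<lambda>(x :: real ^ 'n) t. U (rhat (norm x)) t);
          \<rho>' = (\<lambda>x :: real ^ 'n. \<rho> (norm x))
      in (weak_solution p m f f u \<longleftrightarrow> weak_solution p m \<rho>' (\<lambda>_. 1) v) \<and>
         (weak_supersolution p m f f u \<longleftrightarrow> weak_supersolution p m \<rho>' (\<lambda>_. 1) v) \<and>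
         (weak_subsolution p m f f u \<longleftrightarrow> weak_subsolution p m \<rho>' (\<lambda>_. 1) v)) \<and>
    \<rho> 0 = 1 \<and>
    comparable \<rho> (\<lambda>s. (inv_into {0..} g (ln s)) powr p / (ln s) powr p * (1 / s powr p)) \<and>
    comparable rhat (\<lambda>s. inv_into {0..} g (ln s))"
proof -
  define n where "n = CARD('n)"
  interpret growth p "real n" \<alpha>1 \<alpha>2 g g'
    using assms by unfold_locales (auto simp: n_def)
  interpret inv: radial_diffeo R R' by (rule inverse)
  define \<rho> where "\<rho> s = R' s powr p" for s
  \<comment> \<open>1 < p < N excludes dimension one, as the cutoff at the axis requires.\<close>
  have N2: "2 \<le> CARD('n)" using assms(1,2) by linarith
  have sig: "0 < sig p m" using assms(1,3) by (simp add: sig_def)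
  have fc: "continuous_on UNIV f"
  proof -
    have "continuous_on UNIV (\<lambda>x :: real ^ 'n. g (norm x))"
      by (rule continuous_on_compose2[OF g_cont]) (auto intro: continuous_intros)
    then have "continuous_on UNIV (\<lambda>x :: real ^ 'n. exp (g (norm x)))" by (rule continuous_on_exp)
    then show ?thesis by (simp add: f[abs_def])
  qed
  have \<rho>c: "continuous_on {0..} \<rho>"
    unfolding \<rho>_def[abs_def] using inv.pos' by (intro continuous_intros inv.cont') (auto simp: less_imp_neq[symmetric])
  have \<rho>'c: "continuous_on UNIV (\<lambda>x :: real ^ 'n. \<rho> (norm x))"
    by (rule continuous_on_compose2[OF \<rho>c]) (auto intro: continuous_intros)
  have \<rho>pos: "0 < \<rho> s" if "0 \<le> s" for s using inv.pos'[OF that] by (simp add: \<rho>_def)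
  \<comment> \<open>This is the matching of the space terms with b1 = f and b2 = 1; the conditions
    in both directions are derived from it.\<close>
  have J: "radjac S S' x = S' (norm x) powr p * f x" for x :: "real ^ 'n"
  proof (cases "x = 0")
    case True
    then show ?thesis by (simp add: radjac_def radq_def S'_def f g_0)
  next
    case False
    define r where "r = norm x"
    have r: "0 < r" using False by (simp add: r_def)
    define t where "t = S r / r"
    have t: "0 < t" using S_pos[OF r] r by (simp add: t_def)
    have S'r: "S' r = t powr (q + 1) * E r" using r by (simp add: S'_def t_def)
    have "S' r powr (p - 1) = t powr ((q + 1) * (p - 1)) * E r powr (p - 1)"
      unfolding S'r using E_pos[of r] by (simp add: powr_mult powr_powr less_imp_le)
    also have "(q + 1) * (p - 1) = real (n - 1)" using q(3) N2 by (simp add: n_def of_nat_diff)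
    also have "t powr real (n - 1) = t ^ (n - 1)" using t by (simp add: powr_realpow)
    also have "E r powr (p - 1) = exp (- g r)" using assms(1) by (simp add: E_def exp_powr_real)
    finally have e: "S' r powr (p - 1) = t ^ (n - 1) * exp (- g r)" .
    have "S' r powr p = S' r powr (p - 1) * S' r"
      using S'_pos[of r] r powr_add[of "S' r" "p - 1" 1] by simp
    then have "S' r powr p * exp (g r) = t ^ (n - 1) * S' r"
      unfolding e by (simp add: exp_minus)
    then show ?thesis using r by (simp add: radjac_def radq_def f n_def t_def flip: r_def)
  qed
  have R'S: "R' (S r) = inverse (S' r)" if "0 \<le> r" for r using RS[OF that] by (simp add: R'_def)
  have fwd1: "f x = radjac S S' x * \<rho> (norm (radmap S S' x))" for x :: "real ^ 'n"
  proof -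
    have "S' (norm x) powr p * inverse (S' (norm x)) powr p = 1"
      using S'_pos[of "norm x"] by (simp add: inverse_powr)
    then show ?thesis by (simp add: J \<rho>_def norm_radmap R'S)
  qed
  have bwd1: "\<rho> (norm y) = radjac R R' y * f (radmap R R' y)" for y :: "real ^ 'n"
  proof -
    have "radjac R R' y * (S' (R (norm y)) powr p * f (radmap R R' y)) = 1"
      using radjac_inverse[of y] unfolding J by (simp add: inv.norm_radmap)
    then have "inverse (S' (R (norm y)) powr p) = radjac R R' y * f (radmap R R' y)"
      by (intro inverse_unique) (simp add: mult_ac)
    then show ?thesis by (simp add: \<rho>_def R'_def inverse_powr)
  qed
  have f0: "0 \<le> f x" for x by (simp add: f)
  have \<rho>0: "0 \<le> \<rho> (norm x)" for x :: "real ^ 'n" using \<rho>pos[of "norm x"] by simp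
  \<comment> \<open>One transport theorem, used for \<open>S\<close> from the weight f to \<rho> and
    for \<open>R\<close> back again.\<close>
  note fwd = weak_solution_comp[OF assms(1) sig N2 fc fc \<rho>'c continuous_on_const f0 \<rho>0 fwd1]
  note bwd = inv.weak_solution_comp[OF assms(1) sig N2 \<rho>'c continuous_on_const fc fc \<rho>0 f0 bwd1]
  \<comment> \<open>The backward transport starts from the profile U(R s) and yields
    U(R(\<open>inv.R\<close> s)), which is the original U on norms.\<close>
  have RR: "R (inv.R (norm x)) = norm x" for x :: "real ^ 'n" using inv.SR by simp
  have equiv: "let u = (\<lambda>(x :: real ^ 'n) t. U (norm x) t);
          v = (\<lambda>(x :: real ^ 'n) t. U (R (norm x)) t);
          \<rho>' = (\<lambda>x :: real ^ 'n. \<rho> (norm x))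
      in (weak_solution p m f f u \<longleftrightarrow> weak_solution p m \<rho>' (\<lambda>_. 1) v) \<and>
         (weak_supersolution p m f f u \<longleftrightarrow> weak_supersolution p m \<rho>' (\<lambda>_. 1) v) \<and>
         (weak_subsolution p m f f u \<longleftrightarrow> weak_subsolution p m \<rho>' (\<lambda>_. 1) v)" for U
  proof -
    have 1: "S' (norm x) powr p * f x = radjac S S' x * 1" for x :: "real ^ 'n" by (simp add: J)
    have 2: "R' (norm y) powr p * 1 = radjac R R' y * f (radmap R R' y)" for y :: "real ^ 'n"
      using bwd1[of y] by (simp add: \<rho>_def)
    show ?thesis
      using fwd(1)[OF 1, of U] fwd(2)[OF 1, of U] fwd(3)[OF 1, of U]
        bwd(1)[OF 2, of "\<lambda>s. U (R s)"] bwd(2)[OF 2, of "\<lambda>s. U (R s)"] bwd(3)[OF 2, of "\<lambda>s. U (R s)"]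
      unfolding RR Let_def by (intro conjI iffI)
  qed
  have "\<rho> 0 = 1" using inv.zero by (simp add: \<rho>_def R'_def S'_def)
  moreover have "comparable \<rho> (\<lambda>s. (inv_into {0..} g (ln s)) powr p / (ln s) powr p * (1 / s powr p))"
    using R'_comparable by (simp add: \<rho>_def[abs_def] G_def)
  moreover have "comparable R (\<lambda>s. inv_into {0..} g (ln s))"
    using R_comparable by (simp add: G_def)
  ultimately show ?thesis
    using \<rho>c \<rho>pos inv.bij inv.mono equiv by (intro exI[of _ \<rho>] exI[of _ R] conjI allI impI) simp_all
qed

end
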